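(* Assume (Z). For each $h\in\mathcal H$, the function $u=V(\cdot,h)$ is the unique solution, within the class of functions $u\in C([a,b])\cap C^1(\mathcal I)$ with $u''\in L^\infty_{loc}(\mathcal I)$, of the obstacle problem $\min\{(\mathcal L-2r)u(x)+f(x,h),\,M(x)-u(x)\}=0$ for a.e. $x\in\mathcal I$, together with $u(a)=u(b)=0$.
   Context: Let $(\Omega,\mathcal F,\mathsf P)$ carry a standard Brownian motion $W$ with natural filtration $\mathbb F$ satisfying the usual conditions. Fix $r>0$, $\sigma>0$, $K>0$. For $x>0$ let $S^x$ solve $\mathrm dS_t=rS_t\,\mathrm dt+\sigma S_t\,\mathrm dW_t$, $S_0=x$; $\mathsf E_x$ denotes expectation when $S_0=x$. Put $d=2r/\sigma^2$, $\hat a=K/(1+1/d)$, $P(x)=\frac1d\hat a^{1+d}x^{-d}$ for $x\ge\hat a$ and $P(x)=K-x$ for $0\le x\le\hat a$, so $P'(x)=\max\{-(\hat a/x)^{1+d},-1\}$. Fix $\hat a\le a<b<\infty$, $\mathcal I=(a,b)$, $\tau^x_{\mathcal I}=\inf\{t\ge0:S^x_t\notin\mathcal I\}$ (written $\tau_{\mathcal I}$ under $\mathsf E_x$), $\mathcal T_x$ the set of $\mathbb F$-stopping times $\tau\le\tau^x_{\mathcal I}$ a.s., $\mathcal H=[P'(a),P'(b)]$, $f(x,\theta)=(\theta-P'(x))^2\sigma^2x^2$. For $x\in[a,b]$ let $\gamma_1(x)=\mathsf E_x[\int_0^{\tau_{\mathcal I}}e^{-2ru}\sigma^2S_u^2\,\mathrm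 du]$, $\gamma_2(x)=\mathsf E_x[\int_0^{\tau_{\mathcal I}}e^{-2ru}P'(S_u)\sigma^2S_u^2\,\mathrm du]$, $\gamma_3(x)=\mathsf E_x[\int_0^{\tau_{\mathcal I}}e^{-2ru}(P'(S_u))^2\sigma^2S_u^2\,\mathrm du]$; for $x\in\mathcal I$ set $\Gamma(x)=\gamma_2(x)/\gamma_1(x)$ and $M(x)=\gamma_3(x)-\gamma_2(x)^2/\gamma_1(x)$, and set $M(a)=M(b)=0$. For $(x,h)\in[a,b]\times\mathcal H$ define $V(x,h)=\inf_{\tau\in\mathcal T_x}\mathsf E_x\big[\int_0^\tau e^{-2ru}f(S_u,h)\,\mathrm du+e^{-2r\tau}M(S_\tau)\big]$. Let $\mathcal Lv(x)=\frac{\sigma^2}{2}x^2v''(x)+rxv'(x)$ and $G(x,h)=(\mathcal L-2r)M(x)+f(x,h)$ for $x\in\mathcal I$. Assumption (Z): for each $h\in\mathcal H$, the equation $G(x,h)=0$ has at most two roots $x\in\mathcal I$. *)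

theory Defs
  imports "HOL-Probability.Probability"
begin

definition std_BM :: "'a measure \<Rightarrow> (real \<Rightarrow> 'a \<Rightarrow> real) \<Rightarrow> bool" where
  "std_BM Mp W \<longleftrightarrow>
     prob_space Mp \<and>
     (\<forall>t. W t \<in> borel_measurable Mp) \<and>
     (\<forall>\<omega>\<in>space Mp. W 0 \<omega> = 0 \<and> continuous_on {0..} (\<lambda>t. W t \<omega>)) \<and>
     (\<forall>s t. 0 \<le> s \<and> s < t \<longrightarrow>
        distributed Mp lborel (\<lambda>\<omega>. W t \<omega> - W s \<omega>)
          (\<lambda>y. ennreal (normal_density 0 (sqrt (t - s)) y))) \<and>
     (\<forall>(n::nat) (tt::nat \<Rightarrow> real). 0 \<le> tt 0 \<and> (\<forall>i<n. tt i < tt (Suc i)) \<longrightarrow>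
        prob_space.indep_vars Mp (\<lambda>_. borel) (\<lambda>i \<omega>. W (tt (Suc i)) \<omega> - W (tt i) \<omega>) {..<n})"

definition complete_space_measure :: "'a measure \<Rightarrow> bool" where
  "complete_space_measure Mp \<longleftrightarrow> (\<forall>N\<in>null_sets Mp. \<forall>A. A \<subseteq> N \<longrightarrow> A \<in> sets Mp)"

definition natF :: "'a measure \<Rightarrow> (real \<Rightarrow> 'a \<Rightarrow> real) \<Rightarrow> real \<Rightarrow> 'a measure" where
  "natF Mp W t = sigma (space Mp)
     ({{\<omega>\<in>space Mp. W s \<omega> \<in> B} | s B. 0 \<le> s \<and> s \<le> t \<and> B \<in> sets borel} \<union> null_sets Mp)"

text \<open>Geometric Brownian motion: the (explicit) solution of dS = r S dt + sigma S dW, S_0 = x.\<close>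
definition GBM :: "real \<Rightarrow> real \<Rightarrow> (real \<Rightarrow> 'a \<Rightarrow> real) \<Rightarrow> real \<Rightarrow> real \<Rightarrow> 'a \<Rightarrow> real" where
  "GBM r \<sigma> W x t \<omega> = x * exp ((r - \<sigma>\<^sup>2 / 2) * t + \<sigma> * W t \<omega>)"

definition dpar :: "real \<Rightarrow> real \<Rightarrow> real" where
  "dpar r \<sigma> = 2 * r / \<sigma>\<^sup>2"

definition ahat :: "real \<Rightarrow> real \<Rightarrow> real \<Rightarrow> real" where
  "ahat r \<sigma> K = K / (1 + 1 / dpar r \<sigma>)"

text \<open>Derivative of the perpetual put value P.\<close>
definition Pd :: "real \<Rightarrow> real \<Rightarrow> real \<Rightarrow> real \<Rightarrow> real" where
  "Pd r \<sigma> K x = max (- ((ahat r \<sigma> K / x) powr (1 + dpar r \<sigma>))) (-1)"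

definition fcost :: "real \<Rightarrow> real \<Rightarrow> real \<Rightarrow> real \<Rightarrow> real \<Rightarrow> real" where
  "fcost r \<sigma> K x \<theta> = (\<theta> - Pd r \<sigma> K x)\<^sup>2 * \<sigma>\<^sup>2 * x\<^sup>2"

text \<open>Exit time of S^x from (a,b); value \<infinity> if it never exits.\<close>
definition exitT :: "real \<Rightarrow> real \<Rightarrow> (real \<Rightarrow> 'a \<Rightarrow> real) \<Rightarrow> real \<Rightarrow> real \<Rightarrow> real \<Rightarrow> 'a \<Rightarrow> ereal" where
  "exitT r \<sigma> W a b x \<omega> = Inf {ereal t | t. 0 \<le> t \<and> GBM r \<sigma> W x t \<omega> \<notin> {a<..<b}}"

definition stopT :: "'a measure \<Rightarrow> (real \<Rightarrow> 'a \<Rightarrow> real) \<Rightarrow> real \<Rightarrow> real \<Rightarrow> real \<Rightarrow> real \<Rightarrow> real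
                     \<Rightarrow> ('a \<Rightarrow> real) set" where
  "stopT Mp W r \<sigma> a b x = {\<tau>. stopping_time (natF Mp W) \<tau> \<and> (\<forall>\<omega>\<in>space Mp. 0 \<le> \<tau> \<omega>) \<and>
       (AE \<omega> in Mp. ereal (\<tau> \<omega>) \<le> exitT r \<sigma> W a b x \<omega>)}"

definition gam :: "'a measure \<Rightarrow> (real \<Rightarrow> 'a \<Rightarrow> real) \<Rightarrow> real \<Rightarrow> real \<Rightarrow> real \<Rightarrow> real
                   \<Rightarrow> (real \<Rightarrow> real) \<Rightarrow> real \<Rightarrow> real" where
  "gam Mp W r \<sigma> a b g x = (\<integral>\<omega>. interval_lebesgue_integral lborel (ereal 0) (exitT r \<sigma> W a b x \<omega>)
       (\<lambda>u. exp (-2 * r * u) * g (GBM r \<sigma> W x u \<omega>) * \<sigma>\<^sup>2 * (GBM r \<sigma> W x u \<omega>)\<^sup>2) \<partial>Mp)"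

definition Mfun :: "'a measure \<Rightarrow> (real \<Rightarrow> 'a \<Rightarrow> real) \<Rightarrow> real \<Rightarrow> real \<Rightarrow> real \<Rightarrow> real \<Rightarrow> real
                    \<Rightarrow> real \<Rightarrow> real" where
  "Mfun Mp W r \<sigma> K a b x =
     (if a < x \<and> x < b then
        gam Mp W r \<sigma> a b (\<lambda>y. (Pd r \<sigma> K y)\<^sup>2) x
        - (gam Mp W r \<sigma> a b (Pd r \<sigma> K) x)\<^sup>2 / gam Mp W r \<sigma> a b (\<lambda>y. 1) x
      else 0)"

definition Vfun :: "'a measure \<Rightarrow> (real \<Rightarrow> 'a \<Rightarrow> real) \<Rightarrow> real \<Rightarrow> real \<Rightarrow> real \<Rightarrow> real \<Rightarrow> real
                    \<Rightarrow> real \<Rightarrow> real \<Rightarrow> real" where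
  "Vfun Mp W r \<sigma> K a b x h =
     (INF \<tau> \<in> stopT Mp W r \<sigma> a b x.
        (\<integral>\<omega>. interval_lebesgue_integral lborel (ereal 0) (ereal (\<tau> \<omega>))
                 (\<lambda>u. exp (-2 * r * u) * fcost r \<sigma> K (GBM r \<sigma> W x u \<omega>) h)
              + exp (-2 * r * \<tau> \<omega>) * Mfun Mp W r \<sigma> K a b (GBM r \<sigma> W x (\<tau> \<omega>) \<omega>) \<partial>Mp))"

text \<open>G(x,h) = (L - 2r) M(x) + f(x,h).\<close>
definition Gfun :: "'a measure \<Rightarrow> (real \<Rightarrow> 'a \<Rightarrow> real) \<Rightarrow> real \<Rightarrow> real \<Rightarrow> real \<Rightarrow> real \<Rightarrow> real
                    \<Rightarrow> real \<Rightarrow> real \<Rightarrow> real" where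
  "Gfun Mp W r \<sigma> K a b x h =
     \<sigma>\<^sup>2 / 2 * x\<^sup>2 * deriv (deriv (Mfun Mp W r \<sigma> K a b)) x
     + r * x * deriv (Mfun Mp W r \<sigma> K a b) x
     - 2 * r * Mfun Mp W r \<sigma> K a b x + fcost r \<sigma> K x h"

text \<open>u in C([a,b]) \<inter> C^1((a,b)) with weak second derivative u2 in L^\<infinity>_loc((a,b)),
  satisfying min{(L-2r)u + f(.,h), M - u} = 0 a.e. on (a,b) and u(a) = u(b) = 0.\<close>
definition obstacle_solution :: "real \<Rightarrow> real \<Rightarrow> real \<Rightarrow> real \<Rightarrow> (real \<Rightarrow> real) \<Rightarrow> (real \<Rightarrow> real)
                                  \<Rightarrow> (real \<Rightarrow> real) \<Rightarrow> bool" where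
  "obstacle_solution r \<sigma> a b fh Mo u \<longleftrightarrow>
     continuous_on {a..b} u \<and>
     (\<exists>u1 u2. (\<forall>x\<in>{a<..<b}. (u has_real_derivative u1 x) (at x)) \<and>
        continuous_on {a<..<b} u1 \<and>
        u2 \<in> borel_measurable lborel \<and>
        (\<forall>c d. a < c \<and> c \<le> d \<and> d < b \<longrightarrow>
           set_integrable lborel {c..d} u2 \<and>
           u1 d - u1 c = (LBINT t=c..d. u2 t) \<and>
           (\<exists>B. AE t in lborel. t \<in> {c..d} \<longrightarrow> \<bar>u2 t\<bar> \<le> B)) \<and>
        (AE x in lborel. x \<in> {a<..<b} \<longrightarrow>
           min (\<sigma>\<^sup>2 / 2 * x\<^sup>2 * u2 x + r * x * u1 x - 2 * r * u x + fh x) (Mo x - u x) = 0)) \<and>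
     u a = 0 \<and> u b = 0"

end

theory Submission
  imports Defs
begin

text \<open>
  The sources of \<open>\<gamma>\<^sub>1\<close>, \<open>\<gamma>\<^sub>2\<close>, \<open>\<gamma>\<^sub>3\<close> are powers of \<open>x\<close>, so only power functions have to be inserted
  into Dynkin's formula, and for these it follows from the exponential martingales of Brownian motion by
  optional stopping on a grid and passage to the limit. Hence \<open>\<gamma>\<^sub>1\<close>, \<open>\<gamma>\<^sub>2\<close>, \<open>\<gamma>\<^sub>3\<close> are explicit solutions
  of Euler equations. With \<open>U\<close> the cost of never stopping before the exit and \<open>\<phi> = U - M\<close>, the cost of \<open>\<tau>\<close> is
  \<open>U(x)\<close> minus the expectation of \<open>e\<close> to the \<open>-2r\<tau>\<close> times \<open>\<phi>(S\<^sub>\<tau>)\<close>.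

  After division by the decreasing homogeneous solution and in the coordinate that makes all homogeneous
  solutions affine, \<open>U - V\<close> is the smallest concave majorant of \<open>\<phi>\<close>: affine majorants bound the reward
  from above, and exit times of intervals attain the chords. The concave majorant of a twice differentiable
  function is \<open>C\<^sup>1\<close>, with second derivative that of the function where the two touch and zero elsewhere, apart
  from the ends of the gaps of the contact set. Every such gap contains an inflection point of the function,
  i.e. a root of \<open>G(\<cdot>,h)\<close>, so assumption (Z) leaves only finitely many exceptional points. Uniqueness is a
  maximum principle.
\<close>

section \<open>Exponential martingales of Brownian motion\<close>

text \<open>The value function is computed outright: its representation by an envelope comes before
  any differential relation, so nothing has to be verified along paths for a function with only a
  weak second derivative. Powers suffice because \<open>a\<close> is at least \<open>ahat\<close>:
  on that range the cap in \<open>Pd\<close> is inactive.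

  \<open>M\<close> never enters Dynkin's formula. It is a quotient of potentials, of the form 0/0 at
  both ends, and serves only as a terminal payoff; the formula is applied to \<open>U\<close> and to
  homogeneous solutions. With \<Gamma> = \<gamma>2 / \<gamma>1 one has \<phi> = (h - \<Gamma>)^2
  \<gamma>1, and \<Gamma> is bounded; this gives continuity of \<phi> up to the ends.

  Admissible stopping times are real valued, while an exit time may be infinite. Exit times are
  therefore cut off at \<open>N\<close>; the discount factor removes the error, no estimate of their
  distribution is required, and the infimum is reached in the limit. Majorants are exact only up to
  an arbitrary slack, because at an end of the interval the envelope may have infinite slope and
  hence no supporting line.\<close>

lemma normal_exponential_moment:
  fixes c s :: real
  assumes s: "s > 0"
  shows "integrable lborel (\<lambda>y. normal_density 0 s y * exp (c * y))"
    and "(\<integral>y. normal_density 0 s y * exp (c * y) \<partial>lborel) = exp (c\<^sup>2 * s\<^sup>2 / 2)"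
proof -
  \<comment> \<open>Completing the square: the exponential weight shifts the mean from 0 to
    \<open>c * s\<^sup>2\<close> and leaves a constant factor.\<close>
  have *: "normal_density 0 s y * exp (c * y) = exp (c\<^sup>2 * s\<^sup>2 / 2) * normal_density (c * s\<^sup>2) s y" for y
    using s by (simp add: normal_density_def mult_exp_exp power2_eq_square field_simps)
  show "integrable lborel (\<lambda>y. normal_density 0 s y * exp (c * y))"
    unfolding * using s by simp
  show "(\<integral>y. normal_density 0 s y * exp (c * y) \<partial>lborel) = exp (c\<^sup>2 * s\<^sup>2 / 2)"
    unfolding * using s by simp
qed

locale brownian_motion = prob_space Mp for Mp :: "'a measure" +
  fixes W :: "real \<Rightarrow> 'a \<Rightarrow> real"
  assumes bm: "std_BM Mp W"
begin

lemma W_measurable [measurable]: "W t \<in> borel_measurable Mp"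
  using bm by (simp add: std_BM_def)

lemma W_0: "\<omega> \<in> space Mp \<Longrightarrow> W 0 \<omega> = 0"
  using bm by (simp add: std_BM_def)

lemma W_continuous: "\<omega> \<in> space Mp \<Longrightarrow> continuous_on {0..} (\<lambda>t. W t \<omega>)"
  using bm by (simp add: std_BM_def)

lemma W_increment_exponential_moment:
  assumes "0 \<le> s" "s < t"
  shows "integrable Mp (\<lambda>\<omega>. exp (c * (W t \<omega> - W s \<omega>)))"
    and "expectation (\<lambda>\<omega>. exp (c * (W t \<omega> - W s \<omega>))) = exp (c\<^sup>2 * (t - s) / 2)"
proof -
  have D: "distributed Mp lborel (\<lambda>\<omega>. W t \<omega> - W s \<omega>)
      (\<lambda>y. ennreal (normal_density 0 (sqrt (t - s)) y))"
    using bm assms by (simp add: std_BM_def)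
  have s: "sqrt (t - s) > 0" using assms by simp
  show "integrable Mp (\<lambda>\<omega>. exp (c * (W t \<omega> - W s \<omega>)))"
    using distributed_integrable[OF D, of "\<lambda>y. exp (c * y)"] normal_exponential_moment(1)[OF s]
    by simp
  show "expectation (\<lambda>\<omega>. exp (c * (W t \<omega> - W s \<omega>))) = exp (c\<^sup>2 * (t - s) / 2)"
    using distributed_integral[OF D, of "\<lambda>y. exp (c * y)"] normal_exponential_moment(2)[OF s] assms
    by simp
qed

text \<open>A generator of the past that fits a hypothesis speaking only of increments along finite
  grids. Several times are allowed at once so that intersections stay in the class.\<close>

definition cylinders :: "real \<Rightarrow> 'a set set" where
  "cylinders s = {{\<omega>\<in>space Mp. \<forall>u\<in>T. W u \<omega> \<in> B u} | T B.
      finite T \<and> T \<subseteq> {0..s} \<and> (\<forall>u\<in>T. B u \<in> sets borel)}"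

lemma cylinders_sets: "C \<in> cylinders s \<Longrightarrow> C \<in> sets Mp"
  unfolding cylinders_def by (auto intro!: sets.sets_Collect_finite_All)

text \<open>The filtration contains all null sets, so they have to belong to the generator. They do
  not disturb stability, since the intersection of a null set with a measurable set is again
  null.\<close>

lemma Int_stable_cylinders_null: "Int_stable (cylinders s \<union> null_sets Mp)"
proof (rule Int_stableI)
  fix A B assume A: "A \<in> cylinders s \<union> null_sets Mp" and B: "B \<in> cylinders s \<union> null_sets Mp"
  have m: "A \<in> sets Mp" "B \<in> sets Mp"
    using A B cylinders_sets by auto
  consider "A \<in> null_sets Mp" | "B \<in> null_sets Mp" | "A \<in> cylinders s" "B \<in> cylinders s"
    using A B by blast
  then show "A \<inter> B \<in> cylinders s \<union> null_sets Mp"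
  proof cases
    case 1 then show ?thesis using m by (auto intro: null_set_Int2)
  next
    case 2 then show ?thesis using m by (auto intro: null_set_Int1)
  next
    case 3
    obtain T C where T: "finite T" "T \<subseteq> {0..s}" "\<forall>u\<in>T. C u \<in> sets borel"
      and A: "A = {\<omega>\<in>space Mp. \<forall>u\<in>T. W u \<omega> \<in> C u}"
      using 3(1) unfolding cylinders_def by blast
    obtain T' C' where T': "finite T'" "T' \<subseteq> {0..s}" "\<forall>u\<in>T'. C' u \<in> sets borel"
      and B: "B = {\<omega>\<in>space Mp. \<forall>u\<in>T'. W u \<omega> \<in> C' u}"
      using 3(2) unfolding cylinders_def by blast
    let ?D = "\<lambda>u. (if u \<in> T then C u else UNIV) \<inter> (if u \<in> T' then C' u else UNIV)"
    have "A \<inter> B = {\<omega>\<in>space Mp. \<forall>u\<in>T \<union> T'. W u \<omega> \<in> ?D u}"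
      unfolding A B by auto
    moreover have "\<forall>u\<in>T \<union> T'. ?D u \<in> sets borel"
      using T T' by auto
    ultimately have "A \<inter> B \<in> cylinders s"
      using T T' unfolding cylinders_def by (intro CollectI exI[of _ "T \<union> T'"] exI[of _ ?D]) simp
    then show ?thesis by blast
  qed
qed

text \<open>Sort the times of the cylinder together with 0 and \<open>s\<close> into a grid and
  append \<open>t\<close>. As \<open>W\<close> starts at 0, every past value is a partial sum of
  grid increments. The cylinder is thus an event about the first \<open>n\<close> increments, and
  \<open>W t - W s\<close> is the last one, independent of them jointly.\<close>

lemma cylinder_indep_increment:
  assumes C: "C \<in> cylinders s" and st: "0 \<le> s" "s < t" and B: "B \<in> sets borel"
  shows "prob (C \<inter> {\<omega>\<in>space Mp. W t \<omega> - W s \<omega> \<in> B}) =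
         prob C * prob {\<omega>\<in>space Mp. W t \<omega> - W s \<omega> \<in> B}"
proof -
  obtain T D where T: "finite T" "T \<subseteq> {0..s}" "\<forall>u\<in>T. D u \<in> sets borel"
    and Ceq: "C = {\<omega>\<in>space Mp. \<forall>u\<in>T. W u \<omega> \<in> D u}"
    using C unfolding cylinders_def by blast
  define l where "l = sorted_list_of_set (insert 0 (insert s T))"
  have lset: "set l = insert 0 (insert s T)" and ls: "sorted_wrt (<) l"
    using T(1) sorted_list_of_set.set_sorted_key_list_of_set[of "insert 0 (insert s T)"]
      strict_sorted_list_of_set[of "insert 0 (insert s T)"]
    unfolding l_def by (metis finite_insert, metis)
  define n where "n = length l - 1"
  have len: "length l = Suc n"
    using lset by (cases l) (auto simp: n_def)
  have mono: "l ! i < l ! j" if "i < j" "j \<le> n" for i j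
    using ls that len by (simp add: sorted_wrt_iff_nth_less)
  have l0: "l ! 0 = 0"
  proof -
    obtain i where i: "i \<le> n" "l ! i = 0" 
      using lset len by (metis in_set_conv_nth insertI1 less_Suc_eq_le)
    have "l ! 0 \<in> set l" using len by (intro nth_mem) simp
    then have "l ! 0 \<ge> 0" using lset T(2) st by auto
    then show ?thesis using i mono[of 0 i] by (cases "i = 0") auto
  qed
  have ln: "l ! n = s"
  proof -
    obtain i where i: "i \<le> n" "l ! i = s" 
      using lset len by (metis in_set_conv_nth insertI1 insert_commute less_Suc_eq_le)
    have "l ! n \<in> set l" using len by (intro nth_mem) simp
    then have "l ! n \<le> s" using lset T(2) st by auto
    then show ?thesis using i mono[of i n] by (cases "i = n") auto
  qed
  \<comment> \<open>The sorted points occupy the indices 0 to \<open>n\<close> and \<open>t\<close>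
    the index \<open>n + 1\<close>, so increment number \<open>n\<close> is
    \<open>W t - W s\<close>.\<close>
  define tt where "tt i = (if i \<le> n then l ! i else t)" for i
  have inc: "\<forall>i<Suc n. tt i < tt (Suc i)"
    using mono ln st by (auto simp: tt_def less_Suc_eq_le not_less_eq_eq)
  have "0 \<le> tt 0" by (simp add: tt_def l0)
  then have ind: "indep_vars (\<lambda>_. borel) (\<lambda>i \<omega>. W (tt (Suc i)) \<omega> - W (tt i) \<omega>) {..<Suc n}"
    using bm inc unfolding std_BM_def by blast
  let ?X = "\<lambda>i \<omega>. W (tt (Suc i)) \<omega> - W (tt i) \<omega>"
  have ind2: "indep_var (PiM {..<n} (\<lambda>_. borel)) (\<lambda>\<omega>. restrict (\<lambda>i. ?X i \<omega>) {..<n})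
      (PiM {n} (\<lambda>_. borel)) (\<lambda>\<omega>. restrict (\<lambda>i. ?X i \<omega>) {n})"
    by (rule indep_var_restrict[OF ind]) auto
  define idx where "idx u = (SOME i. i \<le> n \<and> l ! i = u)" for u
  have idx: "idx u \<le> n \<and> l ! (idx u) = u" if "u \<in> T" for u
  proof -
    have "u \<in> set l" using lset that by auto
    then have "\<exists>i. i \<le> n \<and> l ! i = u" using len by (metis in_set_conv_nth less_Suc_eq_le)
    then show ?thesis unfolding idx_def by (rule someI_ex)
  qed
  have tel: "W u \<omega> = (\<Sum>i<idx u. ?X i \<omega>)" if "u \<in> T" "\<omega> \<in> space Mp" for u \<omega>
  proof -
    have "(\<Sum>i<idx u. ?X i \<omega>) = W (tt (idx u)) \<omega> - W (tt 0) \<omega>"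
      by (rule sum_lessThan_telescope)
    also have "\<dots> = W u \<omega>" using idx[OF that(1)] W_0[OF that(2)] by (simp add: tt_def l0)
    finally show ?thesis by simp
  qed
  let ?A1 = "{f \<in> space (PiM {..<n} (\<lambda>_. borel :: real measure)). \<forall>u\<in>T. (\<Sum>i<idx u. f i) \<in> D u}"
  let ?A2 = "{f \<in> space (PiM {n} (\<lambda>_. borel :: real measure)). f n \<in> B}"
  have A1: "?A1 \<in> sets (PiM {..<n} (\<lambda>_. borel))"
  proof (rule sets.sets_Collect_finite_All[OF _ T(1)])
    fix u assume u: "u \<in> T"
    have [measurable]: "D u \<in> sets borel" using T u by auto
    have "(\<lambda>f. \<Sum>i<idx u. f i) \<in> borel_measurable (PiM {..<n} (\<lambda>_. borel :: real measure))"
      using idx[OF u] by (intro borel_measurable_sum measurable_component_singleton) auto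
    then show "{f \<in> space (PiM {..<n} (\<lambda>_. borel :: real measure)). (\<Sum>i<idx u. f i) \<in> D u}
        \<in> sets (PiM {..<n} (\<lambda>_. borel))"
      by measurable
  qed
  have A2: "?A2 \<in> sets (PiM {n} (\<lambda>_. borel))"
    using B by measurable
  have sum_eq: "(\<Sum>i<idx u. restrict (\<lambda>i. ?X i \<omega>) {..<n} i) = (\<Sum>i<idx u. ?X i \<omega>)" if "u \<in> T" for u \<omega>
    using idx[OF that] by (intro sum.cong) auto
  have e1: "(\<lambda>\<omega>. restrict (\<lambda>i. ?X i \<omega>) {..<n}) -` ?A1 \<inter> space Mp = C"
    unfolding Ceq using tel sum_eq by (auto simp: space_PiM)
  have e2: "(\<lambda>\<omega>. restrict (\<lambda>i. ?X i \<omega>) {n}) -` ?A2 \<inter> space Mp = {\<omega>\<in>space Mp. W t \<omega> - W s \<omega> \<in> B}"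
    by (auto simp: space_PiM tt_def ln)
  have "prob (((\<lambda>\<omega>. restrict (\<lambda>i. ?X i \<omega>) {..<n}) -` ?A1 \<inter> space Mp) \<inter>
       ((\<lambda>\<omega>. restrict (\<lambda>i. ?X i \<omega>) {n}) -` ?A2 \<inter> space Mp)) =
     prob ((\<lambda>\<omega>. restrict (\<lambda>i. ?X i \<omega>) {..<n}) -` ?A1 \<inter> space Mp) *
     prob ((\<lambda>\<omega>. restrict (\<lambda>i. ?X i \<omega>) {n}) -` ?A2 \<inter> space Mp)"
  proof -
    have "indep_set (sigma_sets (space Mp) { (\<lambda>\<omega>. restrict (\<lambda>i. ?X i \<omega>) {..<n}) -` A \<inter> space Mp | A. A \<in> sets (PiM {..<n} (\<lambda>_. borel))})
      (sigma_sets (space Mp) { (\<lambda>\<omega>. restrict (\<lambda>i. ?X i \<omega>) {n}) -` A \<inter> space Mp | A. A \<in> sets (PiM {n} (\<lambda>_. borel))})"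
      using ind2 unfolding indep_var_eq by blast
    then show ?thesis
      unfolding indep_sets2_eq using A1 A2 by (blast intro: sigma_sets.Basic)
  qed
  then show ?thesis unfolding e1 e2 .
qed

section \<open>The augmented natural filtration and exponential martingales\<close>

lemma space_natF [simp]: "space (natF Mp W t) = space Mp"
  unfolding natF_def by (rule space_measure_of) (auto simp: null_sets_def dest: sets.sets_into_space)

lemma sets_natF: "sets (natF Mp W t) = sigma_sets (space Mp)
     ({{\<omega>\<in>space Mp. W s \<omega> \<in> B} | s B. 0 \<le> s \<and> s \<le> t \<and> B \<in> sets borel} \<union> null_sets Mp)"
  unfolding natF_def by (rule sets_measure_of) (auto simp: null_sets_def dest: sets.sets_into_space)

lemma natF_subset: "A \<in> sets (natF Mp W t) \<Longrightarrow> A \<in> sets Mp"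
proof -
  have "sigma_sets (space Mp)
     ({{\<omega>\<in>space Mp. W s \<omega> \<in> B} | s B. 0 \<le> s \<and> s \<le> t \<and> B \<in> sets borel} \<union> null_sets Mp) \<subseteq> sets Mp"
    by (rule sets.sigma_sets_subset) auto
  then show "A \<in> sets (natF Mp W t) \<Longrightarrow> A \<in> sets Mp" by (auto simp: sets_natF)
qed

lemma W_natF_measurable: "0 \<le> s \<Longrightarrow> s \<le> t \<Longrightarrow> W s \<in> borel_measurable (natF Mp W t)"
proof (rule measurableI)
  fix B :: "real set" assume "0 \<le> s" "s \<le> t" "B \<in> sets borel"
  then show "W s -` B \<inter> space (natF Mp W t) \<in> sets (natF Mp W t)"
    unfolding sets_natF space_natF
    by (intro sigma_sets.Basic UnI1 CollectI exI[of _ s] exI[of _ B]) auto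
qed simp

text \<open>Both families have intersection-stable generators, so the product rule need only be
  checked there: for cylinders it is the grid computation, and for null sets both sides are
  0.\<close>

lemma natF_indep_increment:
  assumes st: "0 \<le> s" "s < t"
  shows "indep_set (sets (natF Mp W s))
    (sigma_sets (space Mp) {(\<lambda>\<omega>. W t \<omega> - W s \<omega>) -` B \<inter> space Mp | B. B \<in> sets borel})"
proof -
  let ?G = "cylinders s \<union> null_sets Mp"
  let ?H = "{(\<lambda>\<omega>. W t \<omega> - W s \<omega>) -` B \<inter> space Mp | B. B \<in> sets borel}"
  have H: "Int_stable ?H"
  proof (rule Int_stableI)
    fix a b assume "a \<in> ?H" "b \<in> ?H"
    then obtain A B where "A \<in> sets borel" "B \<in> sets borel"
      "a = (\<lambda>\<omega>. W t \<omega> - W s \<omega>) -` A \<inter> space Mp" "b = (\<lambda>\<omega>. W t \<omega> - W s \<omega>) -` B \<inter> space Mp"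
      by blast
    then show "a \<inter> b \<in> ?H" by (intro CollectI exI[of _ "A \<inter> B"]) auto
  qed
  have "indep_set ?G ?H"
    unfolding indep_sets2_eq
  proof (intro conjI ballI)
    show "?G \<subseteq> events" using cylinders_sets by auto
    show "?H \<subseteq> events" by auto
    fix A B assume A: "A \<in> ?G" and "B \<in> ?H"
    then obtain D where D: "D \<in> sets borel" "B = {\<omega>\<in>space Mp. W t \<omega> - W s \<omega> \<in> D}" by auto
    have Bm: "B \<in> sets Mp" using D by simp
    from A show "prob (A \<inter> B) = prob A * prob B"
    proof
      assume "A \<in> cylinders s"
      then show ?thesis using cylinder_indep_increment[OF _ st D(1)] D(2) by simp
    next
      assume A: "A \<in> null_sets Mp"
      then have "A \<inter> B \<in> null_sets Mp" using Bm by (rule null_set_Int2)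
      then show ?thesis using A by (simp add: measure_eq_0_null_sets)
    qed
  qed
  then have ind: "indep_set (sigma_sets (space Mp) ?G) (sigma_sets (space Mp) ?H)"
    by (rule indep_set_sigma_sets[OF _ Int_stable_cylinders_null H])
  have "{{\<omega>\<in>space Mp. W u \<omega> \<in> B} | u B. 0 \<le> u \<and> u \<le> s \<and> B \<in> sets borel} \<subseteq> cylinders s"
  proof safe
    fix u B assume "0 \<le> u" "u \<le> s" "B \<in> sets (borel :: real measure)"
    then show "{\<omega>\<in>space Mp. W u \<omega> \<in> B} \<in> cylinders s"
      unfolding cylinders_def by (intro CollectI exI[of _ "{u}"] exI[of _ "\<lambda>_. B"]) auto
  qed
  then have "sets (natF Mp W s) \<subseteq> sigma_sets (space Mp) ?G"
    unfolding sets_natF by (intro sigma_sets_mono') blast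
  then show ?thesis using ind unfolding indep_sets2_eq by blast
qed

text \<open>\<open>exp (c * W t \<omega>)\<close> is a factor known at time \<open>s\<close> times a
  function of the independent increment, whose mean is explicit. The martingale property is stated
  as an identity of integrals over past events \<open>A\<close>, the form in which it is used.
  Integrability at \<open>s\<close> is a hypothesis so that the lemma can be started at time 0,
  which yields integrability at all times.\<close>

lemma exp_martingale:
  fixes c :: real
  assumes st: "0 \<le> s" "s \<le> t" and A: "A \<in> sets (natF Mp W s)"
    and int: "integrable Mp (\<lambda>\<omega>. exp (c * W s \<omega>))"
  shows "integrable Mp (\<lambda>\<omega>. exp (c * W t \<omega>))"
    and "expectation (\<lambda>\<omega>. indicator A \<omega> * exp (c * W t \<omega>)) =
         exp (c\<^sup>2 * (t - s) / 2) * expectation (\<lambda>\<omega>. indicator A \<omega> * exp (c * W s \<omega>))"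
proof -
  have A': "A \<in> sets Mp" using natF_subset[OF A] .
  have main: "integrable Mp (\<lambda>\<omega>. indicator A \<omega> * exp (c * W t \<omega>)) \<and> 
    expectation (\<lambda>\<omega>. indicator A \<omega> * exp (c * W t \<omega>)) =
         exp (c\<^sup>2 * (t - s) / 2) * expectation (\<lambda>\<omega>. indicator A \<omega> * exp (c * W s \<omega>))"
    if A: "A \<in> sets (natF Mp W s)" and less: "s < t" for A
  proof -
    let ?X = "\<lambda>\<omega>. indicator A \<omega> * exp (c * W s \<omega>)" and ?Z = "\<lambda>\<omega>. W t \<omega> - W s \<omega>"
    have A': "A \<in> sets Mp" using natF_subset[OF A] .
    have Xm: "?X \<in> borel_measurable (natF Mp W s)"
      using A W_natF_measurable[OF st(1) order_refl] by measurable
    have "indep_var borel ?X borel ?Z"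
      unfolding indep_var_eq
    proof (intro conjI)
      show "random_variable borel ?X" using A' by measurable
      show "random_variable borel ?Z" by measurable
      have "sigma_sets (space Mp) {?X -` B \<inter> space Mp |B. B \<in> sets borel} \<subseteq> sets (natF Mp W s)"
        using measurable_sets[OF Xm]
        by (intro sets.sigma_sets_subset[of _ "natF Mp W s", simplified]) auto
      then show "indep_set (sigma_sets (space Mp) {?X -` B \<inter> space Mp |B. B \<in> sets borel})
         (sigma_sets (space Mp) {?Z -` B \<inter> space Mp |B. B \<in> sets borel})"
        using natF_indep_increment[OF st(1) less] unfolding indep_sets2_eq by blast
    qed
    then have ind: "indep_var borel (id \<circ> ?X) borel ((\<lambda>z. exp (c * z)) \<circ> ?Z)"
      by (rule indep_var_compose) auto
    have i1: "integrable Mp (id \<circ> ?X)"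
      using integrable_real_mult_indicator[OF A' int] by (simp add: comp_def mult.commute)
    have i2: "integrable Mp ((\<lambda>z. exp (c * z)) \<circ> ?Z)"
      using W_increment_exponential_moment(1)[OF st(1) less] by (simp add: comp_def)
    have eq: "(id \<circ> ?X) \<omega> * ((\<lambda>z. exp (c * z)) \<circ> ?Z) \<omega> = indicator A \<omega> * exp (c * W t \<omega>)" for \<omega>
      by (simp add: mult_exp_exp algebra_simps)
    show ?thesis
      using indep_var_integrable[OF ind i1 i2] indep_var_lebesgue_integral[OF ind i1 i2]
        W_increment_exponential_moment(2)[OF st(1) less, of c]
      unfolding eq by (simp add: comp_def mult.commute)
  qed
  show "integrable Mp (\<lambda>\<omega>. exp (c * W t \<omega>))"
  proof (cases "s < t")
    case True
    have "space Mp \<in> sets (natF Mp W s)" using sets.top[of "natF Mp W s"] by simp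
    from main[OF this True] have "integrable Mp (\<lambda>\<omega>. indicator (space Mp) \<omega> * exp (c * W t \<omega>))" by blast
    then show ?thesis
      by (simp cong: Bochner_Integration.integrable_cong)
  next
    case False then show ?thesis using st int by (cases "s = t") auto
  qed
  show "expectation (\<lambda>\<omega>. indicator A \<omega> * exp (c * W t \<omega>)) =
         exp (c\<^sup>2 * (t - s) / 2) * expectation (\<lambda>\<omega>. indicator A \<omega> * exp (c * W s \<omega>))"
    using main[OF A] st by (cases "s < t") auto
qed

lemma exp_W_integrable: "0 \<le> t \<Longrightarrow> integrable Mp (\<lambda>\<omega>. exp (c * W t \<omega>))"
proof -
  assume t: "0 \<le> t"
  have "integrable Mp (\<lambda>\<omega>. exp (c * W 0 \<omega>))"
    by (rule Bochner_Integration.integrable_cong[OF refl, of _ _ "\<lambda>_. 1::real", THEN iffD2]) (auto simp: W_0)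
  then show ?thesis
    using exp_martingale(1)[OF order_refl t sets.empty_sets] by blast
qed

end

section \<open>Grid approximation\<close>

lemma nat_ceiling_gt_iff: "real k < y \<longleftrightarrow> k < nat \<lceil>y\<rceil>"
  by linarith

text \<open>Times are rounded up to the grid: the rounded time exceeds \<open>k / n\<close> exactly
  if \<open>t\<close> does, so for a stopping time the decision to cross a cell is made at its left
  end.\<close>

lemma ceiling_grid_tendsto:
  fixes t :: real
  shows "(\<lambda>n. of_int \<lceil>real n * t\<rceil> / real n) \<longlonglongrightarrow> t"
proof (rule tendsto_sandwich)
  show "\<forall>\<^sub>F n in sequentially. t \<le> of_int \<lceil>real n * t\<rceil> / real n"
    using eventually_gt_at_top[of 0] by eventually_elim (simp add: field_simps)
  show "\<forall>\<^sub>F n in sequentially. of_int \<lceil>real n * t\<rceil> / real n \<le> t + inverse (real n)"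
    using eventually_gt_at_top[of 0]
  proof eventually_elim
    case (elim n)
    have "of_int \<lceil>real n * t\<rceil> \<le> real n * t + 1" by linarith
    then show ?case using elim by (simp add: field_simps)
  qed
  show "(\<lambda>n. t + inverse (real n)) \<longlonglongrightarrow> t"
    using tendsto_add[OF tendsto_const LIMSEQ_inverse_real_of_nat[THEN LIMSEQ_imp_Suc], of t] by simp
qed simp

lemma grid_sum_eq:
  fixes t :: real and f :: "nat \<Rightarrow> real"
  assumes "t \<le> real N" "n > 0"
  shows "(\<Sum>k<N * n. if real k / real n < t then f k else 0) = (\<Sum>k<nat \<lceil>real n * t\<rceil>. f k)"
proof -
  define m where "m = nat \<lceil>real n * t\<rceil>"
  have iff: "real k / real n < t \<longleftrightarrow> k < m" for k
    using assms(2) nat_ceiling_gt_iff[of k "real n * t"] by (simp add: m_def field_simps)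
  have "real n * t \<le> real (N * n)" using assms by (simp add: mult.commute)
  then have "m \<le> N * n" unfolding m_def by linarith
  then have "(\<Sum>k<N * n. if k < m then f k else 0) = (\<Sum>k<m. f k)"
    by (intro sum.mono_neutral_cong_right) auto
  then show ?thesis unfolding iff m_def .
qed

text \<open>The range of summation does not depend on \<open>t\<close>; the cut-off sits in the
  summand. With a random time in place of \<open>t\<close>, expectations can then be taken term by
  term.\<close>

lemma grid_telescope:
  fixes t :: real and y :: "real \<Rightarrow> real"
  assumes "0 \<le> t" "t \<le> real N" "n > 0"
  shows "y (of_int \<lceil>real n * t\<rceil> / real n) =
    y 0 + (\<Sum>k<N * n. if real k / real n < t then y (real (Suc k) / real n) - y (real k / real n) else 0)"
proof -
  have "0 \<le> real n * t" using assms by simp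
  then have "real (nat \<lceil>real n * t\<rceil>) = of_int \<lceil>real n * t\<rceil>" by simp
  then show ?thesis
    unfolding grid_sum_eq[OF assms(2,3)]
    by (subst sum_lessThan_telescope[of "\<lambda>k. y (real k / real n)"]) simp
qed

text \<open>Compare with the primitive \<open>\<Phi>\<close> cell by cell: by the mean value theorem
  its increment is \<open>1 / n\<close> times a value of \<open>y\<close> inside the cell, which is
  close to the value at the left end by uniform continuity. The rounding of \<open>t\<close> is
  absorbed by continuity of \<open>\<Phi>\<close>.\<close>

lemma Riemann_sum_tendsto:
  fixes t :: real and y :: "real \<Rightarrow> real"
  assumes y: "continuous_on {0..real N} y" and t: "0 \<le> t" "t \<le> real N"
  shows "(\<lambda>n. (\<Sum>k<N * n. if real k / real n < t then y (real k / real n) else 0) / real n)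
    \<longlonglongrightarrow> integral {0..t} y"
proof -
  define \<Phi> where "\<Phi> u = integral {0..u} y" for u
  define T where "T n = of_int \<lceil>real n * t\<rceil> / real n" for n
  have \<Phi>': "(\<Phi> has_real_derivative y u) (at u within {0..real N})" if "u \<in> {0..real N}" for u
    unfolding \<Phi>_def using integral_has_real_derivative[OF y that] .
  have T: "T n \<in> {0..real N}" if "n > 0" for n
  proof -
    have "real n * t \<le> real (N * n)" using that t by (simp add: mult.commute)
    then have "\<lceil>real n * t\<rceil> \<le> int (N * n)" by linarith
    then have "of_int \<lceil>real n * t\<rceil> \<le> real (N * n)" by linarith
    moreover have "0 \<le> real n * t" using t by simp
    ultimately show ?thesis using that by (simp add: T_def field_simps)
  qed
  have "continuous_on {0..real N} \<Phi>"
    using \<Phi>' by (rule DERIV_continuous_on)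
  then have lim\<Phi>: "(\<lambda>n. \<Phi> (T n)) \<longlonglongrightarrow> \<Phi> t"
  proof (rule continuous_on_tendsto_compose)
    show "T \<longlonglongrightarrow> t" using ceiling_grid_tendsto[of t] unfolding T_def .
    show "\<forall>\<^sub>F n in sequentially. T n \<in> {0..real N}"
      using eventually_gt_at_top[of 0] by eventually_elim (rule T)
  qed (use t in simp)
  have "(\<lambda>n. (\<Sum>k<N * n. if real k / real n < t then y (real k / real n) else 0) / real n - \<Phi> (T n))
      \<longlonglongrightarrow> 0"
  proof (rule LIMSEQ_I)
    fix e :: real assume e: "0 < e"
    \<comment> \<open>The errors add up to at most \<open>real N * e'\<close>; the added 1 keeps
      this strictly below \<open>e\<close>, also for \<open>N = 0\<close>.\<close>
    define e' where "e' = e / (real N + 1)"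
    have e': "e' > 0" using e by (simp add: e'_def)
    have "uniformly_continuous_on {0..real N} y"
      using y by (rule compact_uniformly_continuous) simp
    then obtain d where d: "d > 0"
      "\<And>u v. u \<in> {0..real N} \<Longrightarrow> v \<in> {0..real N} \<Longrightarrow> dist v u < d \<Longrightarrow> dist (y v) (y u) < e'"
      unfolding uniformly_continuous_on_def using e' by meson
    obtain n0 where n0: "n0 > 0" "inverse (real n0) < d"
      using reals_Archimedean[OF d(1)] by (metis zero_less_Suc)
    show "\<exists>no. \<forall>n\<ge>no. norm ((\<Sum>k<N * n. if real k / real n < t then y (real k / real n) else 0) / real n
        - \<Phi> (T n) - 0) < e"
    proof (intro exI[of _ n0] allI impI)
      fix n assume n: "n \<ge> n0"
      then have npos: "n > 0" using n0 by simp
      have inv: "inverse (real n) < d"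
        using n0 n by (meson le_imp_inverse_le less_le_trans not_less of_nat_0_less_iff of_nat_le_iff)
      let ?m = "nat \<lceil>real n * t\<rceil>"
      have "real n * t \<ge> 0" using t by simp
      then have m: "real ?m / real n = T n" by (simp add: T_def)
      have tel: "\<Phi> (T n) = (\<Sum>k<?m. \<Phi> (real (Suc k) / real n) - \<Phi> (real k / real n))"
        by (subst sum_lessThan_telescope[of "\<lambda>k. \<Phi> (real k / real n)"]) (simp add: m, simp add: \<Phi>_def)
      have step: "\<bar>y (real k / real n) / real n - (\<Phi> (real (Suc k) / real n) - \<Phi> (real k / real n))\<bar>
          \<le> e' / real n" if k: "k < ?m" for k
      proof -
        have le: "real (Suc k) / real n \<le> T n"
          unfolding m[symmetric] using k npos by (intro divide_right_mono) auto
        then have leN: "real (Suc k) / real n \<le> real N" using T[OF npos] by simp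
        have lt: "real k / real n < real (Suc k) / real n" using npos by (simp add: field_simps)
        have "\<exists>z\<in>{real k / real n<..<real (Suc k) / real n}.
            \<Phi> (real (Suc k) / real n) - \<Phi> (real k / real n)
              = y z * (real (Suc k) / real n - real k / real n)"
        proof (rule mvt_simple[OF lt])
          fix u assume u: "real k / real n \<le> u" "u \<le> real (Suc k) / real n"
          then have "u \<in> {0..real N}"
            using leN order_trans[of 0 "real k / real n" u] by simp
          then have "(\<Phi> has_real_derivative y u) (at u within {0..real N})" by (rule \<Phi>')
          moreover have "{real k / real n..real (Suc k) / real n} \<subseteq> {0..real N}"
            using leN order_trans[of 0 "real k / real n"] by auto
          ultimately show "(\<Phi> has_derivative (*) (y u)) (at u within {real k / real n..real (Suc k) / real n})"
            by (metis DERIV_subset has_field_derivative_def)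
        qed
        then obtain z where z: "real k / real n < z" "z < real (Suc k) / real n"
          "\<Phi> (real (Suc k) / real n) - \<Phi> (real k / real n) = (real (Suc k) / real n - real k / real n) * y z"
          by (auto simp: mult.commute)
        have w: "real (Suc k) / real n - real k / real n = 1 / real n"
          by (simp add: add_divide_distrib)
        have "dist (real k / real n) z < d"
          using z(1,2) w inv by (simp add: dist_real_def inverse_eq_divide)
        moreover have "real k / real n \<in> {0..real N}" "z \<in> {0..real N}"
          using z(1,2) leN lt order_trans[of 0 "real k / real n" z] by auto
        ultimately have "\<bar>y (real k / real n) - y z\<bar> < e'"
          using d(2) by (metis dist_real_def)
        then have "\<bar>y (real k / real n) - y z\<bar> / real n \<le> e' / real n"
          by (intro divide_right_mono) auto
        moreover have "y (real k / real n) / real n - (\<Phi> (real (Suc k) / real n) - \<Phi> (real k / real n))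
          = (y (real k / real n) - y z) / real n"
          unfolding z(3) w by (simp add: diff_divide_distrib)
        ultimately show ?thesis by simp
      qed
      have "\<bar>(\<Sum>k<?m. y (real k / real n)) / real n - \<Phi> (T n)\<bar>
          = \<bar>\<Sum>k<?m. y (real k / real n) / real n - (\<Phi> (real (Suc k) / real n) - \<Phi> (real k / real n))\<bar>"
        unfolding tel sum_divide_distrib sum_subtractf[symmetric] ..
      also have "\<dots> \<le> (\<Sum>k<?m. e' / real n)"
        by (rule order_trans[OF sum_abs]) (intro sum_mono step, simp)
      also have "\<dots> = T n * e'" by (simp add: m[symmetric])
      also have "\<dots> \<le> real N * e'" using T[OF npos] e' by (intro mult_right_mono) auto
      also have "\<dots> < e" using e by (simp add: e'_def field_simps)
      finally show "norm ((\<Sum>k<N * n. if real k / real n < t then y (real k / real n) else 0) / real n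
        - \<Phi> (T n) - 0) < e"
        unfolding grid_sum_eq[OF t(2) npos] by simp
    qed
  qed
  from tendsto_add[OF this lim\<Phi>] show ?thesis unfolding \<Phi>_def by simp
qed

lemma (in prob_space) expectation_tendsto_of_L2_bounded:
  fixes Y :: "nat \<Rightarrow> 'a \<Rightarrow> real" and Z :: "'a \<Rightarrow> real"
  assumes Y: "\<And>n. integrable M (Y n)" "\<And>n. integrable M (\<lambda>\<omega>. (Y n \<omega>)\<^sup>2)"
      "\<And>n. expectation (\<lambda>\<omega>. (Y n \<omega>)\<^sup>2) \<le> B" 
    and Z: "Z \<in> borel_measurable M" "AE \<omega> in M. \<bar>Z \<omega>\<bar> \<le> C"
    and nonneg: "\<And>n. AE \<omega> in M. 0 \<le> Y n \<omega>"
    and lim: "AE \<omega> in M. (\<lambda>n. Y n \<omega>) \<longlonglongrightarrow> Z \<omega>"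
  shows "(\<lambda>n. expectation (Y n)) \<longlonglongrightarrow> expectation Z"
proof (rule LIMSEQ_I)
  fix e :: real assume e: "0 < e"
  \<comment> \<open>\<open>D \<ge> C\<close> means that truncation does not change the limit
    \<open>Z\<close>; the last entry makes the tail \<open>\<bar>B\<bar> / D\<close> smaller than
    \<open>e / 2\<close>.\<close>
  define D where "D = max (max C 1) (2 * (\<bar>B\<bar> + 1) / e)"
  have D: "D \<ge> 1" "D \<ge> C" "D \<ge> 2 * (\<bar>B\<bar> + 1) / e" by (auto simp: D_def)
  have [measurable]: "Y n \<in> borel_measurable M" for n using Y(1) by auto
  note Z(1)[measurable]
  have "(\<lambda>n. expectation (\<lambda>\<omega>. min (Y n \<omega>) D)) \<longlonglongrightarrow> expectation (\<lambda>\<omega>. min (Z \<omega>) D)"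
  proof (rule integral_dominated_convergence[where w="\<lambda>_. D"])
    show "AE \<omega> in M. (\<lambda>n. min (Y n \<omega>) D) \<longlonglongrightarrow> min (Z \<omega>) D"
      using lim by eventually_elim (intro tendsto_intros)
    show "AE \<omega> in M. norm (min (Y n \<omega>) D) \<le> D" for n
      using nonneg[of n] by eventually_elim (use D in auto)
  qed auto
  moreover have "expectation (\<lambda>\<omega>. min (Z \<omega>) D) = expectation Z"
    using Z(2) D by (intro integral_cong_AE) auto
  ultimately have "(\<lambda>n. expectation (\<lambda>\<omega>. min (Y n \<omega>) D)) \<longlonglongrightarrow> expectation Z" by simp
  from LIMSEQ_D[OF this, of "e/2"] e obtain n0 where
    n0: "\<And>n. n \<ge> n0 \<Longrightarrow> \<bar>expectation (\<lambda>\<omega>. min (Y n \<omega>) D) - expectation Z\<bar> < e / 2" by auto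
  have tail: "\<bar>expectation (Y n) - expectation (\<lambda>\<omega>. min (Y n \<omega>) D)\<bar> < e / 2" for n
  proof -
    have i: "integrable M (\<lambda>\<omega>. min (Y n \<omega>) D)"
      using Y(1) by (intro integrable_min) auto
    have "expectation (Y n) - expectation (\<lambda>\<omega>. min (Y n \<omega>) D)
      = expectation (\<lambda>\<omega>. Y n \<omega> - min (Y n \<omega>) D)"
      using Y(1) i by (simp add: Bochner_Integration.integral_diff)
    moreover have "0 \<le> expectation (\<lambda>\<omega>. Y n \<omega> - min (Y n \<omega>) D)"
      by (intro integral_nonneg_AE) auto
    moreover have "expectation (\<lambda>\<omega>. Y n \<omega> - min (Y n \<omega>) D) \<le> expectation (\<lambda>\<omega>. (Y n \<omega>)\<^sup>2 / D)"
    proof (rule integral_mono)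
      fix \<omega>
      have "(Y n \<omega> - D) * D \<le> (Y n \<omega>)\<^sup>2"
      proof -
        have "(Y n \<omega> - D) * D = (Y n \<omega>)\<^sup>2 - (Y n \<omega> - D / 2)\<^sup>2 - 3 / 4 * D\<^sup>2"
          by (simp add: power2_eq_square algebra_simps)
        then show ?thesis
          using zero_le_power2[of "Y n \<omega> - D / 2"] zero_le_power2[of D] by linarith
      qed
      then show "Y n \<omega> - min (Y n \<omega>) D \<le> (Y n \<omega>)\<^sup>2 / D"
        using D by (cases "Y n \<omega> \<le> D") (auto simp: pos_le_divide_eq)
    qed (use Y i in auto)
    moreover have "expectation (\<lambda>\<omega>. (Y n \<omega>)\<^sup>2 / D) \<le> \<bar>B\<bar> / D"
      using Y(3)[of n] D by (simp add: divide_right_mono)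
    moreover have "\<bar>B\<bar> / D < e / 2"
    proof -
      have "2 * (\<bar>B\<bar> + 1) \<le> D * e" using D(3) e by (simp add: pos_divide_le_eq)
      then show ?thesis using D(1) by (simp add: field_simps)
    qed
    ultimately show ?thesis by linarith
  qed
  show "\<exists>no. \<forall>n\<ge>no. norm (expectation (Y n) - expectation Z) < e"
  proof (intro exI[of _ n0] allI impI)
    fix n assume "n \<ge> n0"
    then show "norm (expectation (Y n) - expectation Z) < e"
      using n0[of n] tail[of n] unfolding real_norm_def by linarith
  qed
qed

section \<open>Dynkin's formula for powers of geometric Brownian motion\<close>

locale gbm = brownian_motion +
  fixes r \<sigma> a b :: real
  assumes r_pos: "r > 0" and \<sigma>_pos: "\<sigma> > 0" and a_pos: "0 < a" and a_less_b: "a < b"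
begin

abbreviation S :: "real \<Rightarrow> real \<Rightarrow> 'a \<Rightarrow> real" where
  "S \<equiv> GBM r \<sigma> W"

lemma S_pos: "x > 0 \<Longrightarrow> S x t \<omega> > 0"
  by (simp add: GBM_def)

lemma S_0: "\<omega> \<in> space Mp \<Longrightarrow> S x 0 \<omega> = x"
  by (simp add: GBM_def W_0)

lemma S_continuous: "\<omega> \<in> space Mp \<Longrightarrow> continuous_on {0..} (\<lambda>t. S x t \<omega>)"
  unfolding GBM_def using W_continuous by (intro continuous_intros)

lemma S_measurable [measurable]: "S x t \<in> borel_measurable Mp"
  unfolding GBM_def by measurable

lemma S_natF_measurable: "0 \<le> s \<Longrightarrow> s \<le> t \<Longrightarrow> S x s \<in> borel_measurable (natF Mp W t)"
  using W_natF_measurable unfolding GBM_def by measurable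

text \<open>The eigenvalue of the generator minus \<open>l\<close> on the power with exponent
  \<open>p\<close>. The rate \<open>l\<close> stays variable because squaring a discounted power
  doubles both parameters, which makes second moments instances of the same formulas.\<close>

definition symbol :: "real \<Rightarrow> real \<Rightarrow> real" where
  "symbol l p = \<sigma>\<^sup>2 / 2 * p * (p - 1) + r * p - l"

definition Y :: "real \<Rightarrow> real \<Rightarrow> real \<Rightarrow> real \<Rightarrow> 'a \<Rightarrow> real" where
  "Y l p x t \<omega> = exp (- l * t) * S x t \<omega> powr p"

lemma Y_eq_exp:
  assumes "x > 0"
  shows "Y l p x t \<omega> = x powr p * exp (((r - \<sigma>\<^sup>2 / 2) * p - l) * t) * exp ((p * \<sigma>) * W t \<omega>)"
  using assms unfolding Y_def GBM_def
  by (simp add: powr_mult powr_def[of "exp _"] mult_exp_exp algebra_simps)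

lemma Y_nonneg: "0 \<le> Y l p x t \<omega>"
  by (simp add: Y_def)

lemma Y_measurable [measurable]: "Y l p x t \<in> borel_measurable Mp"
  unfolding Y_def by measurable

lemma Y_square: "(Y l p x t \<omega>)\<^sup>2 = Y (2 * l) (2 * p) x t \<omega>"
  unfolding Y_def power_mult_distrib
  by (simp add: power2_eq_square mult_exp_exp powr_add[symmetric])

lemma Y_continuous: "x > 0 \<Longrightarrow> \<omega> \<in> space Mp \<Longrightarrow> continuous_on {0..} (\<lambda>t. Y l p x t \<omega>)"
  unfolding Y_def using S_continuous S_pos[of x]
  by (intro continuous_intros) (auto simp: less_imp_neq[THEN not_sym])

lemma Y_integrable: "x > 0 \<Longrightarrow> 0 \<le> t \<Longrightarrow> integrable Mp (Y l p x t)"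
proof -
  assume "x > 0" "0 \<le> t"
  then have "integrable Mp (\<lambda>\<omega>. x powr p * exp (((r - \<sigma>\<^sup>2 / 2) * p - l) * t) * exp ((p * \<sigma>) * W t \<omega>))"
    using exp_W_integrable[of t "p * \<sigma>"] by simp
  then show ?thesis by (simp add: Y_eq_exp[OF \<open>x > 0\<close>, symmetric])
qed

text \<open>The drift contributes \<open>(r - \<sigma>\<^sup>2 / 2) * p - l\<close> to the growth
  rate, the Gaussian exponential moment \<open>p\<^sup>2 * \<sigma>\<^sup>2 / 2\<close>; the sum is
  \<open>symbol l p\<close>.\<close>

lemma Y_step:
  assumes x: "x > 0" and st: "0 \<le> s" "s \<le> t" and A: "A \<in> sets (natF Mp W s)"
  shows "expectation (\<lambda>\<omega>. indicator A \<omega> * Y l p x t \<omega>) =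
    exp (symbol l p * (t - s)) * expectation (\<lambda>\<omega>. indicator A \<omega> * Y l p x s \<omega>)"
proof -
  let ?m = "(r - \<sigma>\<^sup>2 / 2) * p - l"
  have Y: "indicator A \<omega> * Y l p x u \<omega> =
      (x powr p * exp (?m * u)) * (indicator A \<omega> * exp ((p * \<sigma>) * W u \<omega>))" for u \<omega>
    unfolding Y_eq_exp[OF x] by simp
  have "exp (?m * t) * exp ((p * \<sigma>)\<^sup>2 * (t - s) / 2) = exp (symbol l p * (t - s)) * exp (?m * s)"
    unfolding mult_exp_exp symbol_def by (simp add: algebra_simps power2_eq_square add_divide_distrib diff_divide_distrib)
  then show ?thesis
    unfolding Y using exp_martingale(2)[OF st A exp_W_integrable[OF st(1)], of "p * \<sigma>"] by simp
qed

lemma stopping_time_gt_event: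
  "stopping_time (natF Mp W) \<tau> \<Longrightarrow> {\<omega>\<in>space Mp. s < \<tau> \<omega>} \<in> sets (natF Mp W s)"
proof -
  assume "stopping_time (natF Mp W) \<tau>"
  then have "{\<omega>\<in>space (natF Mp W s). \<tau> \<omega> \<le> s} \<in> sets (natF Mp W s)"
    unfolding stopping_time_def by (simp add: pred_def)
  then have "space (natF Mp W s) - {\<omega>\<in>space (natF Mp W s). \<tau> \<omega> \<le> s} \<in> sets (natF Mp W s)"
    by (rule sets.compl_sets)
  also have "space (natF Mp W s) - {\<omega>\<in>space (natF Mp W s). \<tau> \<omega> \<le> s} = {\<omega>\<in>space Mp. s < \<tau> \<omega>}"
    by auto
  finally show ?thesis .
qed

lemma stopping_time_random_variable:
  assumes "stopping_time (natF Mp W) \<tau>" shows "\<tau> \<in> borel_measurable Mp"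
  unfolding borel_measurable_iff_greater
  using stopping_time_gt_event[OF assms] natF_subset by blast

text \<open>Dynkin's formula in discrete time. The process at the rounded time is telescoped over
  the cells. Whether the cell starting at \<open>k / n\<close> is crossed is known at its left end,
  so the increment over it has as expectation \<open>exp (symbol l p / n) - 1\<close> times that of
  the value there.\<close>

lemma grid_expectation:
  assumes x: "x > 0" and st: "stopping_time (natF Mp W) \<tau>"
    and \<tau>: "\<And>\<omega>. \<omega> \<in> space Mp \<Longrightarrow> 0 \<le> \<tau> \<omega> \<and> \<tau> \<omega> \<le> real N" and n: "n > 0"
  shows "integrable Mp (\<lambda>\<omega>. Y l p x (of_int \<lceil>real n * \<tau> \<omega>\<rceil> / real n) \<omega>)"
    and "expectation (\<lambda>\<omega>. Y l p x (of_int \<lceil>real n * \<tau> \<omega>\<rceil> / real n) \<omega>) = x powr p +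
      (exp (symbol l p / real n) - 1) *
      (\<Sum>k<N * n. expectation (\<lambda>\<omega>. indicator {\<omega>\<in>space Mp. real k / real n < \<tau> \<omega>} \<omega> * Y l p x (real k / real n) \<omega>))"
proof -
  let ?A = "\<lambda>k. {\<omega>\<in>space Mp. real k / real n < \<tau> \<omega>}"
  have A: "?A k \<in> sets (natF Mp W (real k / real n))" for k
    using stopping_time_gt_event[OF st] .
  have A': "?A k \<in> sets Mp" for k using natF_subset[OF A] .
  have eq: "Y l p x (of_int \<lceil>real n * \<tau> \<omega>\<rceil> / real n) \<omega> = x powr p +
      (\<Sum>k<N * n. indicator (?A k) \<omega> * Y l p x (real (Suc k) / real n) \<omega>
        - indicator (?A k) \<omega> * Y l p x (real k / real n) \<omega>)" if \<omega>: "\<omega> \<in> space Mp" for \<omega>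
  proof -
    have "Y l p x (of_int \<lceil>real n * \<tau> \<omega>\<rceil> / real n) \<omega> = Y l p x 0 \<omega> +
      (\<Sum>k<N * n. if real k / real n < \<tau> \<omega> then Y l p x (real (Suc k) / real n) \<omega> - Y l p x (real k / real n) \<omega> else 0)"
      using \<tau>[OF \<omega>] n by (intro grid_telescope) auto
    also have "Y l p x 0 \<omega> = x powr p" using S_0[OF \<omega>] by (simp add: Y_def)
    also have "(\<Sum>k<N * n. if real k / real n < \<tau> \<omega> then Y l p x (real (Suc k) / real n) \<omega> - Y l p x (real k / real n) \<omega> else 0)
      = (\<Sum>k<N * n. indicator (?A k) \<omega> * Y l p x (real (Suc k) / real n) \<omega>
        - indicator (?A k) \<omega> * Y l p x (real k / real n) \<omega>)"
      by (rule sum.cong[OF refl]) (simp only: indicator_def mem_Collect_eq \<omega> simp_thms, simp)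
    finally show ?thesis .
  qed
  have i: "integrable Mp (\<lambda>\<omega>. indicator (?A k) \<omega> * Y l p x t \<omega>)" if "0 \<le> t" for k t
    using integrable_real_mult_indicator[OF A' Y_integrable[OF x that]] by (simp add: mult.commute)
  show "integrable Mp (\<lambda>\<omega>. Y l p x (of_int \<lceil>real n * \<tau> \<omega>\<rceil> / real n) \<omega>)"
    by (subst Bochner_Integration.integrable_cong[OF refl eq]) 
       (auto intro!: Bochner_Integration.integrable_add Bochner_Integration.integrable_sum
          Bochner_Integration.integrable_diff i)
  have "expectation (\<lambda>\<omega>. Y l p x (of_int \<lceil>real n * \<tau> \<omega>\<rceil> / real n) \<omega>) =
      expectation (\<lambda>\<omega>. x powr p + (\<Sum>k<N * n. indicator (?A k) \<omega> * Y l p x (real (Suc k) / real n) \<omega>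
        - indicator (?A k) \<omega> * Y l p x (real k / real n) \<omega>))"
    by (rule Bochner_Integration.integral_cong[OF refl eq])
  also have "\<dots> = x powr p + (\<Sum>k<N * n. expectation (\<lambda>\<omega>. indicator (?A k) \<omega> * Y l p x (real (Suc k) / real n) \<omega>)
        - expectation (\<lambda>\<omega>. indicator (?A k) \<omega> * Y l p x (real k / real n) \<omega>))"
    by (subst Bochner_Integration.integral_add Bochner_Integration.integral_sum Bochner_Integration.integral_diff;
        (intro Bochner_Integration.integrable_sum Bochner_Integration.integrable_diff i)?; simp add: prob_space i)+
  also have "\<dots> = x powr p + (\<Sum>k<N * n. (exp (symbol l p / real n) - 1) *
      expectation (\<lambda>\<omega>. indicator (?A k) \<omega> * Y l p x (real k / real n) \<omega>))"
  proof (intro arg_cong2[where f="(+)"] refl sum.cong)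
    fix k
    have le: "real k / real n \<le> real (Suc k) / real n" by (simp add: divide_right_mono)
    have diff: "real (Suc k) / real n - real k / real n = 1 / real n"
      by (simp add: add_divide_distrib)
    from Y_step[OF x _ le A, of l p, unfolded diff]
    show "expectation (\<lambda>\<omega>. indicator (?A k) \<omega> * Y l p x (real (Suc k) / real n) \<omega>)
        - expectation (\<lambda>\<omega>. indicator (?A k) \<omega> * Y l p x (real k / real n) \<omega>) =
        (exp (symbol l p / real n) - 1) * expectation (\<lambda>\<omega>. indicator (?A k) \<omega> * Y l p x (real k / real n) \<omega>)"
      by (simp add: left_diff_distrib)
  qed
  finally show "expectation (\<lambda>\<omega>. Y l p x (of_int \<lceil>real n * \<tau> \<omega>\<rceil> / real n) \<omega>) = x powr p +
      (exp (symbol l p / real n) - 1) *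
      (\<Sum>k<N * n. expectation (\<lambda>\<omega>. indicator {\<omega>\<in>space Mp. real k / real n < \<tau> \<omega>} \<omega> * Y l p x (real k / real n) \<omega>))"
    by (simp add: sum_distrib_left)
qed

text \<open>By continuity of the paths, \<open>W\<close> is the limit of its values at times rounded
  up to the grid, and for each \<open>n\<close> only countably many such times occur. The clipping
  at 0 is there because continuity is given for nonnegative times only.\<close>

lemma W_joint_measurable [measurable]:
  "(\<lambda>p. W (max 0 (fst p)) (snd p)) \<in> borel_measurable (borel \<Otimes>\<^sub>M Mp)"
proof (rule borel_measurable_LIMSEQ_real)
  fix p :: "real \<times> 'a" assume p: "p \<in> space (borel \<Otimes>\<^sub>M Mp)"
  let ?t = "\<lambda>n. of_int \<lceil>real n * fst p\<rceil> / real n"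
  have "(\<lambda>n. max 0 (?t n)) \<longlonglongrightarrow> max 0 (fst p)"
    by (intro tendsto_max tendsto_const ceiling_grid_tendsto)
  then show "(\<lambda>n. W (max 0 (?t n)) (snd p)) \<longlonglongrightarrow> W (max 0 (fst p)) (snd p)"
    using p by (intro continuous_on_tendsto_compose[where s="{0..}" and f="\<lambda>t. W t (snd p)"] W_continuous)
       (simp_all add: space_pair_measure mem_Times_iff)
next
  fix n :: nat
  show "(\<lambda>p. W (max 0 (of_int \<lceil>real n * fst p\<rceil> / real n)) (snd p)) \<in> borel_measurable (borel \<Otimes>\<^sub>M Mp)"
    by (rule measurable_compose_countable[where f="\<lambda>i p. W (max 0 (of_int i / real n)) (snd p)" and g="\<lambda>p. \<lceil>real n * fst p\<rceil>"])
       measurable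
qed

lemma S_at_random_time_measurable:
  assumes [measurable]: "T \<in> borel_measurable Mp" and T: "\<And>\<omega>. \<omega> \<in> space Mp \<Longrightarrow> 0 \<le> T \<omega>"
  shows "(\<lambda>\<omega>. S x (T \<omega>) \<omega>) \<in> borel_measurable Mp"
proof -
  have "(\<lambda>\<omega>. (T \<omega>, \<omega>)) \<in> measurable Mp (borel \<Otimes>\<^sub>M Mp)" by measurable
  from measurable_compose[OF this W_joint_measurable]
  have [measurable]: "(\<lambda>\<omega>. W (max 0 (T \<omega>)) \<omega>) \<in> borel_measurable Mp" by simp
  have "(\<lambda>\<omega>. x * exp ((r - \<sigma>\<^sup>2 / 2) * T \<omega> + \<sigma> * W (max 0 (T \<omega>)) \<omega>)) \<in> borel_measurable Mp"
    by measurable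
  then show ?thesis
    by (rule measurable_cong[THEN iffD1, rotated]) (simp add: GBM_def T max_absorb2)
qed

text \<open>The upper limit is an extended real, so that one notion covers the real stopping times
  in \<open>Vfun\<close> and the possibly infinite exit time in \<open>gam\<close>.\<close>

definition pathint :: "(real \<Rightarrow> real) \<Rightarrow> real \<Rightarrow> ereal \<Rightarrow> 'a \<Rightarrow> real" where
  "pathint g x T \<omega> = (LBINT u=ereal 0..T. exp (-2 * r * u) * g (S x u \<omega>))"

lemma pathint_measurable:
  assumes [measurable]: "g \<in> borel_measurable borel" "T \<in> borel_measurable Mp"
    and T: "\<And>\<omega>. \<omega> \<in> space Mp \<Longrightarrow> 0 \<le> T \<omega>"
  shows "(\<lambda>\<omega>. pathint g x (T \<omega>) \<omega>) \<in> borel_measurable Mp"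
proof -
  let ?f = "\<lambda>\<omega> u. indicator {u. 0 < u \<and> ereal u < T \<omega>} u *
    (exp (-2 * r * u) * g (x * exp ((r - \<sigma>\<^sup>2 / 2) * u + \<sigma> * W (max 0 u) \<omega>)))"
  have sw: "(\<lambda>p. (snd p, fst p)) \<in> measurable (Mp \<Otimes>\<^sub>M lborel) (borel \<Otimes>\<^sub>M Mp)" by measurable
  from measurable_compose[OF sw W_joint_measurable]
  have [measurable]: "(\<lambda>p. W (max 0 (snd p)) (fst p)) \<in> borel_measurable (Mp \<Otimes>\<^sub>M lborel)" by simp
  have "(\<lambda>(\<omega>, u). ?f \<omega> u) \<in> borel_measurable (Mp \<Otimes>\<^sub>M lborel)"
    unfolding split_beta indicator_def mem_Collect_eq by measurable
  then have "(\<lambda>\<omega>. \<integral>u. ?f \<omega> u \<partial>lborel) \<in> borel_measurable Mp"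
    by (rule lborel.borel_measurable_lebesgue_integral)
  then show ?thesis
  proof (rule measurable_cong[THEN iffD1, rotated])
    fix \<omega> assume "\<omega> \<in> space Mp"
    then have "ereal 0 \<le> T \<omega>" using T by (simp add: zero_ereal_def[symmetric])
    then show "(\<integral>u. ?f \<omega> u \<partial>lborel) = pathint g x (T \<omega>) \<omega>"
      unfolding pathint_def interval_lebesgue_integral_def set_lebesgue_integral_def
      by (auto simp: GBM_def max_absorb2 einterval_iff indicator_def intro!: Bochner_Integration.integral_cong)
  qed
qed

text \<open>Continuity from the left carries the closed interval over to time \<open>t\<close>. At
  \<open>t = 0\<close> there are no earlier times, hence the separate hypothesis on the starting
  point.\<close>

lemma S_stopped_in_closure:
  assumes \<omega>: "\<omega> \<in> space Mp" and x: "x \<in> {p..q}" and t: "0 \<le> t"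
    and inside: "\<And>u. 0 \<le> u \<Longrightarrow> u < t \<Longrightarrow> S x u \<omega> \<in> {p..q}"
  shows "S x t \<omega> \<in> {p..q}"
proof (cases "t = 0")
  case True then show ?thesis using x S_0[OF \<omega>] by simp
next
  case False
  then have t: "0 < t" using t by simp
  have "((\<lambda>u. S x u \<omega>) \<longlongrightarrow> S x t \<omega>) (at t within {0..<t})"
    using S_continuous[OF \<omega>, of x, unfolded continuous_on_def] t
    by (intro tendsto_within_subset[where S="{0..}" and T="{0..<t}"]) auto
  moreover have "at t within {0..<t} \<noteq> bot"
  proof -
    have "closure {0..<t} = {0..t}" using t by (rule closure_atLeastLessThan)
    then have "t islimpt {0..<t}" using t by (simp add: islimpt_in_closure[of t])
    then show ?thesis by (simp add: trivial_limit_within)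
  qed
  moreover have "\<forall>\<^sub>F u in at t within {0..<t}. S x u \<omega> \<in> {p..q}"
    unfolding eventually_at_filter using inside by (auto intro!: always_eventually)
  ultimately show ?thesis
    by (intro Lim_in_closed_set[where f="\<lambda>u. S x u \<omega>" and S="{p..q}"]) auto
qed

lemma exp_diff_quotient_tendsto: "(\<lambda>n. real n * (exp (z / real n) - 1)) \<longlonglongrightarrow> z"
proof (cases "z = 0")
  case False
  have "(\<lambda>n. z / real n) \<longlonglongrightarrow> 0" by (rule lim_const_over_n)
  then have "filterlim (\<lambda>n. z / real n) (at 0) sequentially"
    using False by (auto simp: filterlim_at eventually_sequentially intro!: exI[of _ 1])
  moreover have "((\<lambda>h. (exp h - 1) / h) \<longlongrightarrow> 1) (at (0::real))"
    using DERIV_exp[of "0::real"] by (simp add: has_field_derivative_iff)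
  ultimately have "(\<lambda>n. z * ((exp (z / real n) - 1) / (z / real n))) \<longlonglongrightarrow> z * 1"
    by (intro tendsto_mult tendsto_const) (rule filterlim_compose)
  moreover have "z * ((exp (z / real n) - 1) / (z / real n)) = real n * (exp (z / real n) - 1)" for n
    using False by (cases "n = 0") simp_all
  ultimately show ?thesis by simp
qed simp

lemma powr_bounded: "\<exists>C>0. \<forall>s\<in>{a..b}. s powr p \<le> C"
proof -
  have "continuous_on {a..b} (\<lambda>s. s powr p)"
    using a_pos by (intro continuous_intros) auto
  then have "bounded ((\<lambda>s. s powr p) ` {a..b})"
    by (intro compact_imp_bounded compact_continuous_image) auto
  then obtain B where "\<forall>s\<in>{a..b}. s powr p \<le> B" unfolding bounded_iff by auto
  then show ?thesis by (intro exI[of _ "max B 1"]) (auto simp: le_max_iff_disj)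
qed

text \<open>The expected discounted power at the rounded times \<open>T n\<close> is evaluated in
  two ways. As \<open>T n\<close> tends to \<open>\<tau>\<close>, it converges to the left-hand
  side. By the discrete formula it is \<open>x powr p\<close> plus the factor
  \<open>n * (exp (symbol / n) - 1)\<close>, which tends to the symbol, times an expected Riemann
  sum, which tends to the expected path integral.\<close>

lemma power_Dynkin_bounded:
  assumes x: "x \<in> {a..b}" and st: "stopping_time (natF Mp W) \<tau>"
    and \<tau>: "\<And>\<omega>. \<omega> \<in> space Mp \<Longrightarrow> 0 \<le> \<tau> \<omega> \<and> \<tau> \<omega> \<le> real N"
    and inside: "AE \<omega> in Mp. \<forall>t. 0 \<le> t \<and> t < \<tau> \<omega> \<longrightarrow> S x t \<omega> \<in> {a..b}"
  shows "expectation (\<lambda>\<omega>. exp (-2 * r * \<tau> \<omega>) * S x (\<tau> \<omega>) \<omega> powr p) =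
    x powr p + expectation (\<lambda>\<omega>. pathint (\<lambda>s. symbol (2 * r) p * s powr p) x (\<tau> \<omega>) \<omega>)"
proof -
  have x0: "x > 0" using x a_pos by auto
  have [measurable]: "\<tau> \<in> borel_measurable Mp" using stopping_time_random_variable[OF st] .
  let ?l = "2 * r"
  let ?ind = "\<lambda>n k. indicator {\<omega>\<in>space Mp. real k / real n < \<tau> \<omega>} :: 'a \<Rightarrow> real"
  obtain C where C: "C > 0" "\<And>s. s \<in> {a..b} \<Longrightarrow> s powr p \<le> C" using powr_bounded by blast
  obtain C2 where C2: "C2 > 0" "\<And>s. s \<in> {a..b} \<Longrightarrow> s powr (2 * p) \<le> C2" using powr_bounded by blast
  \<comment> \<open>Only grid times before \<open>\<tau>\<close> contribute, when the path is still
    in \<open>[a,b]\<close>; this bounds the summands although the process itself is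
    unbounded.\<close>
  have bound: "AE \<omega> in Mp. \<forall>n k. ?ind n k \<omega> * Y l' p' x (real k / real n) \<omega> \<le> C'"
    if "l' \<ge> 0" "C' > 0" "\<And>s. s \<in> {a..b} \<Longrightarrow> s powr p' \<le> C'" for l' p' C'
    using inside
  proof eventually_elim
    case (elim \<omega>)
    show ?case
    proof (intro allI)
      fix n k :: nat
      show "?ind n k \<omega> * Y l' p' x (real k / real n) \<omega> \<le> C'"
      proof (cases "\<omega> \<in> {\<omega>\<in>space Mp. real k / real n < \<tau> \<omega>}")
        case True
        then have "S x (real k / real n) \<omega> \<in> {a..b}" using elim by simp
        then have "S x (real k / real n) \<omega> powr p' \<le> C'" using that by blast
        moreover have "exp (- l' * (real k / real n)) \<le> 1" using that(1) by simp
        ultimately have "Y l' p' x (real k / real n) \<omega> \<le> 1 * C'"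
          unfolding Y_def by (intro mult_mono) auto
        then show ?thesis using True by simp
      qed (use that in simp)
    qed
  qed
  \<comment> \<open>\<open>Suc n\<close> in place of \<open>n\<close> excludes the grid with mesh
    \<open>1 / 0\<close>.\<close>
  define T where "T n \<omega> = of_int \<lceil>real (Suc n) * \<tau> \<omega>\<rceil> / real (Suc n)" for n \<omega>
  have T_int: "integrable Mp (\<lambda>\<omega>. Y l' p' x (T n \<omega>) \<omega>)" for l' p' n
    unfolding T_def by (rule grid_expectation(1)[OF x0 st \<tau>]) auto
  have T_exp: "expectation (\<lambda>\<omega>. Y l' p' x (T n \<omega>) \<omega>) = x powr p' + (exp (symbol l' p' / real (Suc n)) - 1) *
      (\<Sum>k<N * Suc n. expectation (\<lambda>\<omega>. ?ind (Suc n) k \<omega> * Y l' p' x (real k / real (Suc n)) \<omega>))" for l' p' n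
    unfolding T_def by (rule grid_expectation(2)[OF x0 st \<tau>]) auto
  have ind_int: "integrable Mp (\<lambda>\<omega>. ?ind n k \<omega> * Y l' p' x (real k / real n) \<omega>)" for n k l' p'
  proof -
    have "integrable Mp (\<lambda>\<omega>. Y l' p' x (real k / real n) \<omega> * ?ind n k \<omega>)"
      by (intro integrable_real_mult_indicator natF_subset[OF stopping_time_gt_event[OF st]] Y_integrable[OF x0]) simp
    then show ?thesis by (simp only: mult.commute)
  qed
  have lim1: "(\<lambda>n. expectation (\<lambda>\<omega>. Y ?l p x (T n \<omega>) \<omega>)) \<longlonglongrightarrow> expectation (\<lambda>\<omega>. Y ?l p x (\<tau> \<omega>) \<omega>)"
  proof -
    let ?c = "\<lambda>n. real n * (exp (symbol (2 * ?l) (2 * p) / real n) - 1)"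
    have "Bseq ?c"
      using exp_diff_quotient_tendsto by (intro convergent_imp_Bseq) (auto simp: convergent_def)
    then obtain Q where Q: "\<And>n. \<bar>?c n\<bar> \<le> Q" unfolding Bseq_def by auto
    have bd2: "AE \<omega> in Mp. \<forall>n k. ?ind n k \<omega> * Y (2 * ?l) (2 * p) x (real k / real n) \<omega> \<le> C2"
      by (rule bound) (use r_pos C2 in auto)
    \<comment> \<open>The square is again a discounted power with both parameters doubled, so the
      discrete formula gives its expectation; \<open>Q\<close> bounds the convergent factor in front
      of the sum.\<close>
    have L2: "expectation (\<lambda>\<omega>. (Y ?l p x (T n \<omega>) \<omega>)\<^sup>2) \<le> x powr (2 * p) + Q * (real N * C2)" for n
    proof -
      let ?\<Sigma> = "\<Sum>k<N * Suc n. expectation (\<lambda>\<omega>. ?ind (Suc n) k \<omega> * Y (2 * ?l) (2 * p) x (real k / real (Suc n)) \<omega>)"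
      have "?\<Sigma> \<le> (\<Sum>k<N * Suc n. C2)"
      proof (intro sum_mono)
        fix k
        have "AE \<omega> in Mp. ?ind (Suc n) k \<omega> * Y (2 * ?l) (2 * p) x (real k / real (Suc n)) \<omega> \<le> C2"
          using bd2 by eventually_elim blast
        then have "expectation (\<lambda>\<omega>. ?ind (Suc n) k \<omega> * Y (2 * ?l) (2 * p) x (real k / real (Suc n)) \<omega>)
            \<le> expectation (\<lambda>\<omega>. C2)"
          by (intro integral_mono_AE ind_int) auto
        then show "expectation (\<lambda>\<omega>. ?ind (Suc n) k \<omega> * Y (2 * ?l) (2 * p) x (real k / real (Suc n)) \<omega>) \<le> C2"
          by (simp add: prob_space)
      qed
      then have up: "?\<Sigma> \<le> real (Suc n) * (real N * C2)" by (simp add: algebra_simps)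
      have lo: "0 \<le> ?\<Sigma>" by (intro sum_nonneg integral_nonneg) (simp add: Y_nonneg)
      have "(exp (symbol (2 * ?l) (2 * p) / real (Suc n)) - 1) * ?\<Sigma> \<le>
          \<bar>exp (symbol (2 * ?l) (2 * p) / real (Suc n)) - 1\<bar> * (real (Suc n) * (real N * C2))"
        using lo up by (intro mult_mono) auto
      also have "\<dots> = \<bar>?c (Suc n)\<bar> * (real N * C2)"
        by (simp only: abs_mult abs_of_nat mult.assoc mult.commute mult.left_commute)
      also have "\<dots> \<le> Q * (real N * C2)"
        by (rule mult_right_mono[OF Q[of "Suc n"]]) (use C2 in simp)
      finally show ?thesis unfolding Y_square T_exp by simp
    qed
    show ?thesis
    proof (rule expectation_tendsto_of_L2_bounded[where B="x powr (2 * p) + Q * (real N * C2)" and C=C])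
      show "integrable Mp (\<lambda>\<omega>. (Y ?l p x (T n \<omega>) \<omega>)\<^sup>2)" for n unfolding Y_square by (rule T_int)
      have "(\<lambda>\<omega>. S x (\<tau> \<omega>) \<omega>) \<in> borel_measurable Mp"
        using \<tau> by (intro S_at_random_time_measurable) auto
      then show "(\<lambda>\<omega>. Y ?l p x (\<tau> \<omega>) \<omega>) \<in> borel_measurable Mp" unfolding Y_def by measurable
      show "AE \<omega> in Mp. \<bar>Y ?l p x (\<tau> \<omega>) \<omega>\<bar> \<le> C"
        using inside AE_space
      proof eventually_elim
        case (elim \<omega>)
        have \<tau>0: "0 \<le> \<tau> \<omega>" using \<tau>[OF elim(2)] ..
        have "S x (\<tau> \<omega>) \<omega> \<in> {a..b}"
        proof (rule S_stopped_in_closure[OF elim(2) x \<tau>0])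
          fix u assume "0 \<le> u" "u < \<tau> \<omega>"
          then show "S x u \<omega> \<in> {a..b}" using elim(1) by blast
        qed
        then have "S x (\<tau> \<omega>) \<omega> powr p \<le> C" by (rule C(2))
        moreover have "exp (- ?l * \<tau> \<omega>) \<le> 1" using r_pos \<tau>0 by simp
        ultimately have "Y ?l p x (\<tau> \<omega>) \<omega> \<le> 1 * C" unfolding Y_def by (intro mult_mono) auto
        then show ?case using Y_nonneg by simp
      qed
      show "AE \<omega> in Mp. (\<lambda>n. Y ?l p x (T n \<omega>) \<omega>) \<longlonglongrightarrow> Y ?l p x (\<tau> \<omega>) \<omega>"
        using AE_space
      proof eventually_elim
        case (elim \<omega>)
        have "(\<lambda>n. T n \<omega>) \<longlonglongrightarrow> \<tau> \<omega>" unfolding T_def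
          by (rule LIMSEQ_Suc[OF ceiling_grid_tendsto[of "\<tau> \<omega>"]])
        moreover have "T n \<omega> \<ge> 0" for n 
        proof -
          have "0 \<le> real (Suc n) * \<tau> \<omega>" using \<tau>[OF elim] by simp
          then have "0 \<le> \<lceil>real (Suc n) * \<tau> \<omega>\<rceil>" by linarith
          then show ?thesis unfolding T_def
            by (intro divide_nonneg_nonneg) (simp_all only: of_int_0_le_iff of_nat_0_le_iff)
        qed
        ultimately show ?case
          using \<tau>[OF elim]
          by (intro continuous_on_tendsto_compose[OF Y_continuous[OF x0 elim]] always_eventually allI) simp_all
      qed
      show "AE \<omega> in Mp. 0 \<le> Y ?l p x (T n \<omega>) \<omega>" for n by (simp add: Y_nonneg)
    qed (rule T_int L2)+
  qed
  have lim2: "(\<lambda>n. expectation (\<lambda>\<omega>. Y ?l p x (T n \<omega>) \<omega>)) \<longlonglongrightarrow>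
      x powr p + symbol ?l p * expectation (\<lambda>\<omega>. pathint (\<lambda>s. s powr p) x (\<tau> \<omega>) \<omega>)"
  proof -
    \<comment> \<open>Riemann sums at left ends, taken up to \<open>\<tau>\<close>; almost surely
      they are bounded by \<open>real N * C\<close>.\<close>
    define R where "R n \<omega> = (\<Sum>k<N * n. ?ind n k \<omega> * Y ?l p x (real k / real n) \<omega>) / real n" for n \<omega>
    have bd1: "AE \<omega> in Mp. \<forall>n k. ?ind n k \<omega> * Y ?l p x (real k / real n) \<omega> \<le> C"
      by (rule bound) (use r_pos C in auto)
    have Rlim: "(\<lambda>n. expectation (R n)) \<longlonglongrightarrow> expectation (\<lambda>\<omega>. pathint (\<lambda>s. s powr p) x (\<tau> \<omega>) \<omega>)"
    proof (rule integral_dominated_convergence[where w="\<lambda>_. real N * C"])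
      show "(\<lambda>\<omega>. pathint (\<lambda>s. s powr p) x (\<tau> \<omega>) \<omega>) \<in> borel_measurable Mp"
        using \<tau> by (intro pathint_measurable) auto
      show "R n \<in> borel_measurable Mp" for n unfolding R_def by measurable
      show "AE \<omega> in Mp. (\<lambda>n. R n \<omega>) \<longlonglongrightarrow> pathint (\<lambda>s. s powr p) x (\<tau> \<omega>) \<omega>"
        using AE_space
      proof eventually_elim
        case (elim \<omega>)
        have c: "continuous_on {0..real N} (\<lambda>t. Y ?l p x t \<omega>)"
          by (rule continuous_on_subset[OF Y_continuous[OF x0 elim]]) auto
        have ct: "continuous_on {0..\<tau> \<omega>} (\<lambda>t. Y ?l p x t \<omega>)"
          by (rule continuous_on_subset[OF Y_continuous[OF x0 elim]]) auto
        have "pathint (\<lambda>s. s powr p) x (\<tau> \<omega>) \<omega> = (LBINT u=0..\<tau> \<omega>. Y ?l p x u \<omega>)"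
          unfolding pathint_def Y_def by (simp add: zero_ereal_def)
        also have "\<dots> = integral {0..\<tau> \<omega>} (\<lambda>t. Y ?l p x t \<omega>)"
          using \<tau>[OF elim] borel_integrable_atLeastAtMost'[OF ct]
          by (simp add: interval_integral_eq_integral zero_ereal_def)
        finally have "pathint (\<lambda>s. s powr p) x (\<tau> \<omega>) \<omega> = integral {0..\<tau> \<omega>} (\<lambda>t. Y ?l p x t \<omega>)" .
        moreover have "R n \<omega> = (\<Sum>k<N * n. if real k / real n < \<tau> \<omega> then Y ?l p x (real k / real n) \<omega> else 0) / real n" for n
          unfolding R_def by (intro arg_cong2[where f="(/)"] refl sum.cong) (simp add: elim indicator_def)
        ultimately show ?case
          using Riemann_sum_tendsto[OF c, of "\<tau> \<omega>"] \<tau>[OF elim] by simp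
      qed
      show "AE \<omega> in Mp. norm (R n \<omega>) \<le> real N * C" for n
        using bd1
      proof (elim eventually_mono)
        fix \<omega> assume *: "\<forall>n k. ?ind n k \<omega> * Y ?l p x (real k / real n) \<omega> \<le> C"
        have "0 \<le> (\<Sum>k<N * n. ?ind n k \<omega> * Y ?l p x (real k / real n) \<omega>)"
          by (intro sum_nonneg) (simp add: Y_nonneg)
        moreover have "(\<Sum>k<N * n. ?ind n k \<omega> * Y ?l p x (real k / real n) \<omega>) \<le> (\<Sum>k<N * n. C)"
          using * by (intro sum_mono) blast
        ultimately show "norm (R n \<omega>) \<le> real N * C"
          unfolding R_def using C by (cases "n = 0") (auto simp: field_simps)
      qed
    qed auto
    have "expectation (\<lambda>\<omega>. Y ?l p x (T n \<omega>) \<omega>) = x powr p +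
        real (Suc n) * (exp (symbol ?l p / real (Suc n)) - 1) * expectation (R (Suc n))" for n
    proof -
      have "expectation (R (Suc n)) = (\<Sum>k<N * Suc n. expectation (\<lambda>\<omega>. ?ind (Suc n) k \<omega> * Y ?l p x (real k / real (Suc n)) \<omega>)) / real (Suc n)"
        unfolding R_def integral_divide_zero
        by (subst Bochner_Integration.integral_sum[OF ind_int]) (rule refl)
      then show ?thesis unfolding T_exp by (simp only: nonzero_mult_div_cancel_left) (simp del: of_nat_Suc)
    qed
    moreover have "(\<lambda>n. x powr p + real (Suc n) * (exp (symbol ?l p / real (Suc n)) - 1) * expectation (R (Suc n)))
       \<longlonglongrightarrow> x powr p + symbol ?l p * expectation (\<lambda>\<omega>. pathint (\<lambda>s. s powr p) x (\<tau> \<omega>) \<omega>)"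
      by (intro tendsto_intros LIMSEQ_Suc[OF exp_diff_quotient_tendsto] LIMSEQ_Suc[OF Rlim])
    ultimately show ?thesis by simp
  qed
  have "pathint (\<lambda>s. symbol ?l p * s powr p) x t \<omega> = symbol ?l p * pathint (\<lambda>s. s powr p) x t \<omega>" for t \<omega>
    unfolding pathint_def by (simp add: mult.left_commute flip: interval_lebesgue_integral_mult_right)
  then show ?thesis
    using LIMSEQ_unique[OF lim1 lim2] by (simp add: Y_def)
qed

end

section \<open>Exit times and optimal stopping\<close>

context gbm begin

lemma exp_decay_integral:
  "integrable lborel (\<lambda>u. indicator {0<..} u * exp (-2 * r * u))"
  "(\<integral>u. indicator {0<..} u * exp (-2 * r * u) \<partial>lborel) = 1 / (2 * r)"
proof -
  let ?d = "exponential_density (2 * r)"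
  have "prob_space (density lborel ?d)"
    using prob_space_exponential_density[of "2 * r"] r_pos by simp
  then have "emeasure (density lborel ?d) (space (density lborel ?d)) = 1"
    by (rule prob_space.emeasure_space_1)
  then have nn: "(\<integral>\<^sup>+u. ennreal (?d u) \<partial>lborel) = ennreal 1"
    by (simp add: emeasure_density)
  have "has_bochner_integral lborel ?d 1"
    using r_pos by (intro has_bochner_integral_nn_integral nn) (auto simp: erlang_density_def)
  then have "has_bochner_integral lborel (\<lambda>u. ?d u / (2 * r)) (1 / (2 * r))"
    by (rule has_bochner_integral_divide_zero)
  \<comment> \<open>The exponential density does not vanish at 0, while the open half-line excludes
    that point; elsewhere the two functions agree.\<close>
  moreover have "AE u in lborel. ?d u / (2 * r) = indicator {0<..} u * exp (-2 * r * u)"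
    using AE_lborel_singleton[of "0::real"]
    by eventually_elim (use r_pos in \<open>auto simp: exponential_density_def mult_ac\<close>)
  ultimately have "has_bochner_integral lborel (\<lambda>u. indicator {0<..} u * exp (-2 * r * u)) (1 / (2 * r))"
    by (subst (asm) has_bochner_integral_cong_AE) auto
  then show "integrable lborel (\<lambda>u. indicator {0<..} u * exp (-2 * r * u))"
    "(\<integral>u. indicator {0<..} u * exp (-2 * r * u) \<partial>lborel) = 1 / (2 * r)"
    by (auto simp: has_bochner_integral_iff)
qed

text \<open>The integrand of \<open>pathint\<close> extended by zero to the whole line: a change of
  horizon becomes a change of indicator, and one dominating function serves all horizons.\<close>

definition discounted_path :: "(real \<Rightarrow> real) \<Rightarrow> real \<Rightarrow> ereal \<Rightarrow> 'a \<Rightarrow> real \<Rightarrow> real" where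
  "discounted_path g x T \<omega> u = indicator {u. 0 < u \<and> ereal u < T} u * (exp (-2 * r * u) * g (S x u \<omega>))"

lemma pathint_eq: "0 \<le> T \<Longrightarrow> pathint g x T \<omega> = (\<integral>u. discounted_path g x T \<omega> u \<partial>lborel)"
  unfolding pathint_def interval_lebesgue_integral_def set_lebesgue_integral_def discounted_path_def
  by (auto simp: einterval_iff indicator_def zero_ereal_def intro!: Bochner_Integration.integral_cong)

lemma discounted_path_measurable:
  assumes \<omega>: "\<omega> \<in> space Mp" and [measurable]: "g \<in> borel_measurable borel"
  shows "discounted_path g x T \<omega> \<in> borel_measurable lborel"
proof -
  have "continuous_on UNIV (\<lambda>u. W (max 0 u) \<omega>)"
    by (rule continuous_on_compose2[OF W_continuous[OF \<omega>]]) (auto intro!: continuous_intros)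
  then have [measurable]: "(\<lambda>u. W (max 0 u) \<omega>) \<in> borel_measurable borel"
    by (rule borel_measurable_continuous_onI)
  have "(\<lambda>u. indicator {u. 0 < u \<and> ereal u < T} u *
      (exp (-2 * r * u) * g (x * exp ((r - \<sigma>\<^sup>2 / 2) * u + \<sigma> * W (max 0 u) \<omega>)))) \<in> borel_measurable lborel"
    by measurable
  moreover have "discounted_path g x T \<omega> = (\<lambda>u. indicator {u. 0 < u \<and> ereal u < T} u *
      (exp (-2 * r * u) * g (x * exp ((r - \<sigma>\<^sup>2 / 2) * u + \<sigma> * W (max 0 u) \<omega>))))"
    by (auto simp: discounted_path_def GBM_def indicator_def max_absorb2)
  ultimately show ?thesis by simp
qed

lemma discounted_path_bound:
  assumes "\<forall>u. 0 < u \<and> ereal u < T \<longrightarrow> \<bar>g (S x u \<omega>)\<bar> \<le> C" "0 \<le> C"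
  shows "\<bar>discounted_path g x T \<omega> u\<bar> \<le> C * (indicator {0<..} u * exp (-2 * r * u))"
  using assms by (auto simp: discounted_path_def indicator_def abs_mult mult.commute)

lemma discounted_path_integrable:
  assumes \<omega>: "\<omega> \<in> space Mp" and g: "g \<in> borel_measurable borel"
    and bound: "\<forall>u. 0 < u \<and> ereal u < T \<longrightarrow> \<bar>g (S x u \<omega>)\<bar> \<le> C" "0 \<le> C"
  shows "integrable lborel (discounted_path g x T \<omega>)"
  using discounted_path_measurable[OF \<omega> g] discounted_path_bound[OF bound]
  by (intro Bochner_Integration.integrable_bound[OF integrable_mult_right[OF exp_decay_integral(1), of C]])
     (auto intro!: AE_I2 order_trans[OF _ abs_ge_self])

lemma pathint_bound:
  assumes \<omega>: "\<omega> \<in> space Mp" and g: "g \<in> borel_measurable borel" and T: "0 \<le> T"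
    and bound: "\<forall>u. 0 < u \<and> ereal u < T \<longrightarrow> \<bar>g (S x u \<omega>)\<bar> \<le> C" "0 \<le> C"
  shows "\<bar>pathint g x T \<omega>\<bar> \<le> C / (2 * r)"
proof -
  have "\<bar>pathint g x T \<omega>\<bar> \<le> (\<integral>u. \<bar>discounted_path g x T \<omega> u\<bar> \<partial>lborel)"
    unfolding pathint_eq[OF T] by (rule integral_abs_bound)
  also have "\<dots> \<le> (\<integral>u. C * (indicator {0<..} u * exp (-2 * r * u)) \<partial>lborel)"
    using discounted_path_integrable[OF \<omega> g bound] discounted_path_bound[OF bound]
    by (intro integral_mono integrable_abs integrable_mult_right exp_decay_integral) auto
  also have "\<dots> = C / (2 * r)" using exp_decay_integral(2) by simp
  finally show ?thesis .
qed

text \<open>For fixed \<open>u\<close> the integrand no longer depends on \<open>N\<close> once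
  \<open>N\<close> exceeds \<open>u\<close>, and the discount factor dominates.\<close>

lemma pathint_min_tendsto:
  assumes \<omega>: "\<omega> \<in> space Mp" and g: "g \<in> borel_measurable borel" and T: "0 \<le> T"
    and bound: "\<forall>u. 0 < u \<and> ereal u < T \<longrightarrow> \<bar>g (S x u \<omega>)\<bar> \<le> C" "0 \<le> C"
  shows "(\<lambda>N. pathint g x (min (ereal (real N)) T) \<omega>) \<longlonglongrightarrow> pathint g x T \<omega>"
proof -
  have *: "pathint g x (min (ereal (real N)) T) \<omega> =
      (\<integral>u. discounted_path g x (min (ereal (real N)) T) \<omega> u \<partial>lborel)" for N
    using T by (intro pathint_eq) simp
  show ?thesis
    unfolding pathint_eq[OF T] *
  proof (rule integral_dominated_convergence[where w="\<lambda>u. C * (indicator {0<..} u * exp (-2 * r * u))"])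
    show "integrable lborel (\<lambda>u. C * (indicator {0<..} u * exp (-2 * r * u)))"
      by (intro integrable_mult_right exp_decay_integral)
    show "AE u in lborel. norm (discounted_path g x (min (ereal (real N)) T) \<omega> u)
        \<le> C * (indicator {0<..} u * exp (-2 * r * u))" for N
      unfolding real_norm_def using bound by (intro AE_I2 discounted_path_bound) auto
    show "AE u in lborel. (\<lambda>N. discounted_path g x (min (ereal (real N)) T) \<omega> u) \<longlonglongrightarrow>
        discounted_path g x T \<omega> u"
    proof (intro AE_I2)
      fix u :: real
      obtain n0 :: nat where n0: "u < real n0" using reals_Archimedean2 by blast
      have "\<forall>\<^sub>F N in sequentially. discounted_path g x (min (ereal (real N)) T) \<omega> u = discounted_path g x T \<omega> u"
        using eventually_ge_at_top[of n0]
      proof eventually_elim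
        case (elim N)
        then have "u < real N" using n0 by linarith
        then show ?case by (simp add: discounted_path_def indicator_def)
      qed
      then show "(\<lambda>N. discounted_path g x (min (ereal (real N)) T) \<omega> u) \<longlonglongrightarrow> discounted_path g x T \<omega> u"
        by (rule tendsto_eventually)
    qed
  qed (use discounted_path_measurable[OF \<omega> g] in auto)
qed

lemma pathint_lincomb:
  assumes \<omega>: "\<omega> \<in> space Mp" and T: "0 \<le> T"
    and g: "g \<in> borel_measurable borel" "g' \<in> borel_measurable borel"
    and bound: "\<forall>u. 0 < u \<and> ereal u < T \<longrightarrow> \<bar>g (S x u \<omega>)\<bar> \<le> C" "0 \<le> C"
      "\<forall>u. 0 < u \<and> ereal u < T \<longrightarrow> \<bar>g' (S x u \<omega>)\<bar> \<le> C'" "0 \<le> C'"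
  shows "pathint (\<lambda>s. c * g s + c' * g' s) x T \<omega> = c * pathint g x T \<omega> + c' * pathint g' x T \<omega>"
proof -
  have eq: "discounted_path (\<lambda>s. c * g s + c' * g' s) x T \<omega> =
      (\<lambda>u. c * discounted_path g x T \<omega> u + c' * discounted_path g' x T \<omega> u)"
    by (rule ext) (simp add: discounted_path_def algebra_simps)
  show ?thesis
    unfolding pathint_eq[OF T] eq
    using discounted_path_integrable[OF \<omega> g(1) bound(1,2)] discounted_path_integrable[OF \<omega> g(2) bound(3,4)]
    by simp
qed

lemma pathint_cong:
  assumes "0 \<le> T" "\<And>u. 0 < u \<Longrightarrow> ereal u < T \<Longrightarrow> g (S x u \<omega>) = g' (S x u \<omega>)"
  shows "pathint g x T \<omega> = pathint g' x T \<omega>"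
  unfolding pathint_eq[OF assms(1)] discounted_path_def using assms(2)
  by (intro Bochner_Integration.integral_cong) (auto simp: indicator_def)

section \<open>Exit times as stopping times\<close>

lemma exitT_nonneg: "0 \<le> exitT r \<sigma> W p q x \<omega>"
  unfolding exitT_def by (intro Inf_greatest) auto

lemma before_exitT:
  assumes "0 \<le> t" "ereal t < exitT r \<sigma> W p q x \<omega>" shows "S x t \<omega> \<in> {p<..<q}"
proof (rule ccontr)
  assume "S x t \<omega> \<notin> {p<..<q}"
  then have "exitT r \<sigma> W p q x \<omega> \<le> ereal t"
    unfolding exitT_def using assms(1) by (intro Inf_lower) auto
  then show False using assms(2) by simp
qed

text \<open>The infimum that defines the exit time is attained, since paths are continuous and the
  complement of an open interval is closed: a path that is inside up to and including
  \<open>t\<close> stays inside a little longer.\<close>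

lemma exitT_le_iff:
  assumes \<omega>: "\<omega> \<in> space Mp" and t: "0 \<le> t"
  shows "exitT r \<sigma> W p q x \<omega> \<le> ereal t \<longleftrightarrow> (\<exists>s\<in>{0..t}. S x s \<omega> \<notin> {p<..<q})"
proof
  assume le: "exitT r \<sigma> W p q x \<omega> \<le> ereal t"
  show "\<exists>s\<in>{0..t}. S x s \<omega> \<notin> {p<..<q}"
  proof (rule ccontr)
    assume "\<not> ?thesis"
    then have inside: "\<And>s. 0 \<le> s \<Longrightarrow> s \<le> t \<Longrightarrow> S x s \<omega> \<in> {p<..<q}" by auto
    have "((\<lambda>u. S x u \<omega>) \<longlongrightarrow> S x t \<omega>) (at t within {0..})"
      using S_continuous[OF \<omega>, of x] t by (simp add: continuous_on_def)
    moreover have "S x t \<omega> \<in> {p<..<q}" using inside t by blast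
    ultimately have "\<forall>\<^sub>F u in at t within {0..}. S x u \<omega> \<in> {p<..<q}"
      by (intro topological_tendstoD[where S="{p<..<q}"]) auto
    then obtain d where d: "d > 0" "\<And>u. u \<in> {0..} \<Longrightarrow> u \<noteq> t \<Longrightarrow> dist u t < d \<Longrightarrow> S x u \<omega> \<in> {p<..<q}"
      unfolding eventually_at by blast
    have "ereal (t + d) \<le> exitT r \<sigma> W p q x \<omega>"
      unfolding exitT_def
    proof (intro Inf_greatest, clarify)
      fix u assume u: "0 \<le> u" "S x u \<omega> \<notin> {p<..<q}"
      show "ereal (t + d) \<le> ereal u"
      proof (rule ccontr)
        assume "\<not> ereal (t + d) \<le> ereal u"
        then have "u < t + d" by simp
        then show False using u inside[of u] d(2)[of u] by (cases "u \<le> t") (auto simp: dist_real_def)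
      qed
    qed
    then have "ereal (t + d) \<le> ereal t" using le by (rule order_trans)
    then show False using d(1) by simp
  qed
next
  assume "\<exists>s\<in>{0..t}. S x s \<omega> \<notin> {p<..<q}"
  then obtain s where s: "0 \<le> s" "s \<le> t" "S x s \<omega> \<notin> {p<..<q}" by auto
  then have "\<not> ereal s < exitT r \<sigma> W p q x \<omega>" using before_exitT by blast
  then have "exitT r \<sigma> W p q x \<omega> \<le> ereal s" by simp
  also have "\<dots> \<le> ereal t" using s(2) by simp
  finally show "exitT r \<sigma> W p q x \<omega> \<le> ereal t" .
qed

text \<open>On a compact time interval a continuous path inside the open interval keeps some
  distance \<open>inverse (Suc n)\<close> from its ends, and such a closed condition may be checked
  at rational times. The event thus arises by countable operations from values of the path up to
  \<open>t\<close>.\<close>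

lemma exitT_event: "0 \<le> t \<Longrightarrow> {\<omega>\<in>space Mp. exitT r \<sigma> W p q x \<omega> \<le> ereal t} \<in> sets (natF Mp W t)"
proof -
  assume t: "0 \<le> t"
  let ?P = "\<lambda>(n::nat) (i::nat) (m::nat) \<omega>. 
    real i / real m \<le> t \<longrightarrow> S x (real i / real m) \<omega> \<in> {p + inverse (real (Suc n))..q - inverse (real (Suc n))}"
  have iff: "exitT r \<sigma> W p q x \<omega> \<le> ereal t \<longleftrightarrow> \<not> (\<exists>n. \<forall>i m. ?P n i m \<omega>)" if \<omega>: "\<omega> \<in> space Mp" for \<omega>
  proof -
    have "(\<forall>s\<in>{0..t}. S x s \<omega> \<in> {p<..<q}) \<longleftrightarrow> (\<exists>n. \<forall>i m. ?P n i m \<omega>)"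
    proof
      assume in_pq: "\<forall>s\<in>{0..t}. S x s \<omega> \<in> {p<..<q}"
      have c: "continuous_on {0..t} (\<lambda>s. S x s \<omega>)"
        by (rule continuous_on_subset[OF S_continuous[OF \<omega>]]) auto
      obtain s1 where s1: "s1 \<in> {0..t}" "\<And>s. s \<in> {0..t} \<Longrightarrow> S x s1 \<omega> \<le> S x s \<omega>"
        using continuous_attains_inf[OF _ _ c] t by auto
      obtain s2 where s2: "s2 \<in> {0..t}" "\<And>s. s \<in> {0..t} \<Longrightarrow> S x s \<omega> \<le> S x s2 \<omega>"
        using continuous_attains_sup[OF _ _ c] t by auto
      have "0 < min (S x s1 \<omega> - p) (q - S x s2 \<omega>)" using in_pq s1(1) s2(1) by auto
      then obtain n where n: "inverse (real (Suc n)) < min (S x s1 \<omega> - p) (q - S x s2 \<omega>)"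
        using reals_Archimedean by blast
      have "?P n i m \<omega>" for i m
      proof
        assume "real i / real m \<le> t"
        then have "real i / real m \<in> {0..t}" by simp
        then show "S x (real i / real m) \<omega> \<in> {p + inverse (real (Suc n))..q - inverse (real (Suc n))}"
          using n s1(2)[of "real i / real m"] s2(2)[of "real i / real m"] by (simp del: of_nat_Suc)
      qed
      then show "\<exists>n. \<forall>i m. ?P n i m \<omega>" by blast
    next
      assume "\<exists>n. \<forall>i m. ?P n i m \<omega>"
      then obtain n where n: "\<And>i m. ?P n i m \<omega>" by blast
      show "\<forall>s\<in>{0..t}. S x s \<omega> \<in> {p<..<q}"
      proof
        fix s assume s: "s \<in> {0..t}"
        \<comment> \<open>Here times are rounded down: the approximating rationals must not lie
          beyond \<open>t\<close>.\<close>
        have "(\<lambda>m. of_int \<lfloor>real m * s\<rfloor> / real m) \<longlonglongrightarrow> s"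
        proof (rule tendsto_sandwich)
          show "\<forall>\<^sub>F m in sequentially. s - inverse (real m) \<le> of_int \<lfloor>real m * s\<rfloor> / real m"
            using eventually_gt_at_top[of 0]
          proof eventually_elim
            case (elim m)
            have "real m * s - 1 \<le> of_int \<lfloor>real m * s\<rfloor>" by linarith
            then have "(real m * s - 1) / real m \<le> of_int \<lfloor>real m * s\<rfloor> / real m"
              by (rule divide_right_mono) simp
            then show ?case using elim by (simp add: diff_divide_distrib inverse_eq_divide)
          qed
          show "\<forall>\<^sub>F m in sequentially. of_int \<lfloor>real m * s\<rfloor> / real m \<le> s"
            using eventually_gt_at_top[of 0] by eventually_elim (simp add: field_simps)
          show "(\<lambda>m. s - inverse (real m)) \<longlonglongrightarrow> s"
            using tendsto_diff[OF tendsto_const LIMSEQ_inverse_real_of_nat[THEN LIMSEQ_imp_Suc], of s] by simp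
        qed simp
        moreover have fl: "of_int \<lfloor>real m * s\<rfloor> / real m = real (nat \<lfloor>real m * s\<rfloor>) / real m" for m
          using s by simp
        ultimately have "(\<lambda>m. real (nat \<lfloor>real m * s\<rfloor>) / real m) \<longlonglongrightarrow> s" by simp
        then have "(\<lambda>m. S x (real (nat \<lfloor>real m * s\<rfloor>) / real m) \<omega>) \<longlonglongrightarrow> S x s \<omega>"
          using s by (intro continuous_on_tendsto_compose[OF S_continuous[OF \<omega>]] always_eventually allI) auto
        moreover have "S x (real (nat \<lfloor>real m * s\<rfloor>) / real m) \<omega>
            \<in> {p + inverse (real (Suc n))..q - inverse (real (Suc n))}" for m
        proof -
          have "of_int \<lfloor>real m * s\<rfloor> \<le> real m * s" by linarith
          then have "of_int \<lfloor>real m * s\<rfloor> / real m \<le> s"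
            using s by (cases "m = 0") (auto simp: field_simps)
          then have "real (nat \<lfloor>real m * s\<rfloor>) / real m \<le> t" unfolding fl[symmetric] using s by simp
          then show ?thesis using n by blast
        qed
        ultimately have "S x s \<omega> \<in> {p + inverse (real (Suc n))..q - inverse (real (Suc n))}"
          by (rule closed_sequentially[OF closed_atLeastAtMost, rotated])
        moreover have "0 < inverse (real (Suc n))" by simp
        ultimately show "S x s \<omega> \<in> {p<..<q}"
          unfolding atLeastAtMost_iff greaterThanLessThan_iff by linarith
      qed
    qed
    then show ?thesis unfolding exitT_le_iff[OF \<omega> t] by blast
  qed
  have "{\<omega>\<in>space (natF Mp W t). ?P n i m \<omega>} \<in> sets (natF Mp W t)" for n i m
  proof (cases "real i / real m \<le> t")
    case True
    have "S x (real i / real m) \<in> borel_measurable (natF Mp W t)"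
      by (rule S_natF_measurable[OF _ True]) simp
    then have "{\<omega>\<in>space (natF Mp W t). S x (real i / real m) \<omega> \<in> {p + inverse (real (Suc n))..q - inverse (real (Suc n))}} \<in> sets (natF Mp W t)"
      by measurable
    then show ?thesis using True by simp
  next
    case False then show ?thesis using sets.top[of "natF Mp W t"] by simp
  qed
  then have "{\<omega>\<in>space (natF Mp W t). \<not> (\<exists>n. \<forall>i m. ?P n i m \<omega>)} \<in> sets (natF Mp W t)"
    by (intro sets.sets_Collect_neg sets.sets_Collect_countable_Ex sets.sets_Collect_countable_All)
  moreover have "{\<omega>\<in>space (natF Mp W t). \<not> (\<exists>n. \<forall>i m. ?P n i m \<omega>)} =
      {\<omega>\<in>space Mp. exitT r \<sigma> W p q x \<omega> \<le> ereal t}"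
    unfolding space_natF by (rule Collect_cong, rule conj_cong[OF refl], rule sym, rule iff)
  ultimately show ?thesis by (simp only:)
qed

text \<open>Admissible stopping times are real valued and the exit time may be infinite; hence the
  cut-off at \<open>N\<close>.\<close>

definition exit_before :: "real \<Rightarrow> real \<Rightarrow> real \<Rightarrow> nat \<Rightarrow> 'a \<Rightarrow> real" where
  "exit_before p q x N \<omega> = real_of_ereal (min (ereal (real N)) (exitT r \<sigma> W p q x \<omega>))"

lemma ereal_exit_before: "ereal (exit_before p q x N \<omega>) = min (ereal (real N)) (exitT r \<sigma> W p q x \<omega>)"
  unfolding exit_before_def using exitT_nonneg[of p q x \<omega>]
  by (cases "exitT r \<sigma> W p q x \<omega>") (auto simp: min_def)

lemma exit_before_nonneg: "0 \<le> exit_before p q x N \<omega>"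
proof -
  have "0 \<le> ereal (exit_before p q x N \<omega>)" unfolding ereal_exit_before using exitT_nonneg by simp
  then show ?thesis by simp
qed

lemma exit_before_le: "exit_before p q x N \<omega> \<le> real N"
proof -
  have "ereal (exit_before p q x N \<omega>) \<le> ereal (real N)" unfolding ereal_exit_before by simp
  then show ?thesis by simp
qed

section \<open>Processes stopped at admissible times\<close>

lemma stopT_inside:
  assumes "\<tau> \<in> stopT Mp W r \<sigma> a b x"
  shows "AE \<omega> in Mp. \<forall>t. 0 \<le> t \<and> t < \<tau> \<omega> \<longrightarrow> S x t \<omega> \<in> {a<..<b}"
proof -
  have "AE \<omega> in Mp. ereal (\<tau> \<omega>) \<le> exitT r \<sigma> W a b x \<omega>" using assms by (simp add: stopT_def)
  then show ?thesis
  proof eventually_elim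
    case (elim \<omega>)
    show ?case
    proof (intro allI impI, elim conjE)
      fix t assume t: "0 \<le> t" "t < \<tau> \<omega>"
      then have "ereal t < exitT r \<sigma> W a b x \<omega>" using elim by (metis less_ereal.simps(1) less_le_trans)
      then show "S x t \<omega> \<in> {a<..<b}" by (rule before_exitT[OF t(1)])
    qed
  qed
qed

lemma stopT_nonneg: "\<tau> \<in> stopT Mp W r \<sigma> a b x \<Longrightarrow> \<omega> \<in> space Mp \<Longrightarrow> 0 \<le> \<tau> \<omega>"
  by (simp add: stopT_def)

lemma stopT_measurable: "\<tau> \<in> stopT Mp W r \<sigma> a b x \<Longrightarrow> \<tau> \<in> borel_measurable Mp"
  by (auto simp: stopT_def intro: stopping_time_random_variable)

lemma stopT_stopped_in:
  assumes \<tau>: "\<tau> \<in> stopT Mp W r \<sigma> a b x" and x: "x \<in> {a..b}"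
  shows "AE \<omega> in Mp. S x (\<tau> \<omega>) \<omega> \<in> {a..b}"
  using stopT_inside[OF \<tau>] AE_space
proof eventually_elim
  case (elim \<omega>)
  show ?case
  proof (rule S_stopped_in_closure[OF elim(2) x stopT_nonneg[OF \<tau> elim(2)]])
    fix u assume "0 \<le> u" "u < \<tau> \<omega>"
    then have "S x u \<omega> \<in> {a<..<b}" using elim(1) by blast
    then show "S x u \<omega> \<in> {a..b}" by auto
  qed
qed

lemma stopT_min:
  assumes \<tau>: "\<tau> \<in> stopT Mp W r \<sigma> a b x"
  shows "(\<lambda>\<omega>. min (real N) (\<tau> \<omega>)) \<in> stopT Mp W r \<sigma> a b x"
proof -
  have "Measurable.pred (natF Mp W t) (\<lambda>\<omega>. min (real N) (\<tau> \<omega>) \<le> t)" for t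
  proof -
    have "Measurable.pred (natF Mp W t) (\<lambda>\<omega>. \<tau> \<omega> \<le> t)"
      using \<tau> by (simp add: stopT_def stopping_time_def)
    then show ?thesis unfolding min_le_iff_disj by measurable
  qed
  moreover have "AE \<omega> in Mp. ereal (min (real N) (\<tau> \<omega>)) \<le> exitT r \<sigma> W a b x \<omega>"
  proof -
    have "AE \<omega> in Mp. ereal (\<tau> \<omega>) \<le> exitT r \<sigma> W a b x \<omega>" using \<tau> by (simp add: stopT_def)
    then show ?thesis
    proof eventually_elim
      case (elim \<omega>)
      have "ereal (min (real N) (\<tau> \<omega>)) \<le> ereal (\<tau> \<omega>)" by simp
      then show ?case using elim by (rule order_trans)
    qed
  qed
  ultimately show ?thesis using \<tau> by (simp add: stopT_def stopping_time_def)
qed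

text \<open>A smaller interval is left no later than \<open>(a,b)\<close>, so these times compete in
  the infimum. The case \<open>p = q\<close> is included: the open interval is then empty and the
  exit immediate.\<close>

lemma exit_before_stopT:
  assumes "a \<le> p" "q \<le> b"
  shows "exit_before p q x N \<in> stopT Mp W r \<sigma> a b x"
proof -
  have "Measurable.pred (natF Mp W t) (\<lambda>\<omega>. exit_before p q x N \<omega> \<le> t)" for t
  proof -
    have "{\<omega>\<in>space Mp. exit_before p q x N \<omega> \<le> t} \<in> sets (natF Mp W t)"
    proof -
      consider "t < 0" | "real N \<le> t" | "0 \<le> t" "t < real N" by linarith
      then show ?thesis
      proof cases
        case 1
        then have "{\<omega>\<in>space Mp. exit_before p q x N \<omega> \<le> t} = {}"
          using exit_before_nonneg[of p q x N] by (auto simp: not_le intro: less_le_trans)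
        then show ?thesis by (simp only: sets.empty_sets)
      next
        case 2
        then have "{\<omega>\<in>space Mp. exit_before p q x N \<omega> \<le> t} = space (natF Mp W t)"
          using exit_before_le[of p q x N] by (auto intro: order_trans)
        then show ?thesis by (simp only: sets.top)
      next
        case 3
        have "exit_before p q x N \<omega> \<le> t \<longleftrightarrow> exitT r \<sigma> W p q x \<omega> \<le> ereal t" for \<omega>
          using 3 unfolding ereal_less_eq(3)[symmetric] ereal_exit_before min_le_iff_disj by auto
        then show ?thesis using exitT_event[OF 3(1), of p q x] by simp
      qed
    qed
    then show ?thesis by (simp add: pred_def)
  qed
  moreover have "ereal (exit_before p q x N \<omega>) \<le> exitT r \<sigma> W a b x \<omega>" for \<omega>
  proof -
    have "exitT r \<sigma> W p q x \<omega> \<le> exitT r \<sigma> W a b x \<omega>"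
      unfolding exitT_def using assms by (intro Inf_superset_mono) force
    then show ?thesis unfolding ereal_exit_before by (simp add: min.coboundedI2)
  qed
  ultimately show ?thesis using exit_before_nonneg by (simp add: stopT_def stopping_time_def)
qed

text \<open>If the cut-off has not intervened, the path is outside the open interval at this time,
  but in its closure as a limit of earlier positions.\<close>

lemma exit_before_value:
  assumes \<omega>: "\<omega> \<in> space Mp" and x: "x \<in> {p..q}" and less: "exit_before p q x N \<omega> < real N"
  shows "S x (exit_before p q x N \<omega>) \<omega> \<in> {p, q}"
proof -
  let ?t = "exit_before p q x N \<omega>"
  have eq: "ereal ?t = exitT r \<sigma> W p q x \<omega>"
    using less ereal_exit_before[of p q x N \<omega>] by (auto simp: min_def split: if_splits)
  then obtain s where s: "s \<in> {0..?t}" "S x s \<omega> \<notin> {p<..<q}"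
    using exitT_le_iff[OF \<omega> exit_before_nonneg[of p q x N \<omega>], of p q x] by auto
  have inside: "S x u \<omega> \<in> {p<..<q}" if "0 \<le> u" "u < ?t" for u
    using before_exitT[OF that(1), of p q x \<omega>] that(2) eq by (metis less_ereal.simps(1))
  have "s = ?t" using s inside[of s] by force
  moreover have "S x ?t \<omega> \<in> {p..q}"
  proof (rule S_stopped_in_closure[OF \<omega> x exit_before_nonneg])
    fix u assume "0 \<le> u" "u < ?t"
    from inside[OF this] show "S x u \<omega> \<in> {p..q}" by auto
  qed
  ultimately show ?thesis using s(2) by auto
qed

text \<open>A bound is asked for on \<open>[a,b]\<close> only, the range of the stopped process;
  nonconstant powers are unbounded on the positive half-line.\<close>

definition bounded_borel :: "(real \<Rightarrow> real) \<Rightarrow> bool" where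
  "bounded_borel v \<longleftrightarrow> v \<in> borel_measurable borel \<and> (\<exists>C\<ge>0. \<forall>s\<in>{a..b}. \<bar>v s\<bar> \<le> C)"

lemma bounded_borel_lincomb:
  assumes "bounded_borel v" "bounded_borel v'"
  shows "bounded_borel (\<lambda>s. c * v s + c' * v' s)"
proof -
  obtain C where C: "0 \<le> C" "\<And>s. s \<in> {a..b} \<Longrightarrow> \<bar>v s\<bar> \<le> C" using assms(1) unfolding bounded_borel_def by blast
  obtain C' where C': "0 \<le> C'" "\<And>s. s \<in> {a..b} \<Longrightarrow> \<bar>v' s\<bar> \<le> C'" using assms(2) unfolding bounded_borel_def by blast
  have [measurable]: "v \<in> borel_measurable borel" "v' \<in> borel_measurable borel"
    using assms by (auto simp: bounded_borel_def)
  have "\<bar>c * v s + c' * v' s\<bar> \<le> \<bar>c\<bar> * C + \<bar>c'\<bar> * C'" if "s \<in> {a..b}" for s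
  proof -
    have "\<bar>c * v s + c' * v' s\<bar> \<le> \<bar>c\<bar> * \<bar>v s\<bar> + \<bar>c'\<bar> * \<bar>v' s\<bar>"
      using abs_triangle_ineq[of "c * v s" "c' * v' s"] by (simp add: abs_mult)
    also have "\<dots> \<le> \<bar>c\<bar> * C + \<bar>c'\<bar> * C'" using C(2)[OF that] C'(2)[OF that] by (intro add_mono mult_left_mono) auto
    finally show ?thesis .
  qed
  then show ?thesis unfolding bounded_borel_def using C(1) C'(1)
    by (intro conjI exI[of _ "\<bar>c\<bar> * C + \<bar>c'\<bar> * C'"]) auto
qed

lemma stopped_value_bound:
  assumes \<tau>: "\<tau> \<in> stopT Mp W r \<sigma> a b x" and x: "x \<in> {a..b}"
    and C: "\<And>s. s \<in> {a..b} \<Longrightarrow> \<bar>v s\<bar> \<le> C"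
  shows "AE \<omega> in Mp. \<bar>exp (-2 * r * \<tau> \<omega>) * v (S x (\<tau> \<omega>) \<omega>)\<bar> \<le> C"
  using stopT_stopped_in[OF \<tau> x] AE_space
proof eventually_elim
  case (elim \<omega>)
  have "exp (-2 * r * \<tau> \<omega>) \<le> 1" using stopT_nonneg[OF \<tau> elim(2)] r_pos by simp
  then have "exp (-2 * r * \<tau> \<omega>) * \<bar>v (S x (\<tau> \<omega>) \<omega>)\<bar> \<le> 1 * C"
    using C[OF elim(1)] by (intro mult_mono) auto
  then show ?case by (simp add: abs_mult)
qed

lemma stopped_value_measurable:
  assumes \<tau>: "\<tau> \<in> stopT Mp W r \<sigma> a b x" and v[measurable]: "v \<in> borel_measurable borel"
  shows "(\<lambda>\<omega>. exp (-2 * r * \<tau> \<omega>) * v (S x (\<tau> \<omega>) \<omega>)) \<in> borel_measurable Mp"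
proof -
  note stopT_measurable[OF \<tau>, measurable]
  have [measurable]: "(\<lambda>\<omega>. S x (\<tau> \<omega>) \<omega>) \<in> borel_measurable Mp"
    using stopT_nonneg[OF \<tau>] by (intro S_at_random_time_measurable) auto
  show ?thesis by measurable
qed

lemma stopped_value_integrable:
  assumes \<tau>: "\<tau> \<in> stopT Mp W r \<sigma> a b x" and x: "x \<in> {a..b}" and v: "bounded_borel v"
  shows "integrable Mp (\<lambda>\<omega>. exp (-2 * r * \<tau> \<omega>) * v (S x (\<tau> \<omega>) \<omega>))"
proof -
  obtain C where C: "0 \<le> C" "\<And>s. s \<in> {a..b} \<Longrightarrow> \<bar>v s\<bar> \<le> C" using v unfolding bounded_borel_def by blast
  show ?thesis
    using stopped_value_bound[OF \<tau> x C(2)] v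
    by (intro integrable_const_bound[where B=C] stopped_value_measurable[OF \<tau>])
       (auto simp: bounded_borel_def)
qed

lemma stopped_pathint_bound:
  assumes \<tau>: "\<tau> \<in> stopT Mp W r \<sigma> a b x" and g: "g \<in> borel_measurable borel"
    and C: "0 \<le> C" "\<And>s. s \<in> {a..b} \<Longrightarrow> \<bar>g s\<bar> \<le> C"
  shows "AE \<omega> in Mp. \<bar>pathint g x (\<tau> \<omega>) \<omega>\<bar> \<le> C / (2 * r)"
  using stopT_inside[OF \<tau>] AE_space
proof eventually_elim
  case (elim \<omega>)
  have "\<forall>u. 0 < u \<and> ereal u < ereal (\<tau> \<omega>) \<longrightarrow> \<bar>g (S x u \<omega>)\<bar> \<le> C"
  proof (intro allI impI, elim conjE)
    fix u assume "0 < u" "ereal u < ereal (\<tau> \<omega>)"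
    then have "S x u \<omega> \<in> {a<..<b}" using elim(1) by simp
    then show "\<bar>g (S x u \<omega>)\<bar> \<le> C" by (intro C(2)) auto
  qed
  then show ?case using stopT_nonneg[OF \<tau> elim(2)] C(1) by (intro pathint_bound[OF elim(2) g]) simp_all
qed

lemma stopped_pathint_integrable:
  assumes \<tau>: "\<tau> \<in> stopT Mp W r \<sigma> a b x" and g: "bounded_borel g"
  shows "integrable Mp (\<lambda>\<omega>. pathint g x (\<tau> \<omega>) \<omega>)"
proof -
  obtain C where C: "0 \<le> C" "\<And>s. s \<in> {a..b} \<Longrightarrow> \<bar>g s\<bar> \<le> C" using g unfolding bounded_borel_def by blast
  have gm: "g \<in> borel_measurable borel" using g by (simp add: bounded_borel_def)
  show ?thesis
    using stopped_pathint_bound[OF \<tau> gm C] stopT_measurable[OF \<tau>] stopT_nonneg[OF \<tau>] gm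
    by (intro integrable_const_bound[where B="C / (2 * r)"] pathint_measurable) auto
qed

lemma stopped_pathint_lincomb:
  assumes \<tau>: "\<tau> \<in> stopT Mp W r \<sigma> a b x" and g: "bounded_borel g" "bounded_borel g'"
  shows "AE \<omega> in Mp. pathint (\<lambda>s. c * g s + c' * g' s) x (\<tau> \<omega>) \<omega> =
    c * pathint g x (\<tau> \<omega>) \<omega> + c' * pathint g' x (\<tau> \<omega>) \<omega>"
proof -
  obtain C where C: "0 \<le> C" "\<And>s. s \<in> {a..b} \<Longrightarrow> \<bar>g s\<bar> \<le> C" using g(1) unfolding bounded_borel_def by blast
  obtain C' where C': "0 \<le> C'" "\<And>s. s \<in> {a..b} \<Longrightarrow> \<bar>g' s\<bar> \<le> C'" using g(2) unfolding bounded_borel_def by blast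
  show ?thesis
    using stopT_inside[OF \<tau>] AE_space
  proof eventually_elim
    case (elim \<omega>)
    have in_ab: "S x u \<omega> \<in> {a..b}" if "0 < u" "ereal u < ereal (\<tau> \<omega>)" for u
    proof -
      have "S x u \<omega> \<in> {a<..<b}" using that elim(1) by simp
      then show ?thesis by auto
    qed
    show ?case
    proof (rule pathint_lincomb)
      show "\<forall>u. 0 < u \<and> ereal u < ereal (\<tau> \<omega>) \<longrightarrow> \<bar>g (S x u \<omega>)\<bar> \<le> C" using C(2) in_ab by blast
      show "\<forall>u. 0 < u \<and> ereal u < ereal (\<tau> \<omega>) \<longrightarrow> \<bar>g' (S x u \<omega>)\<bar> \<le> C'" using C'(2) in_ab by blast
    qed (use elim(2) stopT_nonneg[OF \<tau> elim(2)] g C(1) C'(1) in \<open>simp_all add: bounded_borel_def\<close>)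
  qed
qed

text \<open>Read \<open>Dynkin_pair v g\<close> as ``\<open>(L - 2r) v = g\<close> on \<open>(a,b)\<close>''.\<close>
definition Dynkin_pair :: "(real \<Rightarrow> real) \<Rightarrow> (real \<Rightarrow> real) \<Rightarrow> bool" where
  "Dynkin_pair v g \<longleftrightarrow> bounded_borel v \<and> bounded_borel g \<and>
    (\<forall>x\<in>{a..b}. \<forall>\<tau>\<in>stopT Mp W r \<sigma> a b x. \<forall>N::nat. (\<forall>\<omega>\<in>space Mp. \<tau> \<omega> \<le> real N) \<longrightarrow>
      expectation (\<lambda>\<omega>. exp (-2 * r * \<tau> \<omega>) * v (S x (\<tau> \<omega>) \<omega>)) =
      v x + expectation (\<lambda>\<omega>. pathint g x (\<tau> \<omega>) \<omega>))"

lemma Dynkin_pairD: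
  assumes "Dynkin_pair v g"
  shows "bounded_borel v" "bounded_borel g"
    and "x \<in> {a..b} \<Longrightarrow> \<tau> \<in> stopT Mp W r \<sigma> a b x \<Longrightarrow> (\<And>\<omega>. \<omega> \<in> space Mp \<Longrightarrow> \<tau> \<omega> \<le> real N) \<Longrightarrow>
      expectation (\<lambda>\<omega>. exp (-2 * r * \<tau> \<omega>) * v (S x (\<tau> \<omega>) \<omega>)) =
      v x + expectation (\<lambda>\<omega>. pathint g x (\<tau> \<omega>) \<omega>)"
proof -
  show "bounded_borel v" "bounded_borel g" using assms unfolding Dynkin_pair_def by blast+
  assume "x \<in> {a..b}" "\<tau> \<in> stopT Mp W r \<sigma> a b x" "\<And>\<omega>. \<omega> \<in> space Mp \<Longrightarrow> \<tau> \<omega> \<le> real N"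
  then show "expectation (\<lambda>\<omega>. exp (-2 * r * \<tau> \<omega>) * v (S x (\<tau> \<omega>) \<omega>)) =
      v x + expectation (\<lambda>\<omega>. pathint g x (\<tau> \<omega>) \<omega>)"
    using assms[unfolded Dynkin_pair_def, THEN conjunct2, THEN conjunct2, rule_format, of x \<tau> N] by blast
qed

lemma bounded_borel_powr: "bounded_borel (\<lambda>s. s powr p)"
proof -
  obtain C where "C > 0" "\<forall>s\<in>{a..b}. s powr p \<le> C" using powr_bounded by blast
  then show ?thesis unfolding bounded_borel_def by (intro conjI exI[of _ C]) auto
qed

lemma Dynkin_pair_powr: "Dynkin_pair (\<lambda>s. s powr p) (\<lambda>s. symbol (2 * r) p * s powr p)"
  unfolding Dynkin_pair_def
proof (intro conjI ballI allI impI)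
  show "bounded_borel (\<lambda>s. s powr p)" by (rule bounded_borel_powr)
  show "bounded_borel (\<lambda>s. symbol (2 * r) p * s powr p)"
    using bounded_borel_lincomb[OF bounded_borel_powr bounded_borel_powr, of "symbol (2 * r) p" p 0] by simp
  fix x \<tau> and N :: nat
  assume x: "x \<in> {a..b}" and \<tau>: "\<tau> \<in> stopT Mp W r \<sigma> a b x" and N: "\<forall>\<omega>\<in>space Mp. \<tau> \<omega> \<le> real N"
  have "AE \<omega> in Mp. \<forall>t. 0 \<le> t \<and> t < \<tau> \<omega> \<longrightarrow> S x t \<omega> \<in> {a..b}"
    using stopT_inside[OF \<tau>] by eventually_elim (metis atLeastAtMost_iff greaterThanLessThan_iff less_imp_le)
  then show "expectation (\<lambda>\<omega>. exp (-2 * r * \<tau> \<omega>) * S x (\<tau> \<omega>) \<omega> powr p) =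
      x powr p + expectation (\<lambda>\<omega>. pathint (\<lambda>s. symbol (2 * r) p * s powr p) x (\<tau> \<omega>) \<omega>)"
    using \<tau> N stopT_nonneg[OF \<tau>] by (intro power_Dynkin_bounded[OF x]) (auto simp: stopT_def)
qed

lemma Dynkin_pair_lincomb:
  assumes v: "Dynkin_pair v g" "Dynkin_pair v' g'"
  shows "Dynkin_pair (\<lambda>s. c * v s + c' * v' s) (\<lambda>s. c * g s + c' * g' s)"
  unfolding Dynkin_pair_def
proof (intro conjI ballI allI impI)
  have bb: "bounded_borel v" "bounded_borel v'" "bounded_borel g" "bounded_borel g'"
    using Dynkin_pairD(1,2)[OF v(1)] Dynkin_pairD(1,2)[OF v(2)] by simp_all
  show "bounded_borel (\<lambda>s. c * v s + c' * v' s)" "bounded_borel (\<lambda>s. c * g s + c' * g' s)"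
    using bb by (auto intro: bounded_borel_lincomb)
  fix x \<tau> and N :: nat
  assume x: "x \<in> {a..b}" and \<tau>: "\<tau> \<in> stopT Mp W r \<sigma> a b x" and N: "\<forall>\<omega>\<in>space Mp. \<tau> \<omega> \<le> real N"
  have split: "e * (c * y + c' * z) = c * (e * y) + c' * (e * z)" for e y z :: real
    by (simp add: algebra_simps)
  have "expectation (\<lambda>\<omega>. exp (-2 * r * \<tau> \<omega>) * (c * v (S x (\<tau> \<omega>) \<omega>) + c' * v' (S x (\<tau> \<omega>) \<omega>))) =
    c * expectation (\<lambda>\<omega>. exp (-2 * r * \<tau> \<omega>) * v (S x (\<tau> \<omega>) \<omega>)) +
    c' * expectation (\<lambda>\<omega>. exp (-2 * r * \<tau> \<omega>) * v' (S x (\<tau> \<omega>) \<omega>))"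
    unfolding split
    using stopped_value_integrable[OF \<tau> x bb(1)] stopped_value_integrable[OF \<tau> x bb(2)] by simp
  also have "\<dots> = c * (v x + expectation (\<lambda>\<omega>. pathint g x (\<tau> \<omega>) \<omega>)) +
      c' * (v' x + expectation (\<lambda>\<omega>. pathint g' x (\<tau> \<omega>) \<omega>))"
    by (simp only: Dynkin_pairD(3)[OF v(1) x \<tau> N[rule_format]] Dynkin_pairD(3)[OF v(2) x \<tau> N[rule_format]])
  also have "\<dots> = c * v x + c' * v' x +
      expectation (\<lambda>\<omega>. c * pathint g x (\<tau> \<omega>) \<omega> + c' * pathint g' x (\<tau> \<omega>) \<omega>)"
    using stopped_pathint_integrable[OF \<tau> bb(3)] stopped_pathint_integrable[OF \<tau> bb(4)]
    by (simp add: distrib_left)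
  also have "expectation (\<lambda>\<omega>. c * pathint g x (\<tau> \<omega>) \<omega> + c' * pathint g' x (\<tau> \<omega>) \<omega>) =
     expectation (\<lambda>\<omega>. pathint (\<lambda>s. c * g s + c' * g' s) x (\<tau> \<omega>) \<omega>)"
  proof (rule integral_cong_AE)
    show "AE \<omega> in Mp. c * pathint g x (\<tau> \<omega>) \<omega> + c' * pathint g' x (\<tau> \<omega>) \<omega> =
        pathint (\<lambda>s. c * g s + c' * g' s) x (\<tau> \<omega>) \<omega>"
      using stopped_pathint_lincomb[OF \<tau> bb(3,4), of c c'] by eventually_elim simp
    show "(\<lambda>\<omega>. pathint (\<lambda>s. c * g s + c' * g' s) x (\<tau> \<omega>) \<omega>) \<in> borel_measurable Mp"
      by (rule borel_measurable_integrable[OF stopped_pathint_integrable[OF \<tau> bounded_borel_lincomb[OF bb(3,4)]]])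
  qed (use stopped_pathint_integrable[OF \<tau> bb(3)] stopped_pathint_integrable[OF \<tau> bb(4)] in measurable)
  finally show "expectation (\<lambda>\<omega>. exp (-2 * r * \<tau> \<omega>) * (c * v (S x (\<tau> \<omega>) \<omega>) + c' * v' (S x (\<tau> \<omega>) \<omega>))) =
    c * v x + c' * v' x + expectation (\<lambda>\<omega>. pathint (\<lambda>s. c * g s + c' * g' s) x (\<tau> \<omega>) \<omega>)" .
qed

text \<open>The domains of agreement differ on purpose: at the stopping time the process may sit on
  the boundary, so \<open>v\<close> and \<open>v'\<close> must agree on the closed interval; before
  it the path is in the open interval, so the sources need to agree only there.\<close>

lemma Dynkin_pair_cong:
  assumes v: "Dynkin_pair v g" and v': "bounded_borel v'" "\<And>s. s \<in> {a..b} \<Longrightarrow> v' s = v s"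
    and g': "bounded_borel g'" "\<And>s. s \<in> {a<..<b} \<Longrightarrow> g' s = g s"
  shows "Dynkin_pair v' g'"
  unfolding Dynkin_pair_def
proof (intro conjI ballI allI impI v' g')
  have bb: "bounded_borel v" "bounded_borel g" using Dynkin_pairD(1,2)[OF v] by simp_all
  fix x \<tau> and N :: nat
  assume x: "x \<in> {a..b}" and \<tau>: "\<tau> \<in> stopT Mp W r \<sigma> a b x" and N: "\<forall>\<omega>\<in>space Mp. \<tau> \<omega> \<le> real N"
  have "expectation (\<lambda>\<omega>. exp (-2 * r * \<tau> \<omega>) * v' (S x (\<tau> \<omega>) \<omega>)) =
      expectation (\<lambda>\<omega>. exp (-2 * r * \<tau> \<omega>) * v (S x (\<tau> \<omega>) \<omega>))"
    using bb v' stopT_stopped_in[OF \<tau> x]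
    by (intro integral_cong_AE stopped_value_measurable[OF \<tau>]) (auto simp: bounded_borel_def elim: eventually_mono)
  also have "\<dots> = v x + expectation (\<lambda>\<omega>. pathint g x (\<tau> \<omega>) \<omega>)"
    by (rule Dynkin_pairD(3)[OF v x \<tau> N[rule_format]])
  also have "expectation (\<lambda>\<omega>. pathint g x (\<tau> \<omega>) \<omega>) = expectation (\<lambda>\<omega>. pathint g' x (\<tau> \<omega>) \<omega>)"
  proof (rule integral_cong_AE)
    show "AE \<omega> in Mp. pathint g x (\<tau> \<omega>) \<omega> = pathint g' x (\<tau> \<omega>) \<omega>"
      using stopT_inside[OF \<tau>] AE_space
    proof eventually_elim
      case (elim \<omega>)
      show ?case
      proof (rule pathint_cong)
        show "0 \<le> ereal (\<tau> \<omega>)" using stopT_nonneg[OF \<tau> elim(2)] by simp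
        fix u assume "0 < u" "ereal u < ereal (\<tau> \<omega>)"
        then have "S x u \<omega> \<in> {a<..<b}" using elim(1) by simp
        then show "g (S x u \<omega>) = g' (S x u \<omega>)" using g'(2) by metis
      qed
    qed
  qed (use stopped_pathint_integrable[OF \<tau> bb(2)] stopped_pathint_integrable[OF \<tau> g'(1)] in measurable)
  finally show "expectation (\<lambda>\<omega>. exp (-2 * r * \<tau> \<omega>) * v' (S x (\<tau> \<omega>) \<omega>)) =
      v' x + expectation (\<lambda>\<omega>. pathint g' x (\<tau> \<omega>) \<omega>)"
    using v'(2)[OF x] by simp
qed

text \<open>\<open>Dynkin_pair\<close> speaks of bounded stopping times. Cutting
  \<open>\<tau>\<close> off at \<open>N\<close>, the stopped value is pathwise constant from some
  \<open>N\<close> on and the path integral converges; discounting bounds both uniformly.\<close>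

lemma Dynkin_formula:
  assumes v: "Dynkin_pair v g" and x: "x \<in> {a..b}" and \<tau>: "\<tau> \<in> stopT Mp W r \<sigma> a b x"
  shows "expectation (\<lambda>\<omega>. exp (-2 * r * \<tau> \<omega>) * v (S x (\<tau> \<omega>) \<omega>)) =
      v x + expectation (\<lambda>\<omega>. pathint g x (\<tau> \<omega>) \<omega>)"
proof -
  have bb: "bounded_borel v" "bounded_borel g" using Dynkin_pairD(1,2)[OF v] by simp_all
  have m: "v \<in> borel_measurable borel" "g \<in> borel_measurable borel"
    using bb by (auto simp: bounded_borel_def)
  obtain C where C: "0 \<le> C" "\<And>s. s \<in> {a..b} \<Longrightarrow> \<bar>v s\<bar> \<le> C" using bb(1) unfolding bounded_borel_def by blast
  obtain C' where C': "0 \<le> C'" "\<And>s. s \<in> {a..b} \<Longrightarrow> \<bar>g s\<bar> \<le> C'" using bb(2) unfolding bounded_borel_def by blast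
  let ?\<tau> = "\<lambda>N \<omega>. min (real N) (\<tau> \<omega>)"
  have \<tau>N: "?\<tau> N \<in> stopT Mp W r \<sigma> a b x" for N using stopT_min[OF \<tau>] .
  have "(\<lambda>N. expectation (\<lambda>\<omega>. exp (-2 * r * ?\<tau> N \<omega>) * v (S x (?\<tau> N \<omega>) \<omega>))) \<longlonglongrightarrow>
    expectation (\<lambda>\<omega>. exp (-2 * r * \<tau> \<omega>) * v (S x (\<tau> \<omega>) \<omega>))"
  proof (rule integral_dominated_convergence[where w="\<lambda>_. C"])
    show "AE \<omega> in Mp. (\<lambda>N. exp (-2 * r * ?\<tau> N \<omega>) * v (S x (?\<tau> N \<omega>) \<omega>)) \<longlonglongrightarrow>
        exp (-2 * r * \<tau> \<omega>) * v (S x (\<tau> \<omega>) \<omega>)"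
    proof (intro AE_I2 tendsto_eventually)
      fix \<omega>
      obtain n0 :: nat where n0: "\<tau> \<omega> < real n0" using reals_Archimedean2 by blast
      show "\<forall>\<^sub>F N in sequentially. exp (-2 * r * ?\<tau> N \<omega>) * v (S x (?\<tau> N \<omega>) \<omega>) =
          exp (-2 * r * \<tau> \<omega>) * v (S x (\<tau> \<omega>) \<omega>)"
        using eventually_ge_at_top[of n0]
      proof eventually_elim
        case (elim N)
        then have "?\<tau> N \<omega> = \<tau> \<omega>" using n0 by simp
        then show ?case by simp
      qed
    qed
    show "AE \<omega> in Mp. norm (exp (-2 * r * ?\<tau> N \<omega>) * v (S x (?\<tau> N \<omega>) \<omega>)) \<le> C" for N
      unfolding real_norm_def by (rule stopped_value_bound[OF \<tau>N x C(2)])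
  qed (rule stopped_value_measurable[OF \<tau> m(1)] stopped_value_measurable[OF \<tau>N m(1)] integrable_const)+
  moreover have "(\<lambda>N. v x + expectation (\<lambda>\<omega>. pathint g x (?\<tau> N \<omega>) \<omega>)) \<longlonglongrightarrow>
    v x + expectation (\<lambda>\<omega>. pathint g x (\<tau> \<omega>) \<omega>)"
  proof (intro tendsto_add tendsto_const integral_dominated_convergence[where w="\<lambda>_. C' / (2 * r)"])
    show "AE \<omega> in Mp. (\<lambda>N. pathint g x (?\<tau> N \<omega>) \<omega>) \<longlonglongrightarrow> pathint g x (\<tau> \<omega>) \<omega>"
      using stopT_inside[OF \<tau>] AE_space
    proof eventually_elim
      case (elim \<omega>)
      have in_ab: "S x u \<omega> \<in> {a..b}" if "0 < u" "ereal u < ereal (\<tau> \<omega>)" for u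
      proof -
        have "S x u \<omega> \<in> {a<..<b}" using that elim(1) by simp
        then show ?thesis by auto
      qed
      have eq: "ereal (?\<tau> N \<omega>) = min (ereal (real N)) (ereal (\<tau> \<omega>))" for N by (simp add: min_def)
      show ?case
        unfolding eq
      proof (rule pathint_min_tendsto[OF elim(2) m(2) _ _ C'(1)])
        show "\<forall>u. 0 < u \<and> ereal u < ereal (\<tau> \<omega>) \<longrightarrow> \<bar>g (S x u \<omega>)\<bar> \<le> C'" using C'(2) in_ab by blast
      qed (use stopT_nonneg[OF \<tau> elim(2)] in simp)
    qed
    show "AE \<omega> in Mp. norm (pathint g x (?\<tau> N \<omega>) \<omega>) \<le> C' / (2 * r)" for N
      unfolding real_norm_def by (rule stopped_pathint_bound[OF \<tau>N m(2) C'])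
  qed (rule borel_measurable_integrable[OF stopped_pathint_integrable[OF \<tau> bb(2)]]
      borel_measurable_integrable[OF stopped_pathint_integrable[OF \<tau>N bb(2)]] integrable_const)+
  moreover have "expectation (\<lambda>\<omega>. exp (-2 * r * ?\<tau> N \<omega>) * v (S x (?\<tau> N \<omega>) \<omega>)) =
      v x + expectation (\<lambda>\<omega>. pathint g x (?\<tau> N \<omega>) \<omega>)" for N
  proof -
    show ?thesis by (rule Dynkin_pairD(3)[OF v x \<tau>N, where N=N]) simp
  qed
  ultimately show ?thesis by (simp add: LIMSEQ_unique)
qed

text \<open>Payoffs that agree at \<open>p\<close> and \<open>q\<close> can differ only if the
  cut-off \<open>N\<close> comes first, and then the discount factor is
  \<open>exp (-2 * r * N)\<close>. Nothing about the distribution of the exit time enters.\<close>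

lemma exit_value_tendsto:
  assumes p: "a \<le> p" "q \<le> b" and x: "x \<in> {p..q}" and v: "bounded_borel v" "bounded_borel v'"
    and eq: "v p = v' p" "v q = v' q"
  shows "(\<lambda>N. expectation (\<lambda>\<omega>. exp (-2 * r * exit_before p q x N \<omega>) * v (S x (exit_before p q x N \<omega>) \<omega>)) -
     expectation (\<lambda>\<omega>. exp (-2 * r * exit_before p q x N \<omega>) * v' (S x (exit_before p q x N \<omega>) \<omega>))) \<longlonglongrightarrow> 0"
proof -
  let ?T = "exit_before p q x"
  \<comment> \<open>A difference in the shape of \<open>bounded_borel_lincomb\<close>; later
    combinations keep coefficients 1 and -1 for the same reason.\<close>
  let ?d = "\<lambda>s. 1 * v s + (-1) * v' s"
  have x': "x \<in> {a..b}" using x p by auto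
  have T: "?T N \<in> stopT Mp W r \<sigma> a b x" for N using exit_before_stopT[OF p] .
  have d: "bounded_borel ?d" using v by (rule bounded_borel_lincomb)
  obtain C where C: "0 \<le> C" "\<And>s. s \<in> {a..b} \<Longrightarrow> \<bar>?d s\<bar> \<le> C" using d unfolding bounded_borel_def by blast
  have const: "expectation (\<lambda>\<omega>. c) = c" for c :: real by (simp add: prob_space)
  have bound: "\<bar>expectation (\<lambda>\<omega>. exp (-2 * r * ?T N \<omega>) * ?d (S x (?T N \<omega>) \<omega>))\<bar> \<le> C * exp (-2 * r * real N)" for N
  proof -
    have "AE \<omega> in Mp. \<bar>exp (-2 * r * ?T N \<omega>) * ?d (S x (?T N \<omega>) \<omega>)\<bar> \<le> C * exp (-2 * r * real N)"
      using stopT_stopped_in[OF T[of N] x'] AE_space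
    proof eventually_elim
      case (elim \<omega>)
      show ?case
      proof (cases "?T N \<omega> < real N")
        case True
        then have "?d (S x (?T N \<omega>) \<omega>) = 0" using exit_before_value[OF elim(2) x] eq by fastforce
        then show ?thesis using C(1) by simp
      next
        case False
        then have "?T N \<omega> = real N" using exit_before_le[of p q x N \<omega>] by simp
        then show ?thesis using C(2)[OF elim(1)] by (simp add: abs_mult mult.commute)
      qed
    qed
    then have "expectation (\<lambda>\<omega>. \<bar>exp (-2 * r * ?T N \<omega>) * ?d (S x (?T N \<omega>) \<omega>)\<bar>) \<le>
        expectation (\<lambda>\<omega>. C * exp (-2 * r * real N))"
      by (intro integral_mono_AE integrable_abs stopped_value_integrable[OF T x' d]) auto
    then have "expectation (\<lambda>\<omega>. \<bar>exp (-2 * r * ?T N \<omega>) * ?d (S x (?T N \<omega>) \<omega>)\<bar>) \<le> C * exp (-2 * r * real N)"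
      unfolding const .
    then show ?thesis by (rule order_trans[OF integral_abs_bound])
  qed
  have decay: "(\<lambda>N. C * exp (-2 * r * real N)) \<longlonglongrightarrow> C * 0"
  proof (intro tendsto_mult tendsto_const)
    have "(\<lambda>N. exp (-2 * r) ^ N) \<longlonglongrightarrow> 0" using r_pos by (intro LIMSEQ_realpow_zero) auto
    then show "(\<lambda>N. exp (-2 * r * real N)) \<longlonglongrightarrow> 0" by (simp add: exp_of_nat_mult[symmetric] mult.commute)
  qed
  have "(\<lambda>N. expectation (\<lambda>\<omega>. exp (-2 * r * ?T N \<omega>) * ?d (S x (?T N \<omega>) \<omega>))) \<longlonglongrightarrow> 0"
    by (rule Lim_null_comparison[OF always_eventually, OF allI, OF _ decay[unfolded mult_zero_right]])
       (unfold real_norm_def, rule bound)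
  moreover have "expectation (\<lambda>\<omega>. exp (-2 * r * ?T N \<omega>) * ?d (S x (?T N \<omega>) \<omega>)) =
     expectation (\<lambda>\<omega>. exp (-2 * r * ?T N \<omega>) * v (S x (?T N \<omega>) \<omega>)) -
     expectation (\<lambda>\<omega>. exp (-2 * r * ?T N \<omega>) * v' (S x (?T N \<omega>) \<omega>))" for N
  proof -
    have split: "e * (1 * y + (-1) * z) = e * y - e * z" for e y z :: real by (simp add: algebra_simps)
    show ?thesis
      unfolding split
      by (rule Bochner_Integration.integral_diff[OF stopped_value_integrable[OF T x' v(1)] stopped_value_integrable[OF T x' v(2)]])
  qed
  ultimately show ?thesis by (simp only:)
qed

text \<open>With zero boundary values the stopped value of \<open>v\<close> disappears in the limit
  of the cut-off exit times, and only the source integral is left. This identifies the potentials in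
  \<open>gam\<close> with solutions of boundary value problems.\<close>

lemma exit_potential:
  assumes v: "Dynkin_pair v g" and x: "x \<in> {a..b}" and zero: "v a = 0" "v b = 0"
  shows "expectation (\<lambda>\<omega>. pathint g x (exitT r \<sigma> W a b x \<omega>) \<omega>) = - v x"
proof -
  have bb: "bounded_borel v" "bounded_borel g" using Dynkin_pairD(1,2)[OF v] by simp_all
  have m: "g \<in> borel_measurable borel" using bb by (auto simp: bounded_borel_def)
  obtain C where C: "0 \<le> C" "\<And>s. s \<in> {a..b} \<Longrightarrow> \<bar>g s\<bar> \<le> C" using bb(2) unfolding bounded_borel_def by blast
  let ?T = "exit_before a b x"
  have T: "?T N \<in> stopT Mp W r \<sigma> a b x" for N by (rule exit_before_stopT) auto
  have lim: "(\<lambda>N. pathint g x (?T N \<omega>) \<omega>) \<longlonglongrightarrow> pathint g x (exitT r \<sigma> W a b x \<omega>) \<omega>"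
    if "\<omega> \<in> space Mp" for \<omega>
    unfolding ereal_exit_before
  proof (rule pathint_min_tendsto[OF that m exitT_nonneg _ C(1)], intro allI impI, elim conjE)
    fix u assume "0 < u" "ereal u < exitT r \<sigma> W a b x \<omega>"
    then have "S x u \<omega> \<in> {a<..<b}" by (intro before_exitT) auto
    then show "\<bar>g (S x u \<omega>)\<bar> \<le> C" by (intro C(2)) auto
  qed
  have meas: "(\<lambda>\<omega>. pathint g x (?T N \<omega>) \<omega>) \<in> borel_measurable Mp" for N
    by (rule borel_measurable_integrable[OF stopped_pathint_integrable[OF T bb(2)]])
  have "(\<lambda>N. expectation (\<lambda>\<omega>. pathint g x (?T N \<omega>) \<omega>)) \<longlonglongrightarrow>
      expectation (\<lambda>\<omega>. pathint g x (exitT r \<sigma> W a b x \<omega>) \<omega>)"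
  proof (rule integral_dominated_convergence[where w="\<lambda>_. C / (2 * r)"])
    show "(\<lambda>\<omega>. pathint g x (exitT r \<sigma> W a b x \<omega>) \<omega>) \<in> borel_measurable Mp"
      by (rule borel_measurable_LIMSEQ_real[OF lim meas])
    show "AE \<omega> in Mp. norm (pathint g x (?T N \<omega>) \<omega>) \<le> C / (2 * r)" for N
      unfolding real_norm_def by (rule stopped_pathint_bound[OF T m C])
  qed (use meas lim in auto)
  moreover have "(\<lambda>N. expectation (\<lambda>\<omega>. pathint g x (?T N \<omega>) \<omega>)) \<longlonglongrightarrow> - v x"
  proof -
    have z: "bounded_borel (\<lambda>_. 0)" by (auto simp: bounded_borel_def)
    have "(\<lambda>N. expectation (\<lambda>\<omega>. exp (-2 * r * ?T N \<omega>) * v (S x (?T N \<omega>) \<omega>)) - 0 - v x) \<longlonglongrightarrow> 0 - v x"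
      using exit_value_tendsto[OF order_refl order_refl x bb(1) z] zero
      by (intro tendsto_diff tendsto_const) simp
    then show ?thesis using Dynkin_formula[OF v x T] by simp
  qed
  ultimately show ?thesis by (rule LIMSEQ_unique)
qed

text \<open>By Dynkin's formula for \<open>U\<close>, the cost of a stopping time is
  \<open>U x\<close> minus the expected discounted value of \<open>U - M\<close>. A homogeneous
  \<open>l\<close> has expected discounted value \<open>l x\<close> at every admissible time: as a
  majorant it bounds all rewards, and if it meets \<open>U - M\<close> at \<open>p\<close> and
  \<open>q\<close>, the exit times from \<open>(p,q)\<close> reach \<open>l x\<close> in the limit.
  The slack \<open>e\<close> allows for points at which no majorant has the exact value.\<close>

theorem optimal_stopping_value:
  assumes U: "Dynkin_pair U (\<lambda>s. - f s)" and M: "bounded_borel M" and x: "x \<in> {a..b}"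
    and upper: "\<And>e. e > 0 \<Longrightarrow> \<exists>l. Dynkin_pair l (\<lambda>_. 0) \<and> (\<forall>s\<in>{a..b}. U s - M s \<le> l s) \<and> l x \<le> H + e"
    and lower: "\<exists>l p q. Dynkin_pair l (\<lambda>_. 0) \<and> a \<le> p \<and> p \<le> x \<and> x \<le> q \<and> q \<le> b \<and>
      l p = U p - M p \<and> l q = U q - M q \<and> l x = H"
  shows "(INF \<tau> \<in> stopT Mp W r \<sigma> a b x.
     expectation (\<lambda>\<omega>. pathint f x (\<tau> \<omega>) \<omega> + exp (-2 * r * \<tau> \<omega>) * M (S x (\<tau> \<omega>) \<omega>))) = U x - H"
proof -
  let ?J = "\<lambda>\<tau>. expectation (\<lambda>\<omega>. pathint f x (\<tau> \<omega>) \<omega> + exp (-2 * r * \<tau> \<omega>) * M (S x (\<tau> \<omega>) \<omega>))"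
  let ?\<phi> = "\<lambda>s. 1 * U s + (-1) * M s"
  have bb: "bounded_borel U" "bounded_borel (\<lambda>s. - f s)" using Dynkin_pairD(1,2)[OF U] by simp_all
  have \<phi>: "bounded_borel ?\<phi>" using bb(1) M by (rule bounded_borel_lincomb)
  have J: "?J \<tau> = U x - expectation (\<lambda>\<omega>. exp (-2 * r * \<tau> \<omega>) * ?\<phi> (S x (\<tau> \<omega>) \<omega>))"
    if \<tau>: "\<tau> \<in> stopT Mp W r \<sigma> a b x" for \<tau>
  proof -
    have neg: "pathint f x t \<omega> = - pathint (\<lambda>s. - f s) x t \<omega>" for t \<omega>
      unfolding pathint_def by (simp add: interval_lebesgue_integral_uminus)
    have "?J \<tau> = - expectation (\<lambda>\<omega>. pathint (\<lambda>s. - f s) x (\<tau> \<omega>) \<omega>) +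
        expectation (\<lambda>\<omega>. exp (-2 * r * \<tau> \<omega>) * M (S x (\<tau> \<omega>) \<omega>))"
      unfolding neg using stopped_pathint_integrable[OF \<tau> bb(2)] stopped_value_integrable[OF \<tau> x M] by simp
    also have "\<dots> = U x - (expectation (\<lambda>\<omega>. exp (-2 * r * \<tau> \<omega>) * U (S x (\<tau> \<omega>) \<omega>)) -
        expectation (\<lambda>\<omega>. exp (-2 * r * \<tau> \<omega>) * M (S x (\<tau> \<omega>) \<omega>)))"
      using Dynkin_formula[OF U x \<tau>] by simp
    also have "expectation (\<lambda>\<omega>. exp (-2 * r * \<tau> \<omega>) * U (S x (\<tau> \<omega>) \<omega>)) -
        expectation (\<lambda>\<omega>. exp (-2 * r * \<tau> \<omega>) * M (S x (\<tau> \<omega>) \<omega>)) =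
        expectation (\<lambda>\<omega>. exp (-2 * r * \<tau> \<omega>) * ?\<phi> (S x (\<tau> \<omega>) \<omega>))"
      using stopped_value_integrable[OF \<tau> x bb(1)] stopped_value_integrable[OF \<tau> x M]
      by (simp add: right_diff_distrib)
    finally show ?thesis .
  qed
  have pair0: "expectation (\<lambda>\<omega>. exp (-2 * r * \<tau> \<omega>) * l (S x (\<tau> \<omega>) \<omega>)) = l x"
    if "Dynkin_pair l (\<lambda>_. 0)" "\<tau> \<in> stopT Mp W r \<sigma> a b x" for l \<tau>
    using Dynkin_formula[OF that(1) x that(2)] by (simp add: pathint_def)
  have lb: "U x - H \<le> ?J \<tau>" if \<tau>: "\<tau> \<in> stopT Mp W r \<sigma> a b x" for \<tau>
  proof (rule field_le_epsilon)
    fix e :: real assume "e > 0"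
    then obtain l where l: "Dynkin_pair l (\<lambda>_. 0)" "\<forall>s\<in>{a..b}. U s - M s \<le> l s" "l x \<le> H + e"
      using upper by blast
    have "bounded_borel l" by (rule Dynkin_pairD(1)[OF l(1)])
    moreover have "AE \<omega> in Mp. exp (-2 * r * \<tau> \<omega>) * ?\<phi> (S x (\<tau> \<omega>) \<omega>) \<le>
        exp (-2 * r * \<tau> \<omega>) * l (S x (\<tau> \<omega>) \<omega>)"
      using stopT_stopped_in[OF \<tau> x] by eventually_elim (intro mult_left_mono; use l(2) in simp)
    ultimately have "expectation (\<lambda>\<omega>. exp (-2 * r * \<tau> \<omega>) * ?\<phi> (S x (\<tau> \<omega>) \<omega>)) \<le>
        expectation (\<lambda>\<omega>. exp (-2 * r * \<tau> \<omega>) * l (S x (\<tau> \<omega>) \<omega>))"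
      by (intro integral_mono_AE stopped_value_integrable[OF \<tau> x] \<phi>)
    then show "U x - H \<le> ?J \<tau> + e" unfolding J[OF \<tau>] pair0[OF l(1) \<tau>] using l(3) by linarith
  qed
  obtain l p q where l: "Dynkin_pair l (\<lambda>_. 0)" "a \<le> p" "p \<le> x" "x \<le> q" "q \<le> b"
    "l p = U p - M p" "l q = U q - M q" "l x = H" using lower by blast
  let ?T = "exit_before p q x"
  have T: "?T N \<in> stopT Mp W r \<sigma> a b x" for N using exit_before_stopT[OF l(2,5)] .
  have "bounded_borel l" by (rule Dynkin_pairD(1)[OF l(1)])
  then have "(\<lambda>N. expectation (\<lambda>\<omega>. exp (-2 * r * ?T N \<omega>) * ?\<phi> (S x (?T N \<omega>) \<omega>)) -
      expectation (\<lambda>\<omega>. exp (-2 * r * ?T N \<omega>) * l (S x (?T N \<omega>) \<omega>))) \<longlonglongrightarrow> 0"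
    using l by (intro exit_value_tendsto \<phi>) auto
  then have "(\<lambda>N. expectation (\<lambda>\<omega>. exp (-2 * r * ?T N \<omega>) * ?\<phi> (S x (?T N \<omega>) \<omega>)) - H) \<longlonglongrightarrow> 0"
    unfolding pair0[OF l(1) T] l(8) .
  then have "(\<lambda>N. (U x - H) - (expectation (\<lambda>\<omega>. exp (-2 * r * ?T N \<omega>) * ?\<phi> (S x (?T N \<omega>) \<omega>)) - H))
      \<longlonglongrightarrow> (U x - H) - 0"
    by (rule tendsto_diff[OF tendsto_const])
  moreover have "(U x - H) - (y - H) = U x - y" for y by simp
  ultimately have lim: "(\<lambda>N. ?J (?T N)) \<longlonglongrightarrow> U x - H"
    unfolding J[OF T] by (simp only: diff_zero)
  have bdd: "bdd_below (?J ` stopT Mp W r \<sigma> a b x)" by (rule bdd_belowI2[OF lb])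
  show ?thesis
  proof (rule antisym)
    show "(INF \<tau> \<in> stopT Mp W r \<sigma> a b x. ?J \<tau>) \<le> U x - H"
      by (rule LIMSEQ_le_const[OF lim]) (intro exI allI impI cINF_lower[OF bdd T])
    have "stopT Mp W r \<sigma> a b x \<noteq> {}" using T by blast
    then show "U x - H \<le> (INF \<tau> \<in> stopT Mp W r \<sigma> a b x. ?J \<tau>)"
      by (rule cINF_greatest[OF _ lb])
  qed
qed

end

section \<open>Concave envelopes\<close>

text \<open>Beyond distance \<open>d\<close> the cone has risen by the full oscillation
  \<open>2 * C\<close>, within it \<open>e\<close> suffices. Without \<open>e\<close> there need not
  be any cone, as for a function with infinite slope at \<open>y\<close>.\<close>

lemma continuous_le_cone:
  fixes F :: "real \<Rightarrow> real"
  assumes F: "continuous_on {A..B} F" and y: "y \<in> {A..B}" and e: "e > 0"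
  shows "\<exists>m\<ge>0. \<forall>z\<in>{A..B}. F z \<le> F y + e + m * \<bar>z - y\<bar>"
proof -
  obtain d where d: "d > 0" "\<And>z. z \<in> {A..B} \<Longrightarrow> dist z y < d \<Longrightarrow> dist (F z) (F y) < e"
    using F y e unfolding continuous_on_iff by metis
  have "bounded (F ` {A..B})"
    using F by (intro compact_imp_bounded compact_continuous_image) auto
  then obtain C where "\<forall>z\<in>{A..B}. \<bar>F z\<bar> \<le> C" unfolding bounded_iff by auto
  then have C: "\<And>z. z \<in> {A..B} \<Longrightarrow> \<bar>F z\<bar> \<le> C" by blast
  have C0: "C \<ge> 0" using C[OF y] by linarith
  show ?thesis
  proof (intro exI[of _ "2 * C / d"] conjI ballI)
    show "0 \<le> 2 * C / d" using C0 d by simp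
    fix z assume z: "z \<in> {A..B}"
    show "F z \<le> F y + e + 2 * C / d * \<bar>z - y\<bar>"
    proof (cases "dist z y < d")
      case True
      then have "F z < F y + e" using d(2)[OF z] by (simp add: dist_real_def abs_less_iff)
      moreover have "0 \<le> 2 * C / d * \<bar>z - y\<bar>" using C0 d by simp
      ultimately show ?thesis by linarith
    next
      case False
      then have "2 * C / d * d \<le> 2 * C / d * \<bar>z - y\<bar>"
        using C0 d by (intro mult_left_mono) (auto simp: dist_real_def)
      then have "2 * C \<le> 2 * C / d * \<bar>z - y\<bar>" using d by simp
      then show ?thesis using C[OF z] C[OF y] e by linarith
    qed
  qed
qed

locale concave_envelope =
  fixes F :: "real \<Rightarrow> real" and A B :: real
  assumes AB: "A < B" and F_cont: "continuous_on {A..B} F"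
begin

definition majorant :: "real \<Rightarrow> real \<Rightarrow> bool" where
  "majorant m c \<longleftrightarrow> (\<forall>z\<in>{A..B}. F z \<le> m * z + c)"

text \<open>Affine majorants, and not concave ones, are used because each of them corresponds to a
  homogeneous solution that bounds the reward.\<close>

definition env :: "real \<Rightarrow> real" where
  "env y = Inf {m * y + c | m c. majorant m c}"

lemma majorant_exists: "\<exists>m c. majorant m c"
proof -
  obtain m where "m \<ge> 0" "\<forall>z\<in>{A..B}. F z \<le> F A + 1 + m * \<bar>z - A\<bar>"
    using continuous_le_cone[OF F_cont, of A 1] AB by auto
  then have "majorant m (F A + 1 - m * A)"
    unfolding majorant_def by (auto simp: algebra_simps)
  then show ?thesis by blast
qed

lemma env_ge: "y \<in> {A..B} \<Longrightarrow> F y \<le> env y"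
  unfolding env_def using majorant_exists
  by (intro cInf_greatest) (auto simp: majorant_def)

lemma env_le: 
  assumes "majorant m c" "y \<in> {A..B}" shows "env y \<le> m * y + c"
  unfolding env_def
proof (rule cInf_lower)
  show "m * y + c \<in> {m * y + c | m c. majorant m c}" using assms(1) by blast
  show "bdd_below {m * y + c | m c. majorant m c}"
    by (rule bdd_belowI[of _ "F y"]) (use assms(2) in \<open>auto simp: majorant_def\<close>)
qed

lemma env_approx: "e > 0 \<Longrightarrow> \<exists>m c. majorant m c \<and> m * y + c < env y + e"
  using cInf_lessD[of "{m * y + c | m c. majorant m c}" "env y + e"] majorant_exists
  unfolding env_def[symmetric] by auto

lemma env_concave: "concave_on {A..B} env"
  unfolding concave_on_iff
proof (intro conjI ballI allI impI)
  fix x y u v :: real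
  assume x: "x \<in> {A..B}" and y: "y \<in> {A..B}" and uv: "0 \<le> u" "0 \<le> v" "u + v = 1"
  show "env (u *\<^sub>R x + v *\<^sub>R y) \<ge> u * env x + v * env y"
    unfolding env_def[of "u *\<^sub>R x + v *\<^sub>R y"]
  proof (rule cInf_greatest)
    show "{m * (u *\<^sub>R x + v *\<^sub>R y) + c | m c. majorant m c} \<noteq> {}" using majorant_exists by auto
    fix w assume "w \<in> {m * (u *\<^sub>R x + v *\<^sub>R y) + c | m c. majorant m c}"
    then obtain m c where w: "w = m * (u * x + v * y) + c" and mc: "majorant m c" by auto
    have "u * env x + v * env y \<le> u * (m * x + c) + v * (m * y + c)"
      using env_le[OF mc x] env_le[OF mc y] uv by (intro add_mono mult_left_mono) auto
    also have "\<dots> = m * (u * x + v * y) + (u + v) * c" by (simp add: algebra_simps)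
    finally show "u * env x + v * env y \<le> w" using w uv by simp
  qed
qed auto

text \<open>At an end point only one branch of the cone lies over \<open>[A,B]\<close>, so the cone
  is an affine majorant there. This gives the value of the envelope and its continuity at the ends,
  where concavity alone does not help.\<close>

lemma env_cone:
  assumes y: "y = A \<or> y = B" and e: "e > 0"
  shows "\<exists>m\<ge>0. \<forall>z\<in>{A..B}. env z \<le> F y + e + m * \<bar>z - y\<bar>"
proof -
  have yAB: "y \<in> {A..B}" using y AB by auto
  obtain m where m: "m \<ge> 0" "\<forall>z\<in>{A..B}. F z \<le> F y + e + m * \<bar>z - y\<bar>"
    using continuous_le_cone[OF F_cont yAB e] by blast
  define s :: real where "s = (if y = A then 1 else -1)"
  have abs: "\<bar>z - y\<bar> = s * (z - y)" if "z \<in> {A..B}" for z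
    using that y by (auto simp: s_def)
  have maj: "majorant (m * s) (F y + e - m * s * y)"
    unfolding majorant_def using m(2) abs by (auto simp: algebra_simps)
  have "env z \<le> F y + e + m * \<bar>z - y\<bar>" if z: "z \<in> {A..B}" for z
    unfolding abs[OF z] using env_le[OF maj z] by (simp add: algebra_simps)
  then show ?thesis using m(1) by blast
qed

lemma env_endpoint: "y = A \<or> y = B \<Longrightarrow> env y = F y"
proof (rule antisym)
  assume y: "y = A \<or> y = B"
  then have yAB: "y \<in> {A..B}" using AB by auto
  show "F y \<le> env y" by (rule env_ge[OF yAB])
  show "env y \<le> F y"
  proof (rule field_le_epsilon)
    fix e :: real assume "e > 0"
    from env_cone[OF y this] yAB show "env y \<le> F y + e" by fastforce
  qed
qed

text \<open>Inside, concavity suffices. At an end point \<open>F \<le> env\<close> gives the bound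
  from below, and a cone with half of the allowed margin as slack the bound from above.\<close>

lemma env_continuous: "continuous_on {A..B} env"
proof -
  have interior: "continuous (at y within {A..B}) env" if "y \<in> {A<..<B}" for y
  proof -
    have "convex_on {A<..<B} (\<lambda>z. - env z)"
      using env_concave unfolding concave_on_def by (rule convex_on_subset) auto
    then have "continuous_on {A<..<B} (\<lambda>z. - env z)"
      by (intro convex_on_continuous) auto
    then have "continuous_on {A<..<B} env" using continuous_on_minus by fastforce
    then have "isCont env y" using that by (simp add: continuous_on_eq_continuous_at)
    then show ?thesis by (rule continuous_at_imp_continuous_at_within)
  qed
  have endpoint: "continuous (at y within {A..B}) env" if y: "y = A \<or> y = B" for y
    unfolding continuous_within env_endpoint[OF y]
  proof (rule order_tendstoI)
    have yAB: "y \<in> {A..B}" using y AB by auto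
    have Flim: "(F \<longlongrightarrow> F y) (at y within {A..B})" using F_cont yAB by (auto simp: continuous_on_def)
    have in_AB: "\<forall>\<^sub>F z in at y within {A..B}. z \<in> {A..B}"
      by (simp add: eventually_at_filter)
    fix l assume "l < F y"
    from order_tendstoD(1)[OF Flim this] in_AB
    show "\<forall>\<^sub>F z in at y within {A..B}. l < env z"
      by eventually_elim (use env_ge less_le_trans in blast)
  next
    fix u assume u: "F y < u"
    obtain m where m: "\<forall>z\<in>{A..B}. env z \<le> F y + (u - F y) / 2 + m * \<bar>z - y\<bar>"
      using env_cone[OF y, of "(u - F y) / 2"] u by auto
    have lim: "((\<lambda>z. F y + (u - F y) / 2 + m * \<bar>z - y\<bar>) \<longlongrightarrow> F y + (u - F y) / 2 + m * \<bar>y - y\<bar>) (at y within {A..B})"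
      by (intro tendsto_intros)
    have "F y + (u - F y) / 2 + m * \<bar>y - y\<bar> < u" using u by (simp add: field_simps)
    from order_tendstoD(2)[OF lim this]
    have "\<forall>\<^sub>F z in at y within {A..B}. F y + (u - F y) / 2 + m * \<bar>z - y\<bar> < u" .
    moreover have "\<forall>\<^sub>F z in at y within {A..B}. z \<in> {A..B}"
      by (simp add: eventually_at_filter)
    ultimately show "\<forall>\<^sub>F z in at y within {A..B}. env z < u"
      by eventually_elim (use m le_less_trans in blast)
  qed
  show ?thesis
    unfolding continuous_on_eq_continuous_within
  proof
    fix y assume "y \<in> {A..B}"
    then have "y \<in> {A<..<B} \<or> (y = A \<or> y = B)" by auto
    then show "continuous (at y within {A..B}) env" using interior endpoint by blast
  qed
qed

lemma supporting_line:
  assumes y: "y \<in> {A<..<B}"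
  shows "\<exists>m c. majorant m c \<and> env y = m * y + c"
proof -
  have "convex_on {A..B} (\<lambda>z. - env z)" using env_concave by (simp add: concave_on_def)
  then obtain s where s: "\<And>z. z \<in> {A..B} \<Longrightarrow> - env z \<ge> - env y + s * (z - y)"
    using convex_le_Inf_differential[of "{A..B}" "\<lambda>z. - env z" y] y interior_atLeastAtMost_real by metis
  have "majorant (- s) (env y + s * y)"
    unfolding majorant_def
  proof
    fix z assume z: "z \<in> {A..B}"
    show "F z \<le> - s * z + (env y + s * y)"
      using env_ge[OF z] s[OF z] by (simp add: algebra_simps)
  qed
  then show ?thesis by (intro exI[of _ "- s"] exI[of _ "env y + s * y"]) simp
qed

text \<open>If a supporting line did not touch \<open>F\<close> on one side of \<open>y\<close>, it could be tilted about a
  point just beyond \<open>y\<close> into a majorant that is strictly smaller at \<open>y\<close>.\<close>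

lemma contact:
  assumes y: "y \<in> {A<..<B}" and mc: "majorant m c" "env y = m * y + c"
  shows "\<exists>p\<in>{A..y}. F p = m * p + c" "\<exists>q\<in>{y..B}. F q = m * q + c"
proof -
  define g where "g z = m * z + c - F z" for z
  have g0: "0 \<le> g z" if "z \<in> {A..B}" for z using mc(1) that by (simp add: g_def majorant_def)
  have gc: "continuous_on {A..B} g" unfolding g_def using F_cont by (intro continuous_intros)
  \<comment> \<open>The sign \<open>s\<close> selects the side: 1 if contact is missing on the left,
    -1 if on the right. The tilted line \<open>m * z + c - \<eta> * s * (t - z)\<close> is lower on
    the side of \<open>t\<close> that contains \<open>y\<close> and higher on the other.\<close>
  have tilt: False
    if t: "t \<in> {A<..<B}" "s * (t - y) > 0" "\<bar>s\<bar> = 1" and pos: "\<And>z. z \<in> {A..B} \<Longrightarrow> s * (t - z) \<ge> 0 \<Longrightarrow> g z > 0" for s t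
  proof -
    let ?K = "{z\<in>{A..B}. s * (t - z) \<ge> 0}"
    have s: "s = 1 \<or> s = -1" using t(3) by linarith
    have "closed ((\<lambda>z. s * (t - z)) -` {0..})"
      by (intro continuous_closed_vimage continuous_intros)
    then have "compact ({A..B} \<inter> (\<lambda>z. s * (t - z)) -` {0..})"
      by (intro compact_Int_closed) auto
    moreover have "{A..B} \<inter> (\<lambda>z. s * (t - z)) -` {0..} = ?K" by auto
    ultimately have K: "compact ?K" by simp
    have yK: "y \<in> ?K" using t y by auto
    have "continuous_on ?K g" by (rule continuous_on_subset[OF gc]) auto
    then obtain w where w: "w \<in> ?K" "\<And>z. z \<in> ?K \<Longrightarrow> g w \<le> g z"
      using continuous_attains_inf[OF K] yK by blast
    have gw: "g w > 0" using w(1) pos by blast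
    \<comment> \<open>\<open>g w\<close> is the least gap on the side that is lowered, and the line
      sinks by at most \<open>\<eta> * (B - A) = g w\<close> there, so it remains above
      \<open>F\<close>.\<close>
    define \<eta> where "\<eta> = g w / (B - A)"
    have \<eta>: "\<eta> > 0" using gw AB by (simp add: \<eta>_def)
    have "majorant (m - \<eta> * s * (-1)) (c - \<eta> * s * t)"
      unfolding majorant_def
    proof
      fix z assume z: "z \<in> {A..B}"
      have "\<eta> * (s * (t - z)) \<le> g z"
      proof (cases "s * (t - z) \<ge> 0")
        case True
        have "s * (t - z) \<le> B - A" using s t(1) z by auto
        then have "\<eta> * (s * (t - z)) \<le> \<eta> * (B - A)" using \<eta> by (intro mult_left_mono) auto
        also have "\<dots> = g w" using AB by (simp add: \<eta>_def)
        also have "\<dots> \<le> g z" using w(2) z True by blast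
        finally show ?thesis .
      next
        case False
        then have "\<eta> * (s * (t - z)) \<le> 0" using \<eta> by (simp add: mult_nonneg_nonpos)
        then show ?thesis using g0[OF z] by linarith
      qed
      then show "F z \<le> (m - \<eta> * s * (-1)) * z + (c - \<eta> * s * t)"
        by (simp add: g_def algebra_simps)
    qed
    then have "env y \<le> (m - \<eta> * s * (-1)) * y + (c - \<eta> * s * t)"
      using y by (intro env_le) auto
    then have "\<eta> * (s * (t - y)) \<le> 0" using mc(2) by (simp add: algebra_simps)
    moreover have "0 < \<eta> * (s * (t - y))" using \<eta> t(2) by (rule mult_pos_pos)
    ultimately show False by linarith
  qed
  have near: "\<exists>d>0. \<forall>z\<in>{A..B}. \<bar>z - y\<bar> < d \<longrightarrow> g z > 0" if gy: "g y > 0"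
  proof -
    have "y \<in> {A..B}" using y by auto
    then obtain d where "d > 0" "\<forall>z\<in>{A..B}. dist z y < d \<longrightarrow> dist (g z) (g y) < g y"
      using gc[unfolded continuous_on_iff] gy by blast
    then show ?thesis by (intro exI[of _ d]) (auto simp: dist_real_def abs_less_iff)
  qed
  show "\<exists>p\<in>{A..y}. F p = m * p + c"
  proof (rule ccontr)
    assume none: "\<not> ?thesis"
    have pos: "g z > 0" if "z \<in> {A..y}" for z
    proof -
      have "F z \<noteq> m * z + c" using none that by blast
      then have "g z \<noteq> 0" by (simp add: g_def)
      moreover have "g z \<ge> 0" using that y by (intro g0) auto
      ultimately show ?thesis by simp
    qed
    obtain d where d: "d > 0" "\<And>z. z \<in> {A..B} \<Longrightarrow> \<bar>z - y\<bar> < d \<Longrightarrow> g z > 0"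
      using near pos[of y] y by auto
    define t where "t = y + min (d / 2) ((B - y) / 2)"
    have t: "y < t" "t < B" "t < y + d" using d(1) y by (auto simp: t_def min_def field_simps)
    show False
    proof (rule tilt[of t 1])
      fix z assume z: "z \<in> {A..B}" "1 * (t - z) \<ge> 0"
      show "g z > 0"
      proof (cases "z \<le> y")
        case True then show ?thesis using z by (intro pos) auto
      next
        case False then show ?thesis using z t by (intro d(2)) auto
      qed
    qed (use t y in auto)
  qed
  show "\<exists>q\<in>{y..B}. F q = m * q + c"
  proof (rule ccontr)
    assume none: "\<not> ?thesis"
    have pos: "g z > 0" if "z \<in> {y..B}" for z
    proof -
      have "F z \<noteq> m * z + c" using none that by blast
      then have "g z \<noteq> 0" by (simp add: g_def)
      moreover have "g z \<ge> 0" using that y by (intro g0) auto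
      ultimately show ?thesis by simp
    qed
    obtain d where d: "d > 0" "\<And>z. z \<in> {A..B} \<Longrightarrow> \<bar>z - y\<bar> < d \<Longrightarrow> g z > 0"
      using near pos[of y] y by auto
    define t where "t = y - min (d / 2) ((y - A) / 2)"
    have t: "t < y" "A < t" "y - d < t" using d(1) y by (auto simp: t_def min_def field_simps)
    show False
    proof (rule tilt[of t "-1"])
      fix z assume z: "z \<in> {A..B}" "-1 * (t - z) \<ge> 0"
      show "g z > 0"
      proof (cases "y \<le> z")
        case True then show ?thesis using z by (intro pos) auto
      next
        case False then show ?thesis using z t by (intro d(2)) auto
      qed
    qed (use t y in auto)
  qed
qed

text \<open>Between two contact points of a supporting line the envelope coincides with it:
  concavity puts it above the chord, the majorant below. If \<open>y\<close> is itself a contact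
  point, \<open>p = q = y\<close> is possible.\<close>

lemma chord:
  assumes y: "y \<in> {A<..<B}"
  obtains m c p q where "majorant m c" "env y = m * y + c" "A \<le> p" "p \<le> y" "y \<le> q" "q \<le> B"
    "F p = m * p + c" "F q = m * q + c" "\<And>z. z \<in> {p..q} \<Longrightarrow> env z = m * z + c"
proof -
  obtain m c where mc: "majorant m c" "env y = m * y + c" using supporting_line[OF y] by blast
  obtain p where p: "p \<in> {A..y}" "F p = m * p + c" using contact(1)[OF y mc] by blast
  obtain q where q: "q \<in> {y..B}" "F q = m * q + c" using contact(2)[OF y mc] by blast
  have pq: "p \<in> {A..B}" "q \<in> {A..B}" using p q y by auto
  have "env z = m * z + c" if z: "z \<in> {p..q}" for z
  proof (rule antisym)
    show "env z \<le> m * z + c" using z pq by (intro env_le mc) auto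
    show "m * z + c \<le> env z"
    proof (cases "p = q")
      case True then show ?thesis using z p env_ge[OF pq(1)] by simp
    next
      case False
      then have pq_less: "p < q" using z by auto
      define u where "u = (q - z) / (q - p)"
      have u: "0 \<le> u" "u \<le> 1" using z pq_less by (auto simp: u_def field_simps)
      have zeq: "u * p + (1 - u) * q = z"
      proof -
        have "u * (q - p) = q - z" using pq_less by (simp add: u_def)
        then show ?thesis by (simp add: algebra_simps)
      qed
      have "m * z + c = u * (m * p + c) + (1 - u) * (m * q + c)"
        unfolding zeq[symmetric] by (simp add: algebra_simps)
      also have "\<dots> \<le> u * env p + (1 - u) * env q"
        using env_ge[OF pq(1)] env_ge[OF pq(2)] p(2) q(2) u by (intro add_mono mult_left_mono) auto
      also have "\<dots> \<le> env (u * p + (1 - u) * q)"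
        using env_concave[unfolded concave_on_iff, THEN conjunct2, rule_format, OF pq u(1), of "1 - u"] u by simp
      finally show ?thesis unfolding zeq .
    qed
  qed
  then show thesis using that[OF mc] p q by auto
qed

end

section \<open>Regularity of the envelope of a twice differentiable function\<close>

locale smooth_concave_envelope = concave_envelope +
  fixes F1 F2 :: "real \<Rightarrow> real"
  assumes F1: "\<And>y. y \<in> {A<..<B} \<Longrightarrow> (F has_real_derivative F1 y) (at y)"
    and F2: "\<And>y. y \<in> {A<..<B} \<Longrightarrow> (F1 has_real_derivative F2 y) (at y)"
    and finite_inflections: "finite {y\<in>{A<..<B}. F2 y = 0}"
begin

definition env1 :: "real \<Rightarrow> real" where "env1 = deriv env"

definition contacts :: "real set" where "contacts = {y\<in>{A<..<B}. env y = F y}"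

text \<open>\<open>F\<close> minus the line has a local maximum at the touching point.\<close>

lemma touching_slope:
  assumes y: "y \<in> {A<..<B}" and mc: "majorant m c" "F y = m * y + c"
  shows "F1 y = m"
proof -
  obtain e where e: "e > 0" "ball y e \<subseteq> {A<..<B}"
    using y open_greaterThanLessThan open_contains_ball by blast
  have "((\<lambda>z. F z - (m * z + c)) has_real_derivative F1 y - m) (at y)"
    using F1[OF y] by (auto intro!: derivative_eq_intros)
  moreover have "\<forall>z. \<bar>y - z\<bar> < e \<longrightarrow> F z - (m * z + c) \<le> F y - (m * y + c)"
  proof (intro allI impI)
    fix z assume "\<bar>y - z\<bar> < e"
    then have "z \<in> {A<..<B}" using e(2) by (auto simp: dist_real_def)
    then show "F z - (m * z + c) \<le> F y - (m * y + c)" using mc by (simp add: majorant_def)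
  qed
  ultimately have "F1 y - m = 0" using e(1) by (intro DERIV_local_max)
  then show ?thesis by simp
qed

text \<open>Strictly inside a chord the envelope is affine. Otherwise \<open>y\<close> is a contact
  point, and the envelope is squeezed between \<open>F\<close> and a tangent line of
  \<open>F\<close>, which have the same slope.\<close>

lemma env_has_derivative_slope:
  assumes y: "y \<in> {A<..<B}" and mc: "majorant m c" "env y = m * y + c"
    and pq: "p \<le> y" "y \<le> q" "F p = m * p + c" "F q = m * q + c" "\<And>z. z \<in> {p..q} \<Longrightarrow> env z = m * z + c"
  shows "(env has_real_derivative m) (at y)"
proof (cases "p < y \<and> y < q")
  case True
  have "((\<lambda>z. m * z + c) has_real_derivative m) (at y)" by (auto intro!: derivative_eq_intros)
  then show ?thesis
    by (rule has_field_derivative_transform_within_open[of _ _ _ "{p<..<q}"]) (use True pq(5) in auto)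
next
  case False
  then have Fy: "F y = m * y + c" using pq by auto
  have m: "F1 y = m" by (rule touching_slope[OF y mc(1) Fy])
  have "((\<lambda>z. (F z - F y) / (z - y) - m) \<longlongrightarrow> m - m) (at y)"
    using F1[OF y] m by (intro tendsto_intros) (simp add: has_field_derivative_iff)
  then have lim: "((\<lambda>z. \<bar>(F z - F y) / (z - y) - m\<bar>) \<longlongrightarrow> 0) (at y)"
    using tendsto_rabs_zero by force
  have "((\<lambda>z. (env z - env y) / (z - y) - m) \<longlongrightarrow> 0) (at y)"
  proof (rule Lim_null_comparison[OF _ lim])
    have "\<forall>\<^sub>F z in at y. z \<in> {A<..<B}"
      using y by (intro eventually_at_in_open') auto
    moreover have "\<forall>\<^sub>F z in at y. z \<noteq> y" by (simp add: eventually_at_filter)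
    ultimately show "\<forall>\<^sub>F z in at y. norm ((env z - env y) / (z - y) - m) \<le> \<bar>(F z - F y) / (z - y) - m\<bar>"
    proof eventually_elim
      case (elim z)
      have z: "z \<in> {A..B}" using elim by auto
      have eq: "(v - (m * y + c)) / (z - y) - m = (v - (m * z + c)) / (z - y)" for v
        using elim(2) by (simp add: field_simps)
      have "\<bar>env z - (m * z + c)\<bar> \<le> \<bar>F z - (m * z + c)\<bar>"
        using env_le[OF mc(1) z] env_ge[OF z] by linarith
      then show ?case
        unfolding mc(2) Fy eq by (simp add: abs_divide divide_right_mono)
    qed
  qed
  then show ?thesis
    unfolding has_field_derivative_iff using Lim_null by blast
qed

lemma env_deriv: "y \<in> {A<..<B} \<Longrightarrow> (env has_real_derivative env1 y) (at y)"
proof -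
  assume y: "y \<in> {A<..<B}"
  obtain m c p q where 1: "majorant m c" "env y = m * y + c" "A \<le> p" "p \<le> y" "y \<le> q" "q \<le> B"
    "F p = m * p + c" "F q = m * q + c" "\<And>z. z \<in> {p..q} \<Longrightarrow> env z = m * z + c"
    using chord[OF y] by blast
  have "(env has_real_derivative m) (at y)"
    by (rule env_has_derivative_slope[OF y 1(1,2,4,5,7,8,9)])
  then show ?thesis unfolding env1_def by (simp add: DERIV_imp_deriv)
qed

lemma chord1:
  assumes y: "y \<in> {A<..<B}"
  obtains c p q where "majorant (env1 y) c" "env y = env1 y * y + c" "A \<le> p" "p \<le> y" "y \<le> q" "q \<le> B"
    "F p = env1 y * p + c" "F q = env1 y * q + c" "\<And>z. z \<in> {p..q} \<Longrightarrow> env z = env1 y * z + c"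
proof -
  obtain m c p q where 1: "majorant m c" "env y = m * y + c" "A \<le> p" "p \<le> y" "y \<le> q" "q \<le> B"
    "F p = m * p + c" "F q = m * q + c" "\<And>z. z \<in> {p..q} \<Longrightarrow> env z = m * z + c"
    using chord[OF y] by blast
  have "(env has_real_derivative m) (at y)"
    by (rule env_has_derivative_slope[OF y 1(1,2,4,5,7,8,9)])
  then have "env1 y = m" unfolding env1_def by (rule DERIV_imp_deriv)
  then show thesis using that 1 by blast
qed

lemma env_supergradient:
  assumes y: "y \<in> {A<..<B}" and z: "z \<in> {A..B}"
  shows "env z \<le> env y + env1 y * (z - y)"
proof -
  obtain c where c: "majorant (env1 y) c" "env y = env1 y * y + c" using chord1[OF y] by metis
  then show ?thesis using env_le[OF c(1) z] by (simp add: algebra_simps)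
qed

text \<open>A differentiable concave function is continuously differentiable. To bound
  \<open>env1 z\<close> from below for \<open>z\<close> near \<open>y\<close>, take the chord from
  \<open>z\<close> to a fixed \<open>w\<close> to the right of \<open>y\<close>: its slope is a
  lower bound, depends continuously on \<open>z\<close>, and is close to \<open>env1 y\<close> at
  \<open>z = y\<close> if \<open>w\<close> is close to \<open>y\<close>. A point \<open>w\<close> on
  the left gives the upper bound.\<close>

lemma env1_continuous: "continuous_on {A<..<B} env1"
proof -
  have "(env1 \<longlongrightarrow> env1 y) (at y)" if y: "y \<in> {A<..<B}" for y
  proof (rule order_tendstoI)
    have env_y: "(env \<longlongrightarrow> env y) (at y)"
      using DERIV_isCont[OF env_deriv[OF y]] by (simp add: isCont_def)
    have quot: "((\<lambda>w. (env w - env y) / (w - y)) \<longlongrightarrow> env1 y) (at y)"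
      using env_deriv[OF y] by (simp add: has_field_derivative_iff)
    fix l assume l: "l < env1 y"
    obtain d where d: "d > 0" "\<And>w. w \<noteq> y \<Longrightarrow> dist w y < d \<Longrightarrow> l < (env w - env y) / (w - y)"
      using order_tendstoD(1)[OF quot l] unfolding eventually_at by auto
    define w where "w = y + min (d / 2) ((B - y) / 2)"
    have w: "y < w" "w < B" "dist w y < d" using d(1) y by (auto simp: w_def min_def dist_real_def field_simps)
    have "((\<lambda>z. (env w - env z) / (w - z)) \<longlongrightarrow> (env w - env y) / (w - y)) (at y)"
      using w by (intro tendsto_intros env_y) auto
    moreover have "l < (env w - env y) / (w - y)" using d(2)[of w] w by simp
    ultimately have "\<forall>\<^sub>F z in at y. l < (env w - env z) / (w - z)" by (rule order_tendstoD(1))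
    moreover have "\<forall>\<^sub>F z in at y. z \<in> {A<..<w}" using w y by (intro eventually_at_in_open') auto
    ultimately show "\<forall>\<^sub>F z in at y. l < env1 z"
    proof eventually_elim
      case (elim z)
      have "env w \<le> env z + env1 z * (w - z)" using elim w by (intro env_supergradient) auto
      then have "(env w - env z) / (w - z) \<le> env1 z" using elim by (simp add: pos_divide_le_eq)
      then show ?case using elim by simp
    qed
  next
    have env_y: "(env \<longlongrightarrow> env y) (at y)"
      using DERIV_isCont[OF env_deriv[OF y]] by (simp add: isCont_def)
    have quot: "((\<lambda>w. (env w - env y) / (w - y)) \<longlongrightarrow> env1 y) (at y)"
      using env_deriv[OF y] by (simp add: has_field_derivative_iff)
    fix l assume l: "env1 y < l"
    obtain d where d: "d > 0" "\<And>w. w \<noteq> y \<Longrightarrow> dist w y < d \<Longrightarrow> (env w - env y) / (w - y) < l"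
      using order_tendstoD(2)[OF quot l] unfolding eventually_at by auto
    define w where "w = y - min (d / 2) ((y - A) / 2)"
    have w: "w < y" "A < w" "dist w y < d" using d(1) y by (auto simp: w_def min_def dist_real_def field_simps)
    have "((\<lambda>z. (env w - env z) / (w - z)) \<longlongrightarrow> (env w - env y) / (w - y)) (at y)"
      using w by (intro tendsto_intros env_y) auto
    moreover have "(env w - env y) / (w - y) < l" using d(2)[of w] w by simp
    ultimately have "\<forall>\<^sub>F z in at y. (env w - env z) / (w - z) < l" by (rule order_tendstoD(2))
    moreover have "\<forall>\<^sub>F z in at y. z \<in> {w<..<B}" using w y by (intro eventually_at_in_open') auto
    ultimately show "\<forall>\<^sub>F z in at y. env1 z < l"
    proof eventually_elim
      case (elim z)
      have "env w \<le> env z + env1 z * (w - z)" using elim w by (intro env_supergradient) auto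
      then have "env1 z \<le> (env w - env z) / (w - z)" using elim by (simp add: neg_le_divide_eq)
      then show ?case using elim by simp
    qed
  qed
  then show ?thesis by (simp add: continuous_on_eq_continuous_at isCont_def)
qed

lemma env1_contact: "y \<in> contacts \<Longrightarrow> env1 y = F1 y"
proof -
  assume "y \<in> contacts"
  then have y: "y \<in> {A<..<B}" "env y = F y" by (auto simp: contacts_def)
  obtain c where c: "majorant (env1 y) c" "env y = env1 y * y + c" using chord1[OF y(1)] by metis
  then show ?thesis using touching_slope[OF y(1) c(1)] y(2) by simp
qed

text \<open>\<open>z\<close> lies on a chord of the envelope, at both ends of which \<open>F\<close>
  touches the same line tangentially. Equal values of \<open>F1\<close> there force a zero of
  \<open>F2\<close> in between.\<close>

lemma inflection_between:
  assumes p: "p \<in> contacts" and q: "q \<in> contacts" and z: "p < z" "z < q" "z \<notin> contacts"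
  shows "\<exists>s\<in>{y\<in>{A<..<B}. F2 y = 0}. p < s \<and> s < q"
proof -
  have pq: "A < p" "q < B" using p q by (auto simp: contacts_def)
  have zAB: "z \<in> {A<..<B}" using pq z by auto
  have Fz: "F z \<noteq> env z" using z(3) zAB by (auto simp: contacts_def)
  obtain c p0 q0 where 1: "majorant (env1 z) c" "env z = env1 z * z + c" "A \<le> p0" "p0 \<le> z" "z \<le> q0" "q0 \<le> B"
    "F p0 = env1 z * p0 + c" "F q0 = env1 z * q0 + c" "\<And>w. w \<in> {p0..q0} \<Longrightarrow> env w = env1 z * w + c"
    using chord1[OF zAB] by blast
  \<comment> \<open>Clipping the chord at \<open>p\<close> and \<open>q\<close> keeps its ends
    inside \<open>(A,B)\<close>, where \<open>F\<close> is differentiable; the clipped ends are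
    still contact points on the same line.\<close>
  let ?p = "max p p0" and ?q = "min q q0"
  have "p0 < z" "z < q0" using 1 Fz by (auto simp: less_le)
  then have less: "?p < z" "z < ?q" using z by auto
  have touch: "F ?p = env1 z * ?p + c" "F ?q = env1 z * ?q + c"
    using 1(9)[of p] 1(9)[of q] 1(4,5,7,8) p q z by (auto simp: max_def min_def contacts_def)
  have in_AB: "?p \<in> {A<..<B}" "?q \<in> {A<..<B}" using less pq z by (auto simp: max_def min_def)
  have slope: "F1 ?p = env1 z" "F1 ?q = env1 z"
    by (rule touching_slope[OF in_AB(1) 1(1) touch(1)], rule touching_slope[OF in_AB(2) 1(1) touch(2)])
  have "\<exists>s. ?p < s \<and> s < ?q \<and> F1 ?q - F1 ?p = (?q - ?p) * F2 s"
    using less in_AB by (intro MVT2 F2) auto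
  then obtain s where s: "?p < s" "s < ?q" "(?q - ?p) * F2 s = 0" using slope by auto
  then have "F2 s = 0" using less by auto
  then show ?thesis using s pq by (intro bexI[of _ s]) auto
qed

text \<open>Contact points with a gap immediately to the right or to the left, together with the
  inflection points. Including the latter gives each remaining contact point a neighbourhood without
  inflections.\<close>

definition exceptional :: "real set" where
  "exceptional = {y\<in>{A<..<B}. F2 y = 0} \<union>
     {y\<in>contacts. \<exists>e>0. \<forall>z. y < z \<and> z < y + e \<longrightarrow> z \<notin> contacts} \<union>
     {y\<in>contacts. \<exists>e>0. \<forall>z. y - e < z \<and> z < y \<longrightarrow> z \<notin> contacts}"

text \<open>Between two contact points that are both followed by a gap lies an inflection point, and
  finitely many points can separate only a finite set in this way. Gaps on the left are treated
  alike.\<close>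

lemma finite_exceptional: "finite exceptional"
proof -
  let ?Z = "{y\<in>{A<..<B}. F2 y = 0}"
  have fin: "finite K"
    if sep: "\<And>y y'. y \<in> K \<Longrightarrow> y' \<in> K \<Longrightarrow> y < y' \<Longrightarrow> \<exists>s\<in>?Z. y < s \<and> s < y'" for K
  proof -
    \<comment> \<open>Separated points have different sets of inflections below them; this embeds
      \<open>K\<close> into the finite power set of \<open>?Z\<close>.\<close>
    let ?g = "\<lambda>y. {s\<in>?Z. s < y}"
    have "inj_on ?g K"
    proof (rule linorder_inj_onI)
      fix y y' assume yy: "y < y'" "y \<in> K" "y' \<in> K"
      obtain s where "s \<in> ?Z" "y < s" "s < y'" using sep[OF yy(2,3,1)] by blast
      then have "s \<in> ?g y'" "s \<notin> ?g y" by auto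
      then show "?g y \<noteq> ?g y'" by blast
    qed auto
    moreover have "?g ` K \<subseteq> Pow ?Z" by auto
    ultimately show ?thesis using finite_inflections by (meson finite_Pow_iff inj_on_finite)
  qed
  have "finite {y\<in>contacts. \<exists>e>0. \<forall>z. y < z \<and> z < y + e \<longrightarrow> z \<notin> contacts}"
  proof (rule fin)
    fix y y' assume y: "y \<in> {y\<in>contacts. \<exists>e>0. \<forall>z. y < z \<and> z < y + e \<longrightarrow> z \<notin> contacts}"
      and y': "y' \<in> {y\<in>contacts. \<exists>e>0. \<forall>z. y < z \<and> z < y + e \<longrightarrow> z \<notin> contacts}" and less: "y < y'"
    obtain e where e: "e > 0" "\<And>z. y < z \<Longrightarrow> z < y + e \<Longrightarrow> z \<notin> contacts" using y by blast
    define z where "z = y + min (e / 2) ((y' - y) / 2)"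
    have z: "y < z" "z < y + e" "z < y'" using e(1) less by (auto simp: z_def min_def field_simps)
    show "\<exists>s\<in>?Z. y < s \<and> s < y'"
      by (rule inflection_between[OF _ _ z(1,3) e(2)[OF z(1,2)]]) (use y y' in blast)+
  qed
  moreover have "finite {y\<in>contacts. \<exists>e>0. \<forall>z. y - e < z \<and> z < y \<longrightarrow> z \<notin> contacts}"
  proof (rule fin)
    fix y y' assume y: "y \<in> {y\<in>contacts. \<exists>e>0. \<forall>z. y - e < z \<and> z < y \<longrightarrow> z \<notin> contacts}"
      and y': "y' \<in> {y\<in>contacts. \<exists>e>0. \<forall>z. y - e < z \<and> z < y \<longrightarrow> z \<notin> contacts}" and less: "y < y'"
    obtain e where e: "e > 0" "\<And>z. y' - e < z \<Longrightarrow> z < y' \<Longrightarrow> z \<notin> contacts" using y' by blast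
    define z where "z = y' - min (e / 2) ((y' - y) / 2)"
    have z: "z < y'" "y' - e < z" "y < z" using e(1) less by (auto simp: z_def min_def field_simps)
    show "\<exists>s\<in>?Z. y < s \<and> s < y'"
      by (rule inflection_between[OF _ _ z(3,1) e(2)[OF z(2,1)]]) (use y y' in blast)+
  qed
  ultimately show ?thesis using finite_inflections unfolding exceptional_def by blast
qed

text \<open>A contact point outside the exceptional set has contact points on both sides within a
  neighbourhood free of inflections. There can be no gap between these, so the envelope agrees with
  \<open>F\<close> near the point. Off the contact set the envelope is locally affine.\<close>

lemma env1_deriv:
  assumes y: "y \<in> {A<..<B}" "y \<notin> exceptional"
  shows "(env1 has_real_derivative (if y \<in> contacts then F2 y else 0)) (at y)"
proof (cases "y \<in> contacts")
  case True
  let ?Z = "{y\<in>{A<..<B}. F2 y = 0}"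
  have "open (- ?Z)" using finite_inflections by (intro open_Compl finite_imp_closed)
  moreover have "y \<in> - ?Z" using y by (auto simp: exceptional_def)
  ultimately obtain e where e: "e > 0" "ball y e \<subseteq> - ?Z" using open_contains_ball by blast
  obtain q where q: "q \<in> contacts" "y < q" "q < y + e"
    using y True e(1) by (auto simp: exceptional_def)
  obtain p where p: "p \<in> contacts" "p < y" "y - e < p"
    using y True e(1) by (auto simp: exceptional_def)
  have noZ: "s \<notin> ?Z" if "p < s" "s < q" for s
  proof -
    have "s \<in> ball y e" using that p q by (auto simp: dist_real_def)
    then show ?thesis using e(2) by blast
  qed
  have "z \<in> contacts" if "z \<in> {p<..<q}" for z
    using inflection_between[OF p(1) q(1), of z] noZ that by (metis greaterThanLessThan_iff)
  then have eq: "F1 z = env1 z" if "z \<in> {p<..<q}" for z using env1_contact that by metis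
  have "(env1 has_real_derivative F2 y) (at y)"
    by (rule has_field_derivative_transform_within_open[OF F2[OF y(1)], of "{p<..<q}"]) (use p q eq in auto)
  then show ?thesis using True by simp
next
  case False
  obtain c p q where 1: "majorant (env1 y) c" "env y = env1 y * y + c" "A \<le> p" "p \<le> y" "y \<le> q" "q \<le> B"
    "F p = env1 y * p + c" "F q = env1 y * q + c" "\<And>z. z \<in> {p..q} \<Longrightarrow> env z = env1 y * z + c"
    using chord1[OF y(1)] by blast
  have "F y \<noteq> env y" using False y by (auto simp: contacts_def)
  then have pq: "p < y" "y < q" using 1 by (auto simp: less_le)
  have eq: "env1 y = env1 z" if "z \<in> {p<..<q}" for z
  proof -
    have "((\<lambda>z. env1 y * z + c) has_real_derivative env1 y) (at z)" by (auto intro!: derivative_eq_intros)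
    then have "(env has_real_derivative env1 y) (at z)"
      by (rule has_field_derivative_transform_within_open[of _ _ _ "{p<..<q}"]) (use that 1(9) in auto)
    moreover have "(env has_real_derivative env1 z) (at z)" using that 1 by (intro env_deriv) auto
    ultimately show ?thesis by (rule DERIV_unique)
  qed
  have "(env1 has_real_derivative 0) (at y)"
    by (rule has_field_derivative_transform_within_open[of "\<lambda>_. env1 y" _ _ "{p<..<q}", OF _ _ _ eq]) (use pq in auto)
  then show ?thesis using False by simp
qed

text \<open>A positive \<open>F2 y\<close> would lift \<open>F\<close> above its tangent line just
  to the right of \<open>y\<close>, but that line is a majorant.\<close>

lemma F2_contact_nonpos:
  assumes "y \<in> contacts"
  shows "F2 y \<le> 0"
proof (rule ccontr)
  assume "\<not> F2 y \<le> 0"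
  have y: "y \<in> {A<..<B}" "env y = F y" using assms by (auto simp: contacts_def)
  obtain c where c: "majorant (env1 y) c" "env y = env1 y * y + c" using chord1[OF y(1)] by metis
  obtain d where d: "d > 0" "\<And>h. h > 0 \<Longrightarrow> h < d \<Longrightarrow> F1 y < F1 (y + h)"
    using DERIV_pos_inc_right[OF F2[OF y(1)]] \<open>\<not> F2 y \<le> 0\<close> by auto
  define z where "z = y + min (d / 2) ((B - y) / 2)"
  have z: "y < z" "z < y + d" "z < B" using d(1) y(1) by (auto simp: z_def min_def field_simps)
  have "F y - (env1 y * y + c) < F z - (env1 y * z + c)"
  proof (rule DERIV_pos_imp_increasing_open[OF z(1)])
    fix w assume w: "y < w" "w < z"
    have "((\<lambda>w. F w - (env1 y * w + c)) has_real_derivative F1 w - env1 y) (at w)"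
      using w z y by (auto intro!: derivative_eq_intros F1)
    moreover have "F1 w - env1 y > 0" using d(2)[of "w - y"] w z env1_contact[OF assms] by simp
    ultimately show "\<exists>D. ((\<lambda>w. F w - (env1 y * w + c)) has_real_derivative D) (at w) \<and> D > 0" by blast
  next
    have "continuous_on {y..z} F" by (rule continuous_on_subset[OF F_cont]) (use y z in auto)
    then show "continuous_on {y..z} (\<lambda>w. F w - (env1 y * w + c))" by (intro continuous_intros)
  qed
  moreover have "F z \<le> env1 y * z + c" using c(1) z y by (simp add: majorant_def)
  ultimately show False using c(2) y(2) by simp
qed

end

section \<open>Obstacle problems for the Euler operator\<close>

definition C2_on :: "real set \<Rightarrow> (real \<Rightarrow> real) \<Rightarrow> (real \<Rightarrow> real) \<Rightarrow> (real \<Rightarrow> real) \<Rightarrow> bool" where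
  "C2_on I f f1 f2 \<longleftrightarrow> (\<forall>x\<in>I. (f has_real_derivative f1 x) (at x)) \<and>
     (\<forall>x\<in>I. (f1 has_real_derivative f2 x) (at x)) \<and> continuous_on I f2"

lemma C2_onD:
  assumes "C2_on I f f1 f2"
  shows "x \<in> I \<Longrightarrow> (f has_real_derivative f1 x) (at x)"
    and "x \<in> I \<Longrightarrow> (f1 has_real_derivative f2 x) (at x)"
    and "continuous_on I f" and "continuous_on I f1" and "continuous_on I f2"
proof -
  show 1: "x \<in> I \<Longrightarrow> (f has_real_derivative f1 x) (at x)" for x using assms by (simp add: C2_on_def)
  show 2: "x \<in> I \<Longrightarrow> (f1 has_real_derivative f2 x) (at x)" for x using assms by (simp add: C2_on_def)
  show "continuous_on I f2" using assms by (simp add: C2_on_def)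
  show "continuous_on I f" "continuous_on I f1"
    by (rule DERIV_continuous_on, rule DERIV_subset[OF 1], auto)
       (rule DERIV_continuous_on, rule DERIV_subset[OF 2], auto)
qed

lemma C2_on_subset:
  assumes f: "C2_on I f f1 f2" and J: "J \<subseteq> I"
  shows "C2_on J f f1 f2"
  unfolding C2_on_def
proof (intro conjI ballI)
  fix x assume "x \<in> J"
  then have x: "x \<in> I" using J by blast
  show "(f has_real_derivative f1 x) (at x)" "(f1 has_real_derivative f2 x) (at x)"
    by (rule C2_onD(1)[OF f x], rule C2_onD(2)[OF f x])
qed (rule continuous_on_subset[OF C2_onD(5)[OF f] J])

lemma C2_on_lincomb:
  assumes f: "C2_on I f f1 f2" and g: "C2_on I g g1 g2"
  shows "C2_on I (\<lambda>x. c * f x + c' * g x) (\<lambda>x. c * f1 x + c' * g1 x) (\<lambda>x. c * f2 x + c' * g2 x)"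
  unfolding C2_on_def
  by (auto intro!: derivative_eq_intros C2_onD[OF f] C2_onD[OF g] continuous_intros)

lemma C2_on_mult:
  assumes f: "C2_on I f f1 f2" and g: "C2_on I g g1 g2"
  shows "C2_on I (\<lambda>x. f x * g x) (\<lambda>x. f1 x * g x + f x * g1 x)
    (\<lambda>x. f2 x * g x + 2 * f1 x * g1 x + f x * g2 x)"
  unfolding C2_on_def
  by (auto intro!: derivative_eq_intros C2_onD[OF f] C2_onD[OF g] continuous_intros simp: algebra_simps)

lemma C2_on_inverse:
  assumes f: "C2_on I f f1 f2" and nz: "\<And>x. x \<in> I \<Longrightarrow> f x \<noteq> 0"
  shows "C2_on I (\<lambda>x. 1 / f x) (\<lambda>x. - f1 x / (f x)\<^sup>2) (\<lambda>x. 2 * (f1 x)\<^sup>2 / (f x)^3 - f2 x / (f x)\<^sup>2)"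
  unfolding C2_on_def
  using nz by (auto intro!: derivative_eq_intros C2_onD[OF f] continuous_intros
      simp: field_simps power2_eq_square power3_eq_cube)

lemma C2_on_powr:
  "C2_on {0<..} (\<lambda>x. x powr p) (\<lambda>x. p * x powr (p - 1)) (\<lambda>x. p * (p - 1) * x powr (p - 2))"
  unfolding C2_on_def
  by (auto intro!: derivative_eq_intros continuous_intros simp: algebra_simps)

text \<open>The operator \<open>L - 2r\<close> with both derivatives supplied as arguments, which
  admits a second derivative that exists only outside a finite set.\<close>

definition generator :: "real \<Rightarrow> real \<Rightarrow> (real \<Rightarrow> real) \<Rightarrow> (real \<Rightarrow> real) \<Rightarrow> (real \<Rightarrow> real) \<Rightarrow> real \<Rightarrow> real" where
  "generator r \<sigma> v v1 v2 x = \<sigma>\<^sup>2 / 2 * x\<^sup>2 * v2 x + r * x * v1 x - 2 * r * v x"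

lemma generator_lincomb:
  "generator r \<sigma> (\<lambda>x. c * f x + c' * g x) (\<lambda>x. c * f1 x + c' * g1 x) (\<lambda>x. c * f2 x + c' * g2 x) x =
   c * generator r \<sigma> f f1 f2 x + c' * generator r \<sigma> g g1 g2 x"
proof -
  have "S * (c * p2 + c' * q2) + R * (c * p1 + c' * q1) - T * (c * p0 + c' * q0) =
     c * (S * p2 + R * p1 - T * p0) + c' * (S * q2 + R * q1 - T * q0)" for S R T p0 p1 p2 q0 q1 q2 :: real
    by (simp add: algebra_simps)
  then show ?thesis unfolding generator_def .
qed

lemma generator_powr:
  assumes "x > 0"
  shows "generator r \<sigma> (\<lambda>x. x powr p) (\<lambda>x. p * x powr (p - 1)) (\<lambda>x. p * (p - 1) * x powr (p - 2)) x =
    (\<sigma>\<^sup>2 / 2 * p * (p - 1) + r * p - 2 * r) * x powr p"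
proof -
  have "x\<^sup>2 * x powr (p - 2) = x powr p" "x * x powr (p - 1) = x powr p"
    using assms by (simp_all add: powr_diff)
  moreover have "S * X * (p * (p - 1) * A) + r * x * (p * B) - 2 * r * P = S * p * (p - 1) * (X * A) + r * p * (x * B) - 2 * r * P"
    for S X A B P :: real by (simp add: algebra_simps)
  moreover have "S * p * (p - 1) * P + r * p * P - 2 * r * P = (S * p * (p - 1) + r * p - 2 * r) * P" for S P :: real
    by (simp add: algebra_simps)
  ultimately show ?thesis unfolding generator_def by (simp only:)
qed

text \<open>Minimum principle: at an interior minimum with \<open>z \<le> 0\<close> the first-order
  term vanishes and the zero-order term is nonnegative, so a negative generator forces a negative
  second derivative, against minimality.\<close>

lemma positive_of_generator_negative:
  fixes z :: "real \<Rightarrow> real"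
  assumes ab: "0 < a" "a < b" and r: "r > 0" and \<sigma>: "\<sigma> > 0"
    and z: "continuous_on {a..b} z" "C2_on {a<..<b} z z1 z2" "z a = 0" "z b = 0"
    and neg: "\<And>x. x \<in> {a<..<b} \<Longrightarrow> generator r \<sigma> z z1 z2 x < 0"
    and x: "x \<in> {a<..<b}"
  shows "z x > 0"
proof (rule ccontr)
  assume "\<not> z x > 0"
  obtain w where w: "w \<in> {a..b}" "\<And>y. y \<in> {a..b} \<Longrightarrow> z w \<le> z y"
    using continuous_attains_inf[OF _ _ z(1)] ab by auto
  \<comment> \<open>A minimum at the boundary has the value 0; then \<open>x\<close>, where
    \<open>z\<close> is assumed nonpositive, is a minimum as well, and an interior one.\<close>
  obtain x0 where x0: "x0 \<in> {a<..<b}" "z x0 \<le> 0" "\<And>y. y \<in> {a..b} \<Longrightarrow> z x0 \<le> z y"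
  proof (cases "w \<in> {a<..<b}")
    case True
    moreover have "z w \<le> 0" using w(2)[of x] x \<open>\<not> z x > 0\<close> by simp
    ultimately show ?thesis using that w(2) by blast
  next
    case False
    then have "w = a \<or> w = b" using w(1) by auto
    then have "z w = 0" using z(3,4) by blast
    then have "z x \<le> z y" if "y \<in> {a..b}" for y using w(2)[OF that] \<open>\<not> z x > 0\<close> by linarith
    moreover have "z x \<le> 0" using \<open>\<not> z x > 0\<close> by simp
    ultimately show ?thesis using that x by blast
  qed
  obtain e where e: "e > 0" "ball x0 e \<subseteq> {a<..<b}"
    using x0 open_greaterThanLessThan open_contains_ball by blast
  have min: "\<forall>y. \<bar>x0 - y\<bar> < e \<longrightarrow> z x0 \<le> z y"
  proof (intro allI impI)
    fix y assume "\<bar>x0 - y\<bar> < e"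
    then have "y \<in> {a<..<b}" using e(2) by (auto simp: dist_real_def)
    then show "z x0 \<le> z y" by (intro x0(3)) auto
  qed
  have z1: "z1 x0 = 0" by (rule DERIV_local_min[OF C2_onD(1)[OF z(2) x0(1)] e(1) min])
  have "\<sigma>\<^sup>2 / 2 * x0\<^sup>2 * z2 x0 < 2 * r * z x0"
    using neg[OF x0(1)] z1 by (simp add: generator_def)
  also have "\<dots> \<le> 0" using r x0(2) by (simp add: mult_nonneg_nonpos)
  finally have "z2 x0 < 0" using \<sigma> x0(1) ab by (auto simp: mult_less_0_iff zero_less_mult_iff)
  then obtain d where d: "d > 0" "\<And>h. 0 < h \<Longrightarrow> h < d \<Longrightarrow> z1 (x0 + h) < 0"
    using DERIV_neg_dec_right[OF C2_onD(2)[OF z(2) x0(1)]] z1 by auto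
  define y where "y = x0 + min (d / 2) (e / 2)"
  have y: "x0 < y" "y < x0 + d" "y < x0 + e" using d(1) e(1) by (auto simp: y_def min_def)
  have in_ab: "t \<in> {a<..<b}" if "x0 \<le> t" "t \<le> y" for t
    using e(2) that y by (auto simp: dist_real_def subset_iff)
  have "z y < z x0"
  proof (rule DERIV_neg_imp_decreasing_open[OF y(1)])
    fix t assume t: "x0 < t" "t < y"
    have "z1 t < 0" using d(2)[of "t - x0"] t y by simp
    then show "\<exists>D. (z has_real_derivative D) (at t) \<and> D < 0"
      using C2_onD(1)[OF z(2) in_ab[of t]] t by auto
  next
    show "continuous_on {x0..y} z" by (rule continuous_on_subset[OF C2_onD(3)[OF z(2)]]) (use in_ab in auto)
  qed
  then show False using x0(3)[of y] in_ab[of y] y by auto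
qed

text \<open>Undoes the division by \<open>x powr \<beta>\<close> and the passage to the coordinate
  \<open>y = x powr \<delta>\<close>. If \<open>\<beta>\<close> and
  \<open>\<beta> + \<delta>\<close> are the characteristic exponents, the lifts of affine functions
  are the homogeneous solutions.\<close>

definition lift :: "real \<Rightarrow> real \<Rightarrow> (real \<Rightarrow> real) \<Rightarrow> real \<Rightarrow> real" where
  "lift \<beta> \<delta> H x = x powr \<beta> * H (x powr \<delta>)"

definition lift1 :: "real \<Rightarrow> real \<Rightarrow> (real \<Rightarrow> real) \<Rightarrow> (real \<Rightarrow> real) \<Rightarrow> real \<Rightarrow> real" where
  "lift1 \<beta> \<delta> H H1 x = \<beta> * x powr (\<beta> - 1) * H (x powr \<delta>) + \<delta> * x powr (\<beta> + \<delta> - 1) * H1 (x powr \<delta>)"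

definition lift2 :: "real \<Rightarrow> real \<Rightarrow> (real \<Rightarrow> real) \<Rightarrow> (real \<Rightarrow> real) \<Rightarrow> (real \<Rightarrow> real) \<Rightarrow> real \<Rightarrow> real" where
  "lift2 \<beta> \<delta> H H1 H2 x = \<beta> * (\<beta> - 1) * x powr (\<beta> - 2) * H (x powr \<delta>)
     + \<delta> * (2 * \<beta> + \<delta> - 1) * x powr (\<beta> + \<delta> - 2) * H1 (x powr \<delta>)
     + \<delta>\<^sup>2 * x powr (\<beta> + 2 * \<delta> - 2) * H2 (x powr \<delta>)"

lemma lift_deriv:
  assumes x: "x > 0" and H: "(H has_real_derivative H1 (x powr \<delta>)) (at (x powr \<delta>))"
  shows "(lift \<beta> \<delta> H has_real_derivative lift1 \<beta> \<delta> H H1 x) (at x)"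
proof -
  have "((\<lambda>x. x powr \<delta>) has_real_derivative \<delta> * x powr (\<delta> - 1)) (at x)"
    using x by (auto intro!: derivative_eq_intros)
  from DERIV_chain2[OF H this]
  have c: "((\<lambda>x. H (x powr \<delta>)) has_real_derivative H1 (x powr \<delta>) * (\<delta> * x powr (\<delta> - 1))) (at x)" .
  have "((\<lambda>x. x powr \<beta>) has_real_derivative \<beta> * x powr (\<beta> - 1)) (at x)"
    using x by (auto intro!: derivative_eq_intros)
  from DERIV_mult[OF this c] show ?thesis
    unfolding lift_def[abs_def] lift1_def
    by (rule DERIV_cong)
       (use powr_add[of x \<beta> "\<delta> - 1"] in \<open>simp add: algebra_simps\<close>)
qed

lemma lift1_deriv:
  assumes x: "x > 0" and H: "(H has_real_derivative H1 (x powr \<delta>)) (at (x powr \<delta>))"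
    and H1: "(H1 has_real_derivative H2 (x powr \<delta>)) (at (x powr \<delta>))"
  shows "(lift1 \<beta> \<delta> H H1 has_real_derivative lift2 \<beta> \<delta> H H1 H2 x) (at x)"
proof -
  \<comment> \<open>The first derivative is again a combination of lifts, with shifted exponents, so
    the previous lemma applies to each term.\<close>
  have eq: "lift1 \<beta> \<delta> H H1 = (\<lambda>x. \<beta> * lift (\<beta> - 1) \<delta> H x + \<delta> * lift (\<beta> + \<delta> - 1) \<delta> H1 x)"
    by (simp add: fun_eq_iff lift1_def lift_def mult.assoc)
  show ?thesis
    unfolding eq
    by (rule derivative_eq_intros lift_deriv[where ?H1.0=H1, OF x H] lift_deriv[where ?H1.0=H2, OF x H1] refl)+
       (simp add: lift1_def lift2_def algebra_simps power2_eq_square)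
qed

text \<open>The inner lift is the inverse transformation: it carries a function of \<open>x\<close>
  to the coordinate \<open>y\<close>.\<close>

lemma lift_lift:
  assumes "x > 0" "\<delta> \<noteq> 0"
  shows "lift \<beta> \<delta> (lift (- \<beta> / \<delta>) (1 / \<delta>) \<phi>) x = \<phi> x"
proof -
  have "(x powr \<delta>) powr (- \<beta> / \<delta>) = x powr - \<beta>" "(x powr \<delta>) powr (1 / \<delta>) = x"
    using assms by (simp_all add: powr_powr)
  then show ?thesis using assms by (simp add: lift_def powr_minus)
qed

text \<open>The coefficient of \<open>H\<close> contains the characteristic polynomial at
  \<open>\<beta>\<close>, that of \<open>H1\<close> its difference quotient between
  \<open>\<beta>\<close> and \<open>\<beta> + \<delta>\<close>; both vanish if the two exponents are
  roots. Only \<open>H2\<close> remains, with a weight that is positive for nonzero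
  \<open>\<sigma>\<close> and \<open>\<delta>\<close>: the sign of the generator is that of
  convexity in the new coordinate.\<close>

lemma generator_lift:
  assumes x: "x > 0" and root: "\<sigma>\<^sup>2 / 2 * \<beta> * (\<beta> - 1) + r * \<beta> - 2 * r = 0"
    and \<delta>: "\<sigma>\<^sup>2 / 2 * (2 * \<beta> + \<delta> - 1) + r = 0"
  shows "generator r \<sigma> (lift \<beta> \<delta> H) (lift1 \<beta> \<delta> H H1) (lift2 \<beta> \<delta> H H1 H2) x =
    \<sigma>\<^sup>2 / 2 * \<delta>\<^sup>2 * x powr (\<beta> + 2 * \<delta>) * H2 (x powr \<delta>)"
proof -
  have p2: "x\<^sup>2 * x powr (q - 2) = x powr q" and p1: "x * x powr (q - 1) = x powr q" for q
    using x by (simp_all add: powr_diff)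
  let ?H = "H (x powr \<delta>)" and ?H1 = "H1 (x powr \<delta>)" and ?H2 = "H2 (x powr \<delta>)"
  have "generator r \<sigma> (lift \<beta> \<delta> H) (lift1 \<beta> \<delta> H H1) (lift2 \<beta> \<delta> H H1 H2) x =
     \<sigma>\<^sup>2 / 2 * (\<beta> * (\<beta> - 1) * (x\<^sup>2 * x powr (\<beta> - 2)) * ?H
       + \<delta> * (2 * \<beta> + \<delta> - 1) * (x\<^sup>2 * x powr (\<beta> + \<delta> - 2)) * ?H1
       + \<delta>\<^sup>2 * (x\<^sup>2 * x powr (\<beta> + 2 * \<delta> - 2)) * ?H2)
     + r * (\<beta> * (x * x powr (\<beta> - 1)) * ?H + \<delta> * (x * x powr (\<beta> + \<delta> - 1)) * ?H1)
     - 2 * r * (x powr \<beta> * ?H)"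
    unfolding generator_def lift_def lift1_def lift2_def by (simp add: algebra_simps)
  also have "\<dots> = (\<sigma>\<^sup>2 / 2 * \<beta> * (\<beta> - 1) + r * \<beta> - 2 * r) * (x powr \<beta> * ?H)
     + (\<sigma>\<^sup>2 / 2 * (2 * \<beta> + \<delta> - 1) + r) * (\<delta> * x powr (\<beta> + \<delta>) * ?H1)
     + \<sigma>\<^sup>2 / 2 * \<delta>\<^sup>2 * x powr (\<beta> + 2 * \<delta>) * ?H2"
    unfolding p1 p2 by (simp add: algebra_simps add_divide_distrib diff_divide_distrib)
  finally show ?thesis using root \<delta> by simp
qed

lemma continuous_on_abs_bounded:
  fixes g :: "real \<Rightarrow> real"
  assumes "continuous_on {c..d} g"
  obtains C where "\<And>x. x \<in> {c..d} \<Longrightarrow> \<bar>g x\<bar> \<le> C"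
proof -
  have "bounded (g ` {c..d})"
    using assms by (intro compact_imp_bounded compact_continuous_image) auto
  then obtain C where "\<forall>x\<in>{c..d}. \<bar>g x\<bar> \<le> C" unfolding bounded_iff by auto
  then show thesis using that by blast
qed

text \<open>A continuous \<open>u1\<close> that is differentiable off a finite set still satisfies
  the fundamental theorem of calculus, so the piecewise second derivative is also the weak one. The
  continuous \<open>g\<close> supplies the local bounds.\<close>

lemma obstacle_solutionI:
  assumes u: "continuous_on {a..b} u" "u a = 0" "u b = 0"
    and u1: "\<And>x. x \<in> {a<..<b} \<Longrightarrow> (u has_real_derivative u1 x) (at x)" "continuous_on {a<..<b} u1"
    and E: "finite E" and u2: "\<And>x. x \<in> {a<..<b} - E \<Longrightarrow> (u1 has_real_derivative u2 x) (at x)"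
    and meas: "u2 \<in> borel_measurable borel"
    and bound: "continuous_on {a<..<b} g" "\<And>x. x \<in> {a<..<b} \<Longrightarrow> \<bar>u2 x\<bar> \<le> g x"
    and eq: "\<And>x. x \<in> {a<..<b} - E \<Longrightarrow>
      min (\<sigma>\<^sup>2 / 2 * x\<^sup>2 * u2 x + r * x * u1 x - 2 * r * u x + fh x) (Mo x - u x) = 0"
  shows "obstacle_solution r \<sigma> a b fh Mo u"
proof -
  have pde: "AE x in lborel. x \<in> {a<..<b} \<longrightarrow>
      min (\<sigma>\<^sup>2 / 2 * x\<^sup>2 * u2 x + r * x * u1 x - 2 * r * u x + fh x) (Mo x - u x) = 0"
  proof -
    have "E \<in> null_sets lborel" using E by (rule finite_imp_null_set_lborel)
    then have "AE x in lborel. x \<notin> E" by (rule AE_not_in)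
    then show ?thesis by eventually_elim (use eq in blast)
  qed
  have weak: "set_integrable lborel {c..d} u2 \<and> u1 d - u1 c = (LBINT t=c..d. u2 t) \<and>
      (\<exists>B. AE t in lborel. t \<in> {c..d} \<longrightarrow> \<bar>u2 t\<bar> \<le> B)"
    if cd: "a < c \<and> c \<le> d \<and> d < b" for c d
  proof (intro conjI)
    have sub: "{c..d} \<subseteq> {a<..<b}" using cd by auto
    obtain C where C: "\<And>x. x \<in> {c..d} \<Longrightarrow> \<bar>g x\<bar> \<le> C"
      using continuous_on_abs_bounded[OF continuous_on_subset[OF bound(1) sub]] by blast
    have le: "\<bar>u2 x\<bar> \<le> C" if "x \<in> {c..d}" for x
      using bound(2)[of x] C[OF that] sub that by (smt (verit) subsetD)
    show si: "set_integrable lborel {c..d} u2"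
      unfolding set_integrable_def using meas le
      using cd by (intro integrableI_bounded_set_indicator[where B=C]) (auto simp: emeasure_lborel_Icc_eq)
    show "u1 d - u1 c = (LBINT t=c..d. u2 t)"
    proof -
      have "(u2 has_integral (u1 d - u1 c)) {c..d}"
      proof (rule fundamental_theorem_of_calculus_strong[OF E])
        show "c \<le> d" using cd by simp
        show "continuous_on {c..d} u1" by (rule continuous_on_subset[OF u1(2) sub])
        fix x assume "x \<in> {c..d} - E"
        then show "(u1 has_vector_derivative u2 x) (at x)"
          using u2[of x] sub by (auto simp: has_real_derivative_iff_has_vector_derivative)
      qed
      then show ?thesis using interval_integral_eq_integral[OF _ si] cd by (simp add: integral_unique)
    qed
    show "\<exists>B. AE t in lborel. t \<in> {c..d} \<longrightarrow> \<bar>u2 t\<bar> \<le> B" using le by (intro exI[of _ C] AE_I2) auto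
  qed
  have "u2 \<in> borel_measurable lborel" using meas by simp
  then show ?thesis
    unfolding obstacle_solution_def using u u1 pde weak by blast
qed

lemma obstacle_solutionE:
  assumes "obstacle_solution r \<sigma> a b fh Mo u"
  obtains u1 u2 where "continuous_on {a..b} u" "u a = 0" "u b = 0"
    "\<And>x. x \<in> {a<..<b} \<Longrightarrow> (u has_real_derivative u1 x) (at x)" "continuous_on {a<..<b} u1"
    "\<And>c d. a < c \<Longrightarrow> c \<le> d \<Longrightarrow> d < b \<Longrightarrow> set_integrable lborel {c..d} u2 \<and> u1 d - u1 c = (LBINT t=c..d. u2 t)"
    "AE x in lborel. x \<in> {a<..<b} \<longrightarrow>
      min (\<sigma>\<^sup>2 / 2 * x\<^sup>2 * u2 x + r * x * u1 x - 2 * r * u x + fh x) (Mo x - u x) = 0"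
proof -
  have 1: "continuous_on {a..b} u" "u a = 0" "u b = 0"
    using assms unfolding obstacle_solution_def by simp_all
  from assms[unfolded obstacle_solution_def, THEN conjunct2, THEN conjunct1]
  obtain u1 u2 where 2: "\<forall>x\<in>{a<..<b}. (u has_real_derivative u1 x) (at x)"
    and 3: "continuous_on {a<..<b} u1"
    and 4: "\<forall>c d. a < c \<and> c \<le> d \<and> d < b \<longrightarrow> set_integrable lborel {c..d} u2 \<and> u1 d - u1 c = (LBINT t=c..d. u2 t) \<and>
      (\<exists>B. AE t in lborel. t \<in> {c..d} \<longrightarrow> \<bar>u2 t\<bar> \<le> B)"
    and 5: "AE x in lborel. x \<in> {a<..<b} \<longrightarrow>
      min (\<sigma>\<^sup>2 / 2 * x\<^sup>2 * u2 x + r * x * u1 x - 2 * r * u x + fh x) (Mo x - u x) = 0"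
    by (elim exE conjE) (rule that; assumption)
  show thesis
  proof (rule that[OF 1 _ 3 _ 5])
    show "(u has_real_derivative u1 x) (at x)" if "x \<in> {a<..<b}" for x using 2 that by (rule bspec)
    show "set_integrable lborel {c..d} u2 \<and> u1 d - u1 c = (LBINT t=c..d. u2 t)"
      if "a < c" "c \<le> d" "d < b" for c d using 4[rule_format, of c d] that by simp
  qed
qed

text \<open>At a positive maximum of the difference of two solutions the smaller one does not touch the
  obstacle, so the second derivative of the difference is bounded below by a positive constant just
  to the right of that point.\<close>

lemma obstacle_solution_le:
  assumes ab: "0 < a" "a < b" and r: "r > 0" and \<sigma>: "\<sigma> > 0"
    and u: "obstacle_solution r \<sigma> a b fh Mo u" and v: "obstacle_solution r \<sigma> a b fh Mo v"
    and x: "x \<in> {a..b}"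
  shows "u x \<le> v x"
proof (rule ccontr)
  assume "\<not> u x \<le> v x"
  obtain u1 u2 where U: "continuous_on {a..b} u" "u a = 0" "u b = 0"
    "\<And>x. x \<in> {a<..<b} \<Longrightarrow> (u has_real_derivative u1 x) (at x)" "continuous_on {a<..<b} u1"
    "\<And>c d. a < c \<Longrightarrow> c \<le> d \<Longrightarrow> d < b \<Longrightarrow> set_integrable lborel {c..d} u2 \<and> u1 d - u1 c = (LBINT t=c..d. u2 t)"
    "AE x in lborel. x \<in> {a<..<b} \<longrightarrow>
      min (\<sigma>\<^sup>2 / 2 * x\<^sup>2 * u2 x + r * x * u1 x - 2 * r * u x + fh x) (Mo x - u x) = 0"
    by (rule obstacle_solutionE[OF u]) (rule that)
  obtain v1 v2 where V: "continuous_on {a..b} v" "v a = 0" "v b = 0"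
    "\<And>x. x \<in> {a<..<b} \<Longrightarrow> (v has_real_derivative v1 x) (at x)" "continuous_on {a<..<b} v1"
    "\<And>c d. a < c \<Longrightarrow> c \<le> d \<Longrightarrow> d < b \<Longrightarrow> set_integrable lborel {c..d} v2 \<and> v1 d - v1 c = (LBINT t=c..d. v2 t)"
    "AE x in lborel. x \<in> {a<..<b} \<longrightarrow>
      min (\<sigma>\<^sup>2 / 2 * x\<^sup>2 * v2 x + r * x * v1 x - 2 * r * v x + fh x) (Mo x - v x) = 0"
    by (rule obstacle_solutionE[OF v]) (rule that)
  define z where "z t = u t - v t" for t
  define z1 where "z1 t = u1 t - v1 t" for t
  have zc: "continuous_on {a..b} z" unfolding z_def by (intro continuous_intros U V)
  have zd: "(z has_real_derivative z1 t) (at t)" if "t \<in> {a<..<b}" for t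
    unfolding z_def z1_def using U(4)[OF that] V(4)[OF that] by (auto intro!: derivative_eq_intros)
  have z1c: "continuous_on {a<..<b} z1" unfolding z1_def by (intro continuous_intros U V)
  obtain x0 where x0: "x0 \<in> {a..b}" "\<And>t. t \<in> {a..b} \<Longrightarrow> z t \<le> z x0"
    using continuous_attains_sup[OF _ _ zc] ab by auto
  have pos: "z x0 > 0" using x0(2)[OF x] \<open>\<not> u x \<le> v x\<close> by (simp add: z_def)
  have "x0 \<noteq> a" "x0 \<noteq> b" using pos U(2,3) V(2,3) by (auto simp: z_def)
  then have x0ab: "x0 \<in> {a<..<b}" using x0(1) by auto
  obtain e where e: "e > 0" "ball x0 e \<subseteq> {a<..<b}"
    using x0ab open_greaterThanLessThan open_contains_ball by blast
  have max: "\<forall>t. \<bar>x0 - t\<bar> < e \<longrightarrow> z t \<le> z x0"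
  proof (intro allI impI)
    fix t assume "\<bar>x0 - t\<bar> < e"
    then have "t \<in> {a<..<b}" using e(2) by (auto simp: dist_real_def)
    then show "z t \<le> z x0" by (intro x0(2)) auto
  qed
  have z10: "z1 x0 = 0" by (rule DERIV_local_max[OF zd[OF x0ab] e(1) max])
  \<comment> \<open>Near the maximum
    \<open>\<sigma>\<^sup>2 / 2 * t\<^sup>2 * (u2 t - v2 t) \<ge> q t\<close> will hold almost
    everywhere; at the maximum itself the first-order term of \<open>q\<close> vanishes, so
    \<open>q\<close> is positive there.\<close>
  define q where "q t = 2 * r * z t - r * t * z1 t" for t
  have zc': "continuous_on {a<..<b} z" by (rule continuous_on_subset[OF zc]) auto
  have qc: "continuous_on {a<..<b} q" unfolding q_def by (intro continuous_intros zc' z1c)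
  have q0: "q x0 = 2 * r * z x0" by (simp add: q_def z10)
  have "\<forall>\<^sub>F t in at x0. z t > 0"
    using zc' x0ab pos by (intro order_tendstoD(1)[of z "z x0"]) (auto simp: continuous_on_eq_continuous_at isCont_def)
  moreover have "\<forall>\<^sub>F t in at x0. q t > r * z x0"
  proof (rule order_tendstoD(1))
    show "(q \<longlongrightarrow> q x0) (at x0)"
      using qc x0ab by (simp add: continuous_on_eq_continuous_at isCont_def)
    show "r * z x0 < q x0" using pos r q0 by simp
  qed
  ultimately have "\<forall>\<^sub>F t in at x0. z t > 0 \<and> q t > r * z x0" by (rule eventually_conj)
  then obtain d where d: "d > 0" "\<And>t. t \<noteq> x0 \<Longrightarrow> dist t x0 < d \<Longrightarrow> z t > 0 \<and> q t > r * z x0"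
    unfolding eventually_at by auto
  have near: "z t > 0 \<and> q t > r * z x0" if "dist t x0 < d" for t
    using d(2)[of t] that pos r q0 by (cases "t = x0") auto
  define y where "y = x0 + min (d / 2) (e / 2)"
  have y: "x0 < y" "y < x0 + d" "y < x0 + e" using d(1) e(1) by (auto simp: y_def min_def)
  have in_ab: "t \<in> {a<..<b}" if "x0 \<le> t" "t \<le> y" for t
    using e(2) that y by (auto simp: dist_real_def subset_iff)
  \<comment> \<open>\<open>r * z x0\<close> divided by the upper bound
    \<open>\<sigma>\<^sup>2 * b\<^sup>2 / 2\<close> of the leading coefficient.\<close>
  define k where "k = r * z x0 * 2 / (\<sigma>\<^sup>2 * b\<^sup>2)"
  have k: "k > 0" using r pos \<sigma> ab by (simp add: k_def)
  have z2: "AE t in lborel. t \<in> {x0..y} \<longrightarrow> k \<le> u2 t - v2 t"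
    using U(7) V(7)
  proof eventually_elim
    case (elim t)
    show ?case
    proof
      assume t: "t \<in> {x0..y}"
      then have tab: "t \<in> {a<..<b}" using in_ab by auto
      have "dist t x0 < d" using t y by (auto simp: dist_real_def)
      from near[OF this] have n: "z t > 0" "q t > r * z x0" by auto
      have eu: "min (\<sigma>\<^sup>2 / 2 * t\<^sup>2 * u2 t + r * t * u1 t - 2 * r * u t + fh t) (Mo t - u t) = 0"
        and ev: "min (\<sigma>\<^sup>2 / 2 * t\<^sup>2 * v2 t + r * t * v1 t - 2 * r * v t + fh t) (Mo t - v t) = 0"
        using elim tab by auto
      \<comment> \<open>From \<open>u t \<le> Mo t\<close> and \<open>v t < u t\<close>. Hence
        \<open>v\<close> satisfies the equation, while \<open>u\<close> satisfies at least the
        inequality.\<close>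
      have "Mo t - v t > 0" using eu n(1) by (auto simp: z_def min_def split: if_splits)
      then have "\<sigma>\<^sup>2 / 2 * t\<^sup>2 * v2 t + r * t * v1 t - 2 * r * v t + fh t = 0"
        using ev by (auto simp: min_def split: if_splits)
      moreover have "\<sigma>\<^sup>2 / 2 * t\<^sup>2 * u2 t + r * t * u1 t - 2 * r * u t + fh t \<ge> 0"
        using eu by (auto simp: min_def split: if_splits)
      ultimately have "\<sigma>\<^sup>2 / 2 * t\<^sup>2 * (u2 t - v2 t) \<ge> q t"
        by (simp add: q_def z_def z1_def algebra_simps)
      then have "r * z x0 \<le> \<sigma>\<^sup>2 / 2 * t\<^sup>2 * (u2 t - v2 t)" using n(2) by simp
      moreover have "0 < \<sigma>\<^sup>2 / 2 * t\<^sup>2" using \<sigma> tab ab by auto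
      moreover have "\<sigma>\<^sup>2 / 2 * t\<^sup>2 \<le> \<sigma>\<^sup>2 / 2 * b\<^sup>2"
        using tab ab by (intro mult_left_mono power_mono) auto
      moreover have "0 < r * z x0" using r pos by simp
      ultimately have "r * z x0 / (\<sigma>\<^sup>2 / 2 * b\<^sup>2) \<le> u2 t - v2 t"
        by (smt (verit) divide_le_eq mult.commute mult_right_mono zero_less_mult_pos)
      then show "k \<le> u2 t - v2 t" by (simp add: k_def mult_ac)
    qed
  qed
  have z1_ge: "z1 t \<ge> k * (t - x0)" if t: "x0 \<le> t" "t \<le> y" for t
  proof -
    have b': "a < x0" "t < b" using in_ab[OF t] x0ab by auto
    have su: "set_integrable lborel {x0..t} u2" "u1 t - u1 x0 = (LBINT s=x0..t. u2 s)"
      using U(6)[OF b'(1) t(1) b'(2)] by auto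
    have sv: "set_integrable lborel {x0..t} v2" "v1 t - v1 x0 = (LBINT s=x0..t. v2 s)"
      using V(6)[OF b'(1) t(1) b'(2)] by auto
    have "k * (t - x0) = (LINT s:{x0..t}|lborel. k)"
      using t by (simp add: set_lebesgue_integral_def measure_def)
    also have "\<dots> \<le> (LINT s:{x0..t}|lborel. u2 s - v2 s)"
    proof (rule set_integral_mono_AE)
      show "set_integrable lborel {x0..t} (\<lambda>s. k)"
        by (intro borel_integrable_atLeastAtMost' continuous_intros)
      show "set_integrable lborel {x0..t} (\<lambda>s. u2 s - v2 s)" using su sv by (intro set_integral_diff)
      show "AE s \<in> {x0..t} in lborel. k \<le> u2 s - v2 s"
        using z2 by eventually_elim (use t in auto)
    qed
    also have "\<dots> = (LINT s:{x0..t}|lborel. u2 s) - (LINT s:{x0..t}|lborel. v2 s)"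
      using su sv by (intro set_integral_diff)
    also have "\<dots> = (u1 t - u1 x0) - (v1 t - v1 x0)"
      using t su sv by (simp add: interval_integral_Icc)
    finally show ?thesis using z10 by (simp add: z1_def)
  qed
  have "z x0 < z y"
  proof (rule DERIV_pos_imp_increasing_open[OF y(1)])
    fix t assume t: "x0 < t" "t < y"
    have "0 < k * (t - x0)" using k t by simp
    also have "\<dots> \<le> z1 t" using t by (intro z1_ge) auto
    finally show "\<exists>D. (z has_real_derivative D) (at t) \<and> D > 0" using zd[OF in_ab[of t]] t by auto
  next
    show "continuous_on {x0..y} z" by (rule continuous_on_subset[OF zc']) (use in_ab in auto)
  qed
  moreover have "z y \<le> z x0" using in_ab[of y] y by (intro x0(2)) auto
  ultimately show False by simp
qed

section \<open>The value function\<close>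

lemma C2_on_cong:
  assumes f: "C2_on I f f1 f2" and I: "open I" and eq: "\<And>x. x \<in> I \<Longrightarrow> f x = g x"
  shows "C2_on I g f1 f2"
  unfolding C2_on_def
proof (intro conjI ballI)
  fix x assume x: "x \<in> I"
  show "(g has_real_derivative f1 x) (at x)"
    by (rule has_field_derivative_transform_within_open[OF C2_onD(1)[OF f x] I x eq])
qed (use f in \<open>auto simp: C2_on_def\<close>)

lemma C2_on_deriv2:
  assumes f: "C2_on I f f1 f2" and I: "open I" and x: "x \<in> I"
  shows "deriv f x = f1 x" "deriv (deriv f) x = f2 x"
proof -
  have 1: "deriv f y = f1 y" if "y \<in> I" for y by (rule DERIV_imp_deriv[OF C2_onD(1)[OF f that]])
  show "deriv f x = f1 x" by (rule 1[OF x])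
  have "(deriv f has_real_derivative f2 x) (at x)"
    by (rule has_field_derivative_transform_within_open[OF C2_onD(2)[OF f x] I x 1[symmetric]])
  then show "deriv (deriv f) x = f2 x" by (rule DERIV_imp_deriv)
qed

text \<open>Made for \<open>\<phi>\<close>, which involves
  \<open>\<gamma>2\<^sup>2 / \<gamma>1\<close> and so has the form 0/0 at both ends, but is
  dominated by a multiple of \<open>\<gamma>1\<close>.\<close>

lemma continuous_on_of_dominated_boundary:
  fixes f g :: "real \<Rightarrow> real"
  assumes f: "continuous_on {a<..<b} f" and g: "continuous_on {a..b} g" "g a = 0" "g b = 0"
    and le: "\<And>x. x \<in> {a..b} \<Longrightarrow> \<bar>f x\<bar> \<le> g x"
  shows "continuous_on {a..b} f"
  unfolding continuous_on_def
proof
  fix x assume x: "x \<in> {a..b}"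
  show "(f \<longlongrightarrow> f x) (at x within {a..b})"
  proof (cases "x \<in> {a<..<b}")
    case True
    then have "isCont f x" using f by (simp add: continuous_on_eq_continuous_at)
    then show ?thesis unfolding isCont_def by (rule tendsto_within_subset) simp
  next
    case False
    then have "x = a \<or> x = b" using x by auto
    then have gx: "g x = 0" using g by blast
    then have fx: "f x = 0" using le[OF x] by simp
    have "(g \<longlongrightarrow> 0) (at x within {a..b})" using g(1) x gx unfolding continuous_on_def by metis
    moreover have "\<forall>\<^sub>F y in at x within {a..b}. norm (f y) \<le> g y"
      unfolding eventually_at_filter using le by (auto intro!: always_eventually)
    ultimately have "(f \<longlongrightarrow> 0) (at x within {a..b})" by (rule Lim_null_comparison[rotated])
    then show ?thesis unfolding fx .
  qed
qed

lemma lift2_continuous: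
  assumes "continuous_on J H" "continuous_on J H1" "continuous_on J H2"
    and "\<And>x. x \<in> I \<Longrightarrow> x > 0" "\<And>x. x \<in> I \<Longrightarrow> x powr \<delta> \<in> J"
  shows "continuous_on I (lift2 \<beta> \<delta> H H1 H2)"
proof -
  have p: "continuous_on I (\<lambda>x. x powr q)" for q
    using assms(4) by (intro continuous_intros) force
  have c: "continuous_on I (\<lambda>x. H (x powr \<delta>))" "continuous_on I (\<lambda>x. H1 (x powr \<delta>))"
    "continuous_on I (\<lambda>x. H2 (x powr \<delta>))"
    using assms by (auto intro!: continuous_on_compose2[OF _ p])
  show ?thesis
    unfolding lift2_def[abs_def] by (intro continuous_on_add continuous_on_mult continuous_on_const p c)
qed

lemma lift1_continuous:
  assumes "continuous_on J H" "continuous_on J H1"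
    and "\<And>x. x \<in> I \<Longrightarrow> x > 0" "\<And>x. x \<in> I \<Longrightarrow> x powr \<delta> \<in> J"
  shows "continuous_on I (lift1 \<beta> \<delta> H H1)"
proof -
  have p: "continuous_on I (\<lambda>x. x powr q)" for q
    using assms(3) by (intro continuous_intros) force
  have c: "continuous_on I (\<lambda>x. H (x powr \<delta>))" "continuous_on I (\<lambda>x. H1 (x powr \<delta>))"
    using assms by (auto intro!: continuous_on_compose2[OF _ p])
  show ?thesis
    unfolding lift1_def[abs_def] by (intro continuous_on_add continuous_on_mult continuous_on_const p c)
qed

lemma lift_continuous:
  assumes "continuous_on J H"
    and "\<And>x. x \<in> I \<Longrightarrow> x > 0" "\<And>x. x \<in> I \<Longrightarrow> x powr \<delta> \<in> J"
  shows "continuous_on I (lift \<beta> \<delta> H)"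
proof -
  have p: "continuous_on I (\<lambda>x. x powr q)" for q
    using assms(2) by (intro continuous_intros) force
  have "continuous_on I (\<lambda>x. H (x powr \<delta>))"
    using assms by (auto intro!: continuous_on_compose2[OF _ p])
  then show ?thesis unfolding lift_def[abs_def] by (intro continuous_intros p)
qed

section \<open>Characteristic exponents and potentials of power sources\<close>

context gbm begin

text \<open>With \<open>d = dpar r \<sigma>\<close>, the exponents of the homogeneous solutions
  solve \<open>p\<^sup>2 + (d - 1) * p - 2 * d = 0\<close>. This is the root of the discriminant,
  the distance between the two exponents.\<close>

definition root_gap :: real where
  "root_gap = sqrt ((dpar r \<sigma> - 1)\<^sup>2 + 8 * dpar r \<sigma>)"

definition lower_root :: real where
  "lower_root = ((1 - dpar r \<sigma>) - root_gap) / 2"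

lemma dpar_pos: "dpar r \<sigma> > 0"
  using r_pos \<sigma>_pos by (simp add: dpar_def)

lemma root_gap_pos: "root_gap > 0"
  using dpar_pos by (simp add: root_gap_def add_nonneg_pos)

lemma symbol_eq: "symbol (2 * r) p = \<sigma>\<^sup>2 / 2 * (p\<^sup>2 + (dpar r \<sigma> - 1) * p - 2 * dpar r \<sigma>)"
proof -
  have r: "r = \<sigma>\<^sup>2 / 2 * dpar r \<sigma>" using \<sigma>_pos by (simp add: dpar_def)
  show ?thesis
    unfolding symbol_def by (subst (1 2) r) (simp add: algebra_simps power2_eq_square diff_divide_distrib add_divide_distrib)
qed

lemma symbol_lower_root: "symbol (2 * r) lower_root = 0"
  and symbol_upper_root: "symbol (2 * r) (lower_root + root_gap) = 0"
proof -
  let ?d = "dpar r \<sigma>"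
  have g: "root_gap * root_gap = (?d - 1) * (?d - 1) + 8 * ?d"
    unfolding root_gap_def using dpar_pos by (simp add: power2_eq_square)
  have "lower_root\<^sup>2 + (?d - 1) * lower_root - 2 * ?d = (root_gap * root_gap - (?d - 1) * (?d - 1) - 8 * ?d) / 4"
    unfolding lower_root_def by (simp add: power2_eq_square field_simps)
  then show "symbol (2 * r) lower_root = 0" unfolding symbol_eq g by simp
  have "(lower_root + root_gap)\<^sup>2 + (?d - 1) * (lower_root + root_gap) - 2 * ?d
      = (root_gap * root_gap - (?d - 1) * (?d - 1) - 8 * ?d) / 4"
    unfolding lower_root_def by (simp add: power2_eq_square field_simps)
  then show "symbol (2 * r) (lower_root + root_gap) = 0" unfolding symbol_eq g by simp
qed

text \<open>Vieta: the exponents add up to \<open>1 - dpar r \<sigma>\<close>. The form is the one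
  \<open>generator_lift\<close> asks for.\<close>

lemma root_sum: "\<sigma>\<^sup>2 / 2 * (2 * lower_root + root_gap - 1) + r = 0"
proof -
  have "2 * lower_root + root_gap - 1 = - dpar r \<sigma>" by (simp add: lower_root_def field_simps)
  then show ?thesis using \<sigma>_pos by (simp add: dpar_def)
qed

lemma generator_powr_symbol:
  "x > 0 \<Longrightarrow> generator r \<sigma> (\<lambda>x. x powr p) (\<lambda>x. p * x powr (p - 1)) (\<lambda>x. p * (p - 1) * x powr (p - 2)) x =
    symbol (2 * r) p * x powr p"
  by (simp add: generator_powr symbol_def)

lemma lift_affine:
  "lift lower_root root_gap (\<lambda>y. m * y + c) s = m * s powr (lower_root + root_gap) + c * s powr lower_root"
  by (simp add: lift_def powr_add algebra_simps)

lemma Dynkin_pair_affine: "Dynkin_pair (lift lower_root root_gap (\<lambda>y. m * y + c)) (\<lambda>_. 0)"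
  using Dynkin_pair_lincomb[OF Dynkin_pair_powr[of "lower_root + root_gap"] Dynkin_pair_powr[of lower_root], of m c]
  unfolding symbol_lower_root symbol_upper_root lift_affine[abs_def] by simp

lemma a_less_b_powr: "a powr root_gap < b powr root_gap"
  using a_pos a_less_b root_gap_pos by (intro powr_less_mono2) auto

text \<open>A nonresonant power source has a power as particular solution, and a homogeneous
  solution corrects its two boundary values; \<open>exit_potential\<close> identifies the result
  with the expected integral. The source is compared on \<open>(a,b)\<close> only, which admits
  \<open>Pd\<close>, a power on that range but not on the whole line.\<close>

lemma potential_exists:
  assumes p: "symbol (2 * r) p \<noteq> 0"
  shows "\<exists>g g1 g2. C2_on {0<..} g g1 g2 \<and> g a = 0 \<and> g b = 0 \<and>
    (\<forall>x>0. generator r \<sigma> g g1 g2 x = - k * x powr p) \<and> Dynkin_pair g (\<lambda>s. - k * s powr p) \<and>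
    (\<forall>g0. (\<forall>s\<in>{a<..<b}. g0 s * \<sigma>\<^sup>2 * s\<^sup>2 = k * s powr p) \<longrightarrow> (\<forall>x\<in>{a..b}. gam Mp W r \<sigma> a b g0 x = g x))"
proof -
  let ?\<beta> = lower_root and ?\<delta> = root_gap
  define k' where "k' = - k / symbol (2 * r) p"
  \<comment> \<open>Minus the particular solution, divided by \<open>x powr ?\<beta>\<close>. The
    boundary conditions say that \<open>m * y + c\<close> interpolates these values at
    \<open>a powr ?\<delta>\<close> and \<open>b powr ?\<delta>\<close>.\<close>
  define \<alpha> where "\<alpha> x = - k' * x powr p / x powr ?\<beta>" for x
  define m where "m = (\<alpha> b - \<alpha> a) / (b powr ?\<delta> - a powr ?\<delta>)"
  define c where "c = \<alpha> a - m * a powr ?\<delta>"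
  let ?hom = "\<lambda>x. m * x powr (?\<beta> + ?\<delta>) + c * x powr ?\<beta>"
  let ?hom1 = "\<lambda>x. m * ((?\<beta> + ?\<delta>) * x powr (?\<beta> + ?\<delta> - 1)) + c * (?\<beta> * x powr (?\<beta> - 1))"
  let ?hom2 = "\<lambda>x. m * ((?\<beta> + ?\<delta>) * (?\<beta> + ?\<delta> - 1) * x powr (?\<beta> + ?\<delta> - 2)) + c * (?\<beta> * (?\<beta> - 1) * x powr (?\<beta> - 2))"
  define g where "g x = 1 * ?hom x + k' * x powr p" for x
  define g1 where "g1 x = 1 * ?hom1 x + k' * (p * x powr (p - 1))" for x
  define g2 where "g2 x = 1 * ?hom2 x + k' * (p * (p - 1) * x powr (p - 2))" for x
  have hom: "C2_on {0<..} ?hom ?hom1 ?hom2" by (rule C2_on_lincomb[OF C2_on_powr C2_on_powr])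
  have 1: "C2_on {0<..} g g1 g2"
    unfolding g_def[abs_def] g1_def[abs_def] g2_def[abs_def] by (rule C2_on_lincomb[OF hom C2_on_powr])
  have vanish: "m * x powr ?\<delta> + c = \<alpha> x \<Longrightarrow> x > 0 \<Longrightarrow> g x = 0" for x
  proof -
    assume e: "m * x powr ?\<delta> + c = \<alpha> x" and x: "x > 0"
    have "g x = x powr ?\<beta> * (m * x powr ?\<delta> + c) + k' * x powr p"
      by (simp add: g_def powr_add algebra_simps)
    also have "\<dots> = 0" unfolding e \<alpha>_def using x by simp
    finally show "g x = 0" .
  qed
  have 2: "g a = 0" using a_pos by (intro vanish) (simp_all add: c_def)
  have 3: "g b = 0"
  proof (rule vanish)
    have "m * (b powr ?\<delta> - a powr ?\<delta>) = \<alpha> b - \<alpha> a" using a_less_b_powr by (simp add: m_def)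
    then show "m * b powr ?\<delta> + c = \<alpha> b" by (simp add: c_def algebra_simps)
    show "b > 0" using a_pos a_less_b by simp
  qed
  have 4: "generator r \<sigma> g g1 g2 x = - k * x powr p" if x: "x > 0" for x
  proof -
    have "generator r \<sigma> g g1 g2 x = 1 * generator r \<sigma> ?hom ?hom1 ?hom2 x + k' * (symbol (2 * r) p * x powr p)"
      unfolding g_def[abs_def] g1_def[abs_def] g2_def[abs_def] generator_lincomb[of r \<sigma> 1] generator_powr_symbol[OF x] ..
    also have "generator r \<sigma> ?hom ?hom1 ?hom2 x = 0"
      unfolding generator_lincomb generator_powr_symbol[OF x] symbol_lower_root symbol_upper_root by simp
    finally show ?thesis using p by (simp add: k'_def)
  qed
  have bb: "bounded_borel (\<lambda>s. - k * s powr p)"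
    using bounded_borel_lincomb[OF bounded_borel_powr bounded_borel_powr, of "- k" p 0] by simp
  have bb': "bounded_borel (\<lambda>s. k * s powr p)"
    using bounded_borel_lincomb[OF bounded_borel_powr bounded_borel_powr, of k p 0] by simp
  have 5: "Dynkin_pair g (\<lambda>s. - k * s powr p)"
  proof (rule Dynkin_pair_cong[OF _ _ _ bb])
    show D: "Dynkin_pair g (\<lambda>s. 1 * (m * (symbol (2 * r) (?\<beta> + ?\<delta>) * s powr (?\<beta> + ?\<delta>)) + c * (symbol (2 * r) ?\<beta> * s powr ?\<beta>))
        + k' * (symbol (2 * r) p * s powr p))"
      unfolding g_def[abs_def] by (intro Dynkin_pair_lincomb Dynkin_pair_powr)
    show "bounded_borel g" by (rule Dynkin_pairD(1)[OF D])
  qed (use p in \<open>simp_all add: symbol_lower_root symbol_upper_root k'_def\<close>)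
  have 6: "gam Mp W r \<sigma> a b g0 x = g x"
    if g0: "\<forall>s\<in>{a<..<b}. g0 s * \<sigma>\<^sup>2 * s\<^sup>2 = k * s powr p" and x: "x \<in> {a..b}" for g0 x
  proof -
    \<comment> \<open>\<open>exit_potential\<close> returns minus the function it is given.\<close>
    have neg: "Dynkin_pair (\<lambda>s. - g s) (\<lambda>s. k * s powr p)"
      using Dynkin_pair_lincomb[OF 5 5, of "-1" 0] by simp
    have "gam Mp W r \<sigma> a b g0 x = expectation (\<lambda>\<omega>. pathint (\<lambda>s. g0 s * \<sigma>\<^sup>2 * s\<^sup>2) x (exitT r \<sigma> W a b x \<omega>) \<omega>)"
      unfolding gam_def pathint_def by (simp only: mult.assoc)
    also have "\<dots> = expectation (\<lambda>\<omega>. pathint (\<lambda>s. k * s powr p) x (exitT r \<sigma> W a b x \<omega>) \<omega>)"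
    proof (intro Bochner_Integration.integral_cong refl pathint_cong exitT_nonneg)
      fix \<omega> u assume "0 < u" "ereal u < exitT r \<sigma> W a b x \<omega>"
      then have "S x u \<omega> \<in> {a<..<b}" by (intro before_exitT) auto
      then show "g0 (S x u \<omega>) * \<sigma>\<^sup>2 * (S x u \<omega>)\<^sup>2 = k * S x u \<omega> powr p" using g0 by blast
    qed
    also have "\<dots> = g x" using exit_potential[OF neg x] 2 3 by simp
    finally show ?thesis .
  qed
  show ?thesis using 1 2 3 4 5 6 by blast
qed

end

section \<open>Sources and value function of the hedging problem\<close>

locale put_hedging = gbm +
  fixes K :: real
  assumes K_pos: "K > 0" and ahat_le: "ahat r \<sigma> K \<le> a"
begin

lemma ahat_pos: "ahat r \<sigma> K > 0"
  using K_pos dpar_pos by (simp add: ahat_def add_pos_pos)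

lemma Pd_bounds: "-1 \<le> Pd r \<sigma> K x" "Pd r \<sigma> K x \<le> 0"
  unfolding Pd_def by auto

lemma Pd_measurable [measurable]: "Pd r \<sigma> K \<in> borel_measurable borel"
  unfolding Pd_def[abs_def] by measurable

text \<open>From \<open>ahat\<close> on the ratio is at most 1, so the cap at -1 is inactive and the
  put delta is a pure power.\<close>

lemma Pd_eq:
  assumes x: "x \<ge> a"
  shows "Pd r \<sigma> K x = - (ahat r \<sigma> K powr (1 + dpar r \<sigma>)) * x powr (- (1 + dpar r \<sigma>))"
proof -
  have x0: "x > 0" "ahat r \<sigma> K \<le> x" using x a_pos ahat_le by auto
  have "ahat r \<sigma> K / x \<le> 1" "0 \<le> ahat r \<sigma> K / x" using x0 ahat_pos by auto
  then have "(ahat r \<sigma> K / x) powr (1 + dpar r \<sigma>) \<le> 1" using dpar_pos by (intro powr_le1) auto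
  then have "Pd r \<sigma> K x = - ((ahat r \<sigma> K / x) powr (1 + dpar r \<sigma>))" by (simp add: Pd_def)
  also have "(ahat r \<sigma> K / x) powr (1 + dpar r \<sigma>) = ahat r \<sigma> K powr (1 + dpar r \<sigma>) * x powr (- (1 + dpar r \<sigma>))"
    unfolding powr_minus divide_inverse[symmetric] by (rule powr_divide)
  finally show ?thesis by simp
qed

lemma sources:
  assumes x: "x \<ge> a"
  shows "1 * \<sigma>\<^sup>2 * x\<^sup>2 = \<sigma>\<^sup>2 * x powr 2"
    and "Pd r \<sigma> K x * \<sigma>\<^sup>2 * x\<^sup>2 = - (ahat r \<sigma> K powr (1 + dpar r \<sigma>)) * \<sigma>\<^sup>2 * x powr (1 - dpar r \<sigma>)"
    and "(Pd r \<sigma> K x)\<^sup>2 * \<sigma>\<^sup>2 * x\<^sup>2 = (ahat r \<sigma> K powr (1 + dpar r \<sigma>))\<^sup>2 * \<sigma>\<^sup>2 * x powr (- 2 * dpar r \<sigma>)"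
proof -
  let ?d = "dpar r \<sigma>"
  have x0: "x > 0" using x a_pos by simp
  then show "1 * \<sigma>\<^sup>2 * x\<^sup>2 = \<sigma>\<^sup>2 * x powr 2" by simp
  have x2: "x\<^sup>2 = x powr 2" using x0 by simp
  have swap: "C * X * t * Z = C * t * (X * Z)" for C X t Z :: real by simp
  have "x powr (- (1 + ?d)) * x powr 2 = x powr (1 - ?d)"
    unfolding powr_add[symmetric] by (rule arg_cong[where f="(powr) x"]) simp
  then show "Pd r \<sigma> K x * \<sigma>\<^sup>2 * x\<^sup>2 = - (ahat r \<sigma> K powr (1 + ?d)) * \<sigma>\<^sup>2 * x powr (1 - ?d)"
    unfolding Pd_eq[OF x] x2 swap by (simp only:)
  have "(x powr (- (1 + ?d)))\<^sup>2 * x powr 2 = x powr (- 2 * ?d)"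
    unfolding power2_eq_square powr_add[symmetric] by (rule arg_cong[where f="(powr) x"]) simp
  then show "(Pd r \<sigma> K x)\<^sup>2 * \<sigma>\<^sup>2 * x\<^sup>2 = (ahat r \<sigma> K powr (1 + ?d))\<^sup>2 * \<sigma>\<^sup>2 * x powr (- 2 * ?d)"
    unfolding Pd_eq[OF x] x2 power_mult_distrib power2_minus swap by (simp only:)
qed

text \<open>With \<open>d = dpar r \<sigma>\<close>, the polynomial
  \<open>p\<^sup>2 + (d - 1) * p - 2 * d\<close> has the values 2, \<open>- 2 * d\<close> and
  \<open>2 * d\<^sup>2\<close> at the three source exponents, so resonance never occurs.\<close>

lemma symbols_nonzero:
  "symbol (2 * r) 2 \<noteq> 0" "symbol (2 * r) (1 - dpar r \<sigma>) \<noteq> 0" "symbol (2 * r) (- 2 * dpar r \<sigma>) \<noteq> 0"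
proof -
  let ?d = "dpar r \<sigma>"
  have s: "\<sigma>\<^sup>2 / 2 > 0" using \<sigma>_pos by simp
  have "2\<^sup>2 + (?d - 1) * 2 - 2 * ?d = 2" "(1 - ?d)\<^sup>2 + (?d - 1) * (1 - ?d) - 2 * ?d = - 2 * ?d"
    "(- 2 * ?d)\<^sup>2 + (?d - 1) * (- 2 * ?d) - 2 * ?d = 2 * (?d * ?d)"
    by (simp_all add: power2_eq_square algebra_simps)
  then show "symbol (2 * r) 2 \<noteq> 0" "symbol (2 * r) (1 - ?d) \<noteq> 0" "symbol (2 * r) (- 2 * ?d) \<noteq> 0"
    unfolding symbol_eq using s dpar_pos by auto
qed

text \<open>A quadratic in \<open>h\<close> with the three sources as coefficients; hence the cost
  of never stopping before the exit is
  \<open>h\<^sup>2 * \<gamma>1 - 2 * h * \<gamma>2 + \<gamma>3\<close>.\<close>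

lemma fcost_expand:
  "fcost r \<sigma> K s h = h\<^sup>2 * (1 * \<sigma>\<^sup>2 * s\<^sup>2) - 2 * h * (Pd r \<sigma> K s * \<sigma>\<^sup>2 * s\<^sup>2) + (Pd r \<sigma> K s)\<^sup>2 * \<sigma>\<^sup>2 * s\<^sup>2"
proof -
  have "(A + C - 2 * h * P) * t * y = h' * (1 * t * y) - 2 * h * (P * t * y) + C * t * y"
    if "A = h'" for A C P t y h' :: real using that by (simp add: algebra_simps)
  then show ?thesis unfolding fcost_def power2_diff by blast
qed

lemma bounded_borel_fcost: "bounded_borel (\<lambda>s. - fcost r \<sigma> K s h)"
  unfolding bounded_borel_def
proof (intro conjI exI[of _ "(\<bar>h\<bar> + 1)\<^sup>2 * \<sigma>\<^sup>2 * b\<^sup>2"] ballI)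
  show "(\<lambda>s. - fcost r \<sigma> K s h) \<in> borel_measurable borel" unfolding fcost_def by measurable
  fix s assume s: "s \<in> {a..b}"
  have "\<bar>h - Pd r \<sigma> K s\<bar> \<le> \<bar>h\<bar> + 1" using Pd_bounds[of s] by linarith
  then have "(h - Pd r \<sigma> K s)\<^sup>2 \<le> (\<bar>h\<bar> + 1)\<^sup>2"
    using power_mono[of "\<bar>h - Pd r \<sigma> K s\<bar>" "\<bar>h\<bar> + 1" 2] by simp
  moreover have "s\<^sup>2 \<le> b\<^sup>2" using s a_pos by (intro power_mono) auto
  ultimately have "(h - Pd r \<sigma> K s)\<^sup>2 * \<sigma>\<^sup>2 * s\<^sup>2 \<le> (\<bar>h\<bar> + 1)\<^sup>2 * \<sigma>\<^sup>2 * b\<^sup>2" by (intro mult_mono) auto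
  then show "\<bar>- fcost r \<sigma> K s h\<bar> \<le> (\<bar>h\<bar> + 1)\<^sup>2 * \<sigma>\<^sup>2 * b\<^sup>2" by (simp add: fcost_def)
qed simp

text \<open>In the coordinates \<open>y = x powr root_gap\<close>, after division by \<open>x powr lower_root\<close>, the
  homogeneous solutions of the generator become the affine functions.\<close>

theorem value_function_solves_obstacle_problem:
  assumes Z: "finite {x\<in>{a<..<b}. Gfun Mp W r \<sigma> K a b x h = 0}"
  shows "obstacle_solution r \<sigma> a b (\<lambda>x. fcost r \<sigma> K x h) (Mfun Mp W r \<sigma> K a b)
    (\<lambda>x. Vfun Mp W r \<sigma> K a b x h)"
proof -
  let ?d = "dpar r \<sigma>" and ?c = "ahat r \<sigma> K powr (1 + dpar r \<sigma>)"
  let ?I = "{a<..<b}" and ?M = "Mfun Mp W r \<sigma> K a b"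
  obtain \<gamma>1 \<gamma>1' \<gamma>1'' where \<gamma>1: "C2_on {0<..} \<gamma>1 \<gamma>1' \<gamma>1''" "\<gamma>1 a = 0" "\<gamma>1 b = 0"
    "\<forall>x>0. generator r \<sigma> \<gamma>1 \<gamma>1' \<gamma>1'' x = - \<sigma>\<^sup>2 * x powr 2"
    "Dynkin_pair \<gamma>1 (\<lambda>s. - \<sigma>\<^sup>2 * s powr 2)"
    "\<forall>g0. (\<forall>s\<in>?I. g0 s * \<sigma>\<^sup>2 * s\<^sup>2 = \<sigma>\<^sup>2 * s powr 2) \<longrightarrow> (\<forall>x\<in>{a..b}. gam Mp W r \<sigma> a b g0 x = \<gamma>1 x)"
    using potential_exists[OF symbols_nonzero(1), of "\<sigma>\<^sup>2"] by (elim exE conjE) (rule that)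
  obtain \<gamma>2 \<gamma>2' \<gamma>2'' where \<gamma>2: "C2_on {0<..} \<gamma>2 \<gamma>2' \<gamma>2''" "\<gamma>2 a = 0" "\<gamma>2 b = 0"
    "\<forall>x>0. generator r \<sigma> \<gamma>2 \<gamma>2' \<gamma>2'' x = - (- ?c * \<sigma>\<^sup>2) * x powr (1 - ?d)"
    "Dynkin_pair \<gamma>2 (\<lambda>s. - (- ?c * \<sigma>\<^sup>2) * s powr (1 - ?d))"
    "\<forall>g0. (\<forall>s\<in>?I. g0 s * \<sigma>\<^sup>2 * s\<^sup>2 = - ?c * \<sigma>\<^sup>2 * s powr (1 - ?d)) \<longrightarrow> (\<forall>x\<in>{a..b}. gam Mp W r \<sigma> a b g0 x = \<gamma>2 x)"
    using potential_exists[OF symbols_nonzero(2), of "- ?c * \<sigma>\<^sup>2"] by (elim exE conjE) (rule that)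
  obtain \<gamma>3 \<gamma>3' \<gamma>3'' where \<gamma>3: "C2_on {0<..} \<gamma>3 \<gamma>3' \<gamma>3''" "\<gamma>3 a = 0" "\<gamma>3 b = 0"
    "\<forall>x>0. generator r \<sigma> \<gamma>3 \<gamma>3' \<gamma>3'' x = - (?c\<^sup>2 * \<sigma>\<^sup>2) * x powr (- 2 * ?d)"
    "Dynkin_pair \<gamma>3 (\<lambda>s. - (?c\<^sup>2 * \<sigma>\<^sup>2) * s powr (- 2 * ?d))"
    "\<forall>g0. (\<forall>s\<in>?I. g0 s * \<sigma>\<^sup>2 * s\<^sup>2 = ?c\<^sup>2 * \<sigma>\<^sup>2 * s powr (- 2 * ?d)) \<longrightarrow> (\<forall>x\<in>{a..b}. gam Mp W r \<sigma> a b g0 x = \<gamma>3 x)"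
    using potential_exists[OF symbols_nonzero(3), of "?c\<^sup>2 * \<sigma>\<^sup>2"] by (elim exE conjE) (rule that)
  have Ipos: "?I \<subseteq> {0<..}" and abpos: "{a..b} \<subseteq> {0<..}" using a_pos by auto
  have gam1: "gam Mp W r \<sigma> a b (\<lambda>y. 1) x = \<gamma>1 x" if "x \<in> {a..b}" for x
    using \<gamma>1(6)[rule_format, of "\<lambda>y. 1"] sources(1) that by simp
  have gam2: "gam Mp W r \<sigma> a b (Pd r \<sigma> K) x = \<gamma>2 x" if "x \<in> {a..b}" for x
    by (rule \<gamma>2(6)[rule_format, OF sources(2) that]) simp
  have gam3: "gam Mp W r \<sigma> a b (\<lambda>y. (Pd r \<sigma> K y)\<^sup>2) x = \<gamma>3 x" if "x \<in> {a..b}" for x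
    by (rule \<gamma>3(6)[rule_format, OF sources(3) that]) simp
  have gen1: "generator r \<sigma> \<gamma>1 \<gamma>1' \<gamma>1'' x = - (1 * \<sigma>\<^sup>2 * x\<^sup>2)"
    and gen2: "generator r \<sigma> \<gamma>2 \<gamma>2' \<gamma>2'' x = - (Pd r \<sigma> K x * \<sigma>\<^sup>2 * x\<^sup>2)"
    and gen3: "generator r \<sigma> \<gamma>3 \<gamma>3' \<gamma>3'' x = - ((Pd r \<sigma> K x)\<^sup>2 * \<sigma>\<^sup>2 * x\<^sup>2)" if "x \<in> ?I" for x
  proof -
    have x: "x \<ge> a" "x > 0" using that a_pos by auto
    show "generator r \<sigma> \<gamma>1 \<gamma>1' \<gamma>1'' x = - (1 * \<sigma>\<^sup>2 * x\<^sup>2)"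
      unfolding sources(1)[OF x(1)] \<gamma>1(4)[rule_format, OF x(2)] by simp
    show "generator r \<sigma> \<gamma>2 \<gamma>2' \<gamma>2'' x = - (Pd r \<sigma> K x * \<sigma>\<^sup>2 * x\<^sup>2)"
      unfolding sources(2)[OF x(1)] \<gamma>2(4)[rule_format, OF x(2)] by simp
    show "generator r \<sigma> \<gamma>3 \<gamma>3' \<gamma>3'' x = - ((Pd r \<sigma> K x)\<^sup>2 * \<sigma>\<^sup>2 * x\<^sup>2)"
      unfolding sources(3)[OF x(1)] \<gamma>3(4)[rule_format, OF x(2)] by simp
  qed
  have source_pos: "0 < \<sigma>\<^sup>2 * x\<^sup>2" if "x \<in> ?I" for x using that a_pos \<sigma>_pos by auto
  have pos1: "\<gamma>1 x > 0" if "x \<in> ?I" for x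
  proof (rule positive_of_generator_negative[OF a_pos a_less_b r_pos \<sigma>_pos _ _ \<gamma>1(2,3) _ that])
    show "continuous_on {a..b} \<gamma>1" by (rule continuous_on_subset[OF C2_onD(3)[OF \<gamma>1(1)] abpos])
    show "C2_on ?I \<gamma>1 \<gamma>1' \<gamma>1''" by (rule C2_on_subset[OF \<gamma>1(1) Ipos])
    show "generator r \<sigma> \<gamma>1 \<gamma>1' \<gamma>1'' x < 0" if "x \<in> ?I" for x using gen1[OF that] source_pos[OF that] by simp
  qed
  \<comment> \<open>As \<open>Pd\<close> lies between -1 and 0, the factor \<open>2 + s * Pd\<close>
    is at least 1; the 2 secures strict positivity. Both signs together bound
    \<open>\<gamma>2 / \<gamma>1\<close> by 2 in absolute value.\<close>
  have two_pos: "2 * \<gamma>1 x + s * \<gamma>2 x > 0" if s: "\<bar>s\<bar> = 1" and "x \<in> ?I" for s x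
  proof (rule positive_of_generator_negative[OF a_pos a_less_b r_pos \<sigma>_pos _ _ _ _ _ that(2)])
    have C: "C2_on {0<..} (\<lambda>x. 2 * \<gamma>1 x + s * \<gamma>2 x) (\<lambda>x. 2 * \<gamma>1' x + s * \<gamma>2' x) (\<lambda>x. 2 * \<gamma>1'' x + s * \<gamma>2'' x)"
      by (rule C2_on_lincomb[OF \<gamma>1(1) \<gamma>2(1)])
    show "continuous_on {a..b} (\<lambda>x. 2 * \<gamma>1 x + s * \<gamma>2 x)" by (rule continuous_on_subset[OF C2_onD(3)[OF C] abpos])
    show "C2_on ?I (\<lambda>x. 2 * \<gamma>1 x + s * \<gamma>2 x) (\<lambda>x. 2 * \<gamma>1' x + s * \<gamma>2' x) (\<lambda>x. 2 * \<gamma>1'' x + s * \<gamma>2'' x)"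
      by (rule C2_on_subset[OF C Ipos])
    fix x assume x: "x \<in> ?I"
    have "s * Pd r \<sigma> K x \<ge> - 1"
    proof -
      have "s = 1 \<or> s = -1" using s by linarith
      then show ?thesis using Pd_bounds[of x] by auto
    qed
    then have "0 < (2 + s * Pd r \<sigma> K x) * (\<sigma>\<^sup>2 * x\<^sup>2)" using source_pos[OF x] by (intro mult_pos_pos) auto
    moreover have "generator r \<sigma> (\<lambda>x. 2 * \<gamma>1 x + s * \<gamma>2 x) (\<lambda>x. 2 * \<gamma>1' x + s * \<gamma>2' x) (\<lambda>x. 2 * \<gamma>1'' x + s * \<gamma>2'' x) x
        = - ((2 + s * Pd r \<sigma> K x) * (\<sigma>\<^sup>2 * x\<^sup>2))"
      unfolding generator_lincomb gen1[OF x] gen2[OF x] by (simp add: algebra_simps)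
    ultimately show "generator r \<sigma> (\<lambda>x. 2 * \<gamma>1 x + s * \<gamma>2 x) (\<lambda>x. 2 * \<gamma>1' x + s * \<gamma>2' x) (\<lambda>x. 2 * \<gamma>1'' x + s * \<gamma>2'' x) x < 0"
      by linarith
  qed (use \<gamma>1 \<gamma>2 in simp_all)
  have abs2: "\<bar>\<gamma>2 x\<bar> \<le> 2 * \<gamma>1 x" if "x \<in> ?I" for x
    using two_pos[of 1 x] two_pos[of "-1" x] that by auto
  have M_eq: "?M x = 1 * \<gamma>3 x + (-1) * ((\<gamma>2 x * \<gamma>2 x) * (1 / \<gamma>1 x))" if x: "x \<in> ?I" for x
  proof -
    have x': "x \<in> {a..b}" using x by auto
    show ?thesis unfolding Mfun_def gam1[OF x'] gam2[OF x'] gam3[OF x'] using x by (simp add: power2_eq_square)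
  qed
  have M_bd: "?M a = 0" "?M b = 0" by (simp_all add: Mfun_def)
  have "\<exists>M1 M2. C2_on ?I ?M M1 M2"
  proof -
    have C: "C2_on ?I \<gamma>1 \<gamma>1' \<gamma>1''" "C2_on ?I \<gamma>2 \<gamma>2' \<gamma>2''" "C2_on ?I \<gamma>3 \<gamma>3' \<gamma>3''"
      using C2_on_subset[OF _ Ipos] \<gamma>1(1) \<gamma>2(1) \<gamma>3(1) by blast+
    have nz: "\<gamma>1 x \<noteq> 0" if "x \<in> ?I" for x using pos1[OF that] by simp
    show ?thesis
      using C2_on_cong[OF C2_on_lincomb[OF C(3) C2_on_mult[OF C2_on_mult[OF C(2,2)] C2_on_inverse[OF C(1) nz]], of 1 "-1"]
          open_greaterThanLessThan M_eq[symmetric]] by blast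
  qed
  then obtain M1 M2 where CM: "C2_on ?I ?M M1 M2" by blast
  define U where "U x = 1 * (h\<^sup>2 * \<gamma>1 x + (- 2 * h) * \<gamma>2 x) + 1 * \<gamma>3 x" for x
  define U1 where "U1 x = 1 * (h\<^sup>2 * \<gamma>1' x + (- 2 * h) * \<gamma>2' x) + 1 * \<gamma>3' x" for x
  define U2 where "U2 x = 1 * (h\<^sup>2 * \<gamma>1'' x + (- 2 * h) * \<gamma>2'' x) + 1 * \<gamma>3'' x" for x
  have CU: "C2_on {0<..} U U1 U2"
    unfolding U_def[abs_def] U1_def[abs_def] U2_def[abs_def]
    by (intro C2_on_lincomb \<gamma>1 \<gamma>2 \<gamma>3)
  have CU_I: "C2_on ?I U U1 U2" by (rule C2_on_subset[OF CU Ipos])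
  have U_bd: "U a = 0" "U b = 0" using \<gamma>1 \<gamma>2 \<gamma>3 by (simp_all add: U_def)
  have genU: "generator r \<sigma> U U1 U2 x = - fcost r \<sigma> K x h" if x: "x \<in> ?I" for x
    unfolding U_def[abs_def] U1_def[abs_def] U2_def[abs_def] generator_lincomb gen1[OF x] gen2[OF x] gen3[OF x] fcost_expand
    by simp
  have DU: "Dynkin_pair U (\<lambda>s. - fcost r \<sigma> K s h)"
  proof (rule Dynkin_pair_cong[OF _ _ _ bounded_borel_fcost])
    show D: "Dynkin_pair U (\<lambda>s. 1 * (h\<^sup>2 * (- \<sigma>\<^sup>2 * s powr 2) + (- 2 * h) * (- (- ?c * \<sigma>\<^sup>2) * s powr (1 - ?d)))
        + 1 * (- (?c\<^sup>2 * \<sigma>\<^sup>2) * s powr (- 2 * ?d)))"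
      unfolding U_def[abs_def] by (intro Dynkin_pair_lincomb \<gamma>1 \<gamma>2 \<gamma>3)
    show "bounded_borel U" by (rule Dynkin_pairD(1)[OF D])
    fix s assume "s \<in> ?I"
    then have s: "s \<ge> a" by simp
    show "- fcost r \<sigma> K s h = 1 * (h\<^sup>2 * (- \<sigma>\<^sup>2 * s powr 2) + (- 2 * h) * (- (- ?c * \<sigma>\<^sup>2) * s powr (1 - ?d)))
        + 1 * (- (?c\<^sup>2 * \<sigma>\<^sup>2) * s powr (- 2 * ?d))"
      unfolding fcost_expand sources[OF s] by (simp add: algebra_simps)
  qed simp
  define \<phi> where "\<phi> x = 1 * U x + (-1) * ?M x" for x
  define \<phi>1 where "\<phi>1 x = 1 * U1 x + (-1) * M1 x" for x
  define \<phi>2 where "\<phi>2 x = 1 * U2 x + (-1) * M2 x" for x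
  have C\<phi>: "C2_on ?I \<phi> \<phi>1 \<phi>2"
    unfolding \<phi>_def[abs_def] \<phi>1_def[abs_def] \<phi>2_def[abs_def] by (rule C2_on_lincomb[OF CU_I CM])
  have gen\<phi>: "generator r \<sigma> \<phi> \<phi>1 \<phi>2 x = - Gfun Mp W r \<sigma> K a b x h" if x: "x \<in> ?I" for x
  proof -
    have "Gfun Mp W r \<sigma> K a b x h = generator r \<sigma> ?M M1 M2 x + fcost r \<sigma> K x h"
      unfolding Gfun_def C2_on_deriv2[OF CM open_greaterThanLessThan x] generator_def ..
    then show ?thesis
      unfolding \<phi>_def[abs_def] \<phi>1_def[abs_def] \<phi>2_def[abs_def] generator_lincomb genU[OF x] by simp
  qed
  have c\<gamma>1: "continuous_on {a..b} \<gamma>1" by (rule continuous_on_subset[OF C2_onD(3)[OF \<gamma>1(1)] abpos])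
  have \<phi>_cont: "continuous_on {a..b} \<phi>"
  proof (rule continuous_on_of_dominated_boundary)
    show "continuous_on ?I \<phi>" by (rule C2_onD(3)[OF C\<phi>])
    \<comment> \<open>This is \<open>(\<bar>h\<bar> + 2)\<^sup>2\<close> multiplied out. It bounds
      \<open>(h - \<gamma>2 / \<gamma>1)\<^sup>2\<close>, the quotient of \<open>\<phi>\<close> and
      \<open>\<gamma>1\<close>.\<close>
    let ?C = "h\<^sup>2 + 4 * \<bar>h\<bar> + 4"
    show "continuous_on {a..b} (\<lambda>x. ?C * \<gamma>1 x)" by (intro continuous_intros c\<gamma>1)
    show "?C * \<gamma>1 a = 0" "?C * \<gamma>1 b = 0" using \<gamma>1 by simp_all
    fix x assume x: "x \<in> {a..b}"
    show "\<bar>\<phi> x\<bar> \<le> ?C * \<gamma>1 x"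
    proof (cases "x \<in> ?I")
      case True
      let ?q = "\<gamma>2 x / \<gamma>1 x"
      have p: "\<gamma>1 x > 0" by (rule pos1[OF True])
      have q: "\<bar>?q\<bar> \<le> 2" using abs2[OF True] p by (simp add: abs_divide pos_divide_le_eq)
      have "\<phi> x = (h - ?q)\<^sup>2 * \<gamma>1 x"
        unfolding \<phi>_def U_def M_eq[OF True] using p by (simp add: power2_eq_square field_simps)
      moreover have "(h - ?q)\<^sup>2 \<le> ?C"
      proof -
        have "\<bar>h - ?q\<bar> \<le> \<bar>h\<bar> + 2" using q by linarith
        then have "\<bar>h - ?q\<bar>\<^sup>2 \<le> (\<bar>h\<bar> + 2)\<^sup>2" by (intro power_mono) auto
        then show ?thesis by (simp add: power2_eq_square algebra_simps)
      qed
      ultimately show ?thesis using p by (simp add: abs_mult mult_right_mono)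
    next
      case False
      then have "x = a \<or> x = b" using x by auto
      then show ?thesis using U_bd M_bd \<gamma>1(2,3) by (auto simp: \<phi>_def)
    qed
  qed
  have bbM: "bounded_borel ?M"
  proof -
    have "?M = (\<lambda>x. indicator ?I x *\<^sub>R ?M x)" by (auto simp: Mfun_def indicator_def fun_eq_iff)
    moreover have "(\<lambda>x. indicator ?I x *\<^sub>R ?M x) \<in> borel_measurable borel"
      by (rule borel_measurable_continuous_on_indicator[OF _ C2_onD(3)[OF CM]]) simp
    ultimately have "?M \<in> borel_measurable borel" by simp
    moreover obtain C1 where C1: "\<And>x. x \<in> {a..b} \<Longrightarrow> \<bar>U x\<bar> \<le> C1"
      using continuous_on_abs_bounded[OF continuous_on_subset[OF C2_onD(3)[OF CU] abpos]] by blast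
    moreover obtain C2 where C2: "\<And>x. x \<in> {a..b} \<Longrightarrow> \<bar>\<phi> x\<bar> \<le> C2"
      using continuous_on_abs_bounded[OF \<phi>_cont] by blast
    \<comment> \<open>\<open>?M = U - \<phi>\<close>, and both terms are continuous up to the
      boundary.\<close>
    have "\<bar>?M x\<bar> \<le> max 0 (C1 + C2)" if "x \<in> {a..b}" for x
      using C1[OF that] C2[OF that] by (simp add: \<phi>_def le_max_iff_disj)
    ultimately show ?thesis unfolding bounded_borel_def by (intro conjI exI[of _ "max 0 (C1 + C2)"]) auto
  qed
  let ?\<beta> = lower_root and ?\<delta> = root_gap
  note \<delta> = root_gap_pos
  define A where "A = a powr ?\<delta>"
  define B where "B = b powr ?\<delta>"
  \<comment> \<open>\<open>\<phi>\<close> divided by \<open>x powr ?\<beta>\<close> and read in the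
    coordinate \<open>y = x powr ?\<delta>\<close>; \<open>F1\<close> and \<open>F2\<close> will be
    its derivatives in \<open>y\<close>.\<close>
  define F where "F = lift (- ?\<beta> / ?\<delta>) (1 / ?\<delta>) \<phi>"
  define F1 where "F1 = lift1 (- ?\<beta> / ?\<delta>) (1 / ?\<delta>) \<phi> \<phi>1"
  define F2 where "F2 = lift2 (- ?\<beta> / ?\<delta>) (1 / ?\<delta>) \<phi> \<phi>1 \<phi>2"
  have A0: "A > 0" and AB: "A < B" using a_pos a_less_b_powr by (simp_all add: A_def B_def)
  have inv: "(y powr (1 / ?\<delta>)) powr ?\<delta> = y" if "y > 0" for y using that \<delta> by (simp add: powr_powr)
  have inv': "(x powr ?\<delta>) powr (1 / ?\<delta>) = x" if "x > 0" for x using that \<delta> by (simp add: powr_powr)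
  have to_AB: "x powr ?\<delta> \<in> {A..B}" if "x \<in> {a..b}" for x
    using that a_pos \<delta> by (auto simp: A_def B_def intro!: powr_mono2)
  have to_AB': "x powr ?\<delta> \<in> {A<..<B}" if "x \<in> ?I" for x
    using that a_pos \<delta> by (auto simp: A_def B_def intro!: powr_less_mono2)
  have aA: "A powr (1 / ?\<delta>) = a" "B powr (1 / ?\<delta>) = b" using a_pos a_less_b inv' by (simp_all add: A_def B_def)
  have from_AB: "y powr (1 / ?\<delta>) \<in> {a..b}" if y: "y \<in> {A..B}" for y
  proof -
    have "A powr (1 / ?\<delta>) \<le> y powr (1 / ?\<delta>)" "y powr (1 / ?\<delta>) \<le> B powr (1 / ?\<delta>)"
      using y A0 \<delta> by (auto intro!: powr_mono2)
    then show ?thesis unfolding aA by simp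
  qed
  have from_AB': "y powr (1 / ?\<delta>) \<in> ?I" if y: "y \<in> {A<..<B}" for y
  proof -
    have "A powr (1 / ?\<delta>) < y powr (1 / ?\<delta>)" "y powr (1 / ?\<delta>) < B powr (1 / ?\<delta>)"
      using y A0 \<delta> by (auto intro!: powr_less_mono2)
    then show ?thesis unfolding aA by simp
  qed
  have Fc: "continuous_on {A..B} F"
    unfolding F_def by (rule lift_continuous[OF \<phi>_cont]) (use A0 from_AB in auto)
  have F1d: "(F has_real_derivative F1 y) (at y)" if y: "y \<in> {A<..<B}" for y
    unfolding F_def F1_def by (rule lift_deriv) (use y A0 C2_onD(1)[OF C\<phi> from_AB'[OF y]] in auto)
  have F2d: "(F1 has_real_derivative F2 y) (at y)" if y: "y \<in> {A<..<B}" for y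
    unfolding F1_def F2_def
    by (rule lift1_deriv) (use y A0 C2_onD(1)[OF C\<phi> from_AB'[OF y]] C2_onD(2)[OF C\<phi> from_AB'[OF y]] in auto)
  have F2c: "continuous_on {A<..<B} F2"
    unfolding F2_def by (rule lift2_continuous[OF C2_onD(3,4,5)[OF C\<phi>]]) (use A0 from_AB' in auto)
  have \<phi>_lift: "lift ?\<beta> ?\<delta> F x = \<phi> x" if "x > 0" for x
    unfolding F_def by (rule lift_lift) (use that \<delta> in auto)
  \<comment> \<open>Uniqueness of the derivative replaces a computation with powers.\<close>
  have \<phi>1_lift: "lift1 ?\<beta> ?\<delta> F F1 x = \<phi>1 x" if x: "x \<in> ?I" for x
  proof -
    have x0: "x > 0" using x a_pos by simp
    have "(lift ?\<beta> ?\<delta> F has_real_derivative lift1 ?\<beta> ?\<delta> F F1 x) (at x)"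
      by (rule lift_deriv[where ?H1.0=F1, OF x0 F1d[OF to_AB'[OF x]]])
    then have "(\<phi> has_real_derivative lift1 ?\<beta> ?\<delta> F F1 x) (at x)"
      by (rule has_field_derivative_transform_within_open[of _ _ _ "{0<..}"]) (use x0 \<phi>_lift in auto)
    then show ?thesis using C2_onD(1)[OF C\<phi> x] by (rule DERIV_unique)
  qed
  have \<phi>2_lift: "lift2 ?\<beta> ?\<delta> F F1 F2 x = \<phi>2 x" if x: "x \<in> ?I" for x
  proof -
    have x0: "x > 0" using x a_pos by simp
    have "(lift1 ?\<beta> ?\<delta> F F1 has_real_derivative lift2 ?\<beta> ?\<delta> F F1 F2 x) (at x)"
      by (rule lift1_deriv[where ?H1.0=F1 and ?H2.0=F2, OF x0 F1d[OF to_AB'[OF x]] F2d[OF to_AB'[OF x]]])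
    then have "(\<phi>1 has_real_derivative lift2 ?\<beta> ?\<delta> F F1 F2 x) (at x)"
      by (rule has_field_derivative_transform_within_open[of _ _ _ ?I]) (use x \<phi>1_lift in auto)
    then show ?thesis using C2_onD(2)[OF C\<phi> x] by (rule DERIV_unique)
  qed
  have root: "\<sigma>\<^sup>2 / 2 * ?\<beta> * (?\<beta> - 1) + r * ?\<beta> - 2 * r = 0" using symbol_lower_root by (simp add: symbol_def)
  have weight: "0 < \<sigma>\<^sup>2 / 2 * ?\<delta>\<^sup>2 * x powr (?\<beta> + 2 * ?\<delta>)" if "x > 0" for x
    using that \<delta> \<sigma>_pos by simp
  \<comment> \<open>Inflection points of \<open>F\<close> correspond to roots of \<open>G\<close>;
    this is how assumption (Z) reaches the envelope.\<close>
  have G_F2: "\<sigma>\<^sup>2 / 2 * ?\<delta>\<^sup>2 * x powr (?\<beta> + 2 * ?\<delta>) * F2 (x powr ?\<delta>) = - Gfun Mp W r \<sigma> K a b x h"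
    if x: "x \<in> ?I" for x
  proof -
    have x0: "x > 0" using x a_pos by simp
    have "generator r \<sigma> (lift ?\<beta> ?\<delta> F) (lift1 ?\<beta> ?\<delta> F F1) (lift2 ?\<beta> ?\<delta> F F1 F2) x = generator r \<sigma> \<phi> \<phi>1 \<phi>2 x"
      unfolding generator_def \<phi>_lift[OF x0] \<phi>1_lift[OF x] \<phi>2_lift[OF x] ..
    then show ?thesis unfolding gen\<phi>[OF x] generator_lift[OF x0 root root_sum] .
  qed
  have finite_F2: "finite {y\<in>{A<..<B}. F2 y = 0}"
  proof (rule finite_subset[OF _ finite_imageI[OF Z, of "\<lambda>x. x powr ?\<delta>"]], rule subsetI)
    fix y assume y: "y \<in> {y\<in>{A<..<B}. F2 y = 0}"
    then have "y > 0" using A0 by simp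
    then have "F2 ((y powr (1 / ?\<delta>)) powr ?\<delta>) = 0" using y inv by simp
    moreover have yI: "y powr (1 / ?\<delta>) \<in> ?I" using y from_AB' by blast
    ultimately have "Gfun Mp W r \<sigma> K a b (y powr (1 / ?\<delta>)) h = 0" using G_F2[OF yI] by simp
    then show "y \<in> (\<lambda>x. x powr ?\<delta>) ` {x\<in>?I. Gfun Mp W r \<sigma> K a b x h = 0}"
      using yI inv[OF \<open>y > 0\<close>] by (intro image_eqI[of _ _ "y powr (1 / ?\<delta>)"]) auto
  qed
  interpret E: smooth_concave_envelope F A B F1 F2
    by unfold_locales (rule AB Fc finite_F2 | rule F1d, assumption | rule F2d, assumption)+
  define w where "w = lift ?\<beta> ?\<delta> E.env"
  define w1 where "w1 = lift1 ?\<beta> ?\<delta> E.env E.env1"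
  \<comment> \<open>The second derivative of the envelope outside
    \<open>E.exceptional\<close>.\<close>
  define e2 where "e2 y = (if y \<in> E.contacts then F2 y else 0)" for y
  define w2 where "w2 = lift2 ?\<beta> ?\<delta> E.env E.env1 e2"
  have V_eq: "Vfun Mp W r \<sigma> K a b x h = U x - w x" if x: "x \<in> {a..b}" for x
  proof -
    let ?y = "x powr ?\<delta>"
    have x0: "x > 0" using x a_pos by simp
    have y: "?y \<in> {A..B}" by (rule to_AB[OF x])
    have "Vfun Mp W r \<sigma> K a b x h = (INF \<tau> \<in> stopT Mp W r \<sigma> a b x.
      expectation (\<lambda>\<omega>. pathint (\<lambda>s. fcost r \<sigma> K s h) x (\<tau> \<omega>) \<omega> + exp (-2 * r * \<tau> \<omega>) * ?M (S x (\<tau> \<omega>) \<omega>)))"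
      unfolding Vfun_def pathint_def ..
    also have "\<dots> = U x - w x"
    proof (rule optimal_stopping_value[OF DU bbM x])
      fix e :: real assume e: "e > 0"
      \<comment> \<open>The slack is divided by \<open>x powr ?\<beta>\<close> because
        \<open>lift\<close> multiplies by this weight.\<close>
      obtain m c where mc: "E.majorant m c" "m * ?y + c < E.env ?y + e / x powr ?\<beta>"
        using E.env_approx[of "e / x powr ?\<beta>" ?y] e x0 by auto
      have "U s - ?M s \<le> lift ?\<beta> ?\<delta> (\<lambda>y. m * y + c) s" if s: "s \<in> {a..b}" for s
      proof -
        have s0: "s > 0" using s a_pos by simp
        have "U s - ?M s = lift ?\<beta> ?\<delta> F s" unfolding \<phi>_lift[OF s0] by (simp add: \<phi>_def)
        also have "\<dots> \<le> lift ?\<beta> ?\<delta> (\<lambda>y. m * y + c) s"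
          unfolding lift_def using mc(1) to_AB[OF s] by (intro mult_left_mono) (auto simp: E.majorant_def)
        finally show ?thesis .
      qed
      moreover have "lift ?\<beta> ?\<delta> (\<lambda>y. m * y + c) x \<le> w x + e"
      proof -
        have "x powr ?\<beta> * (m * ?y + c) \<le> x powr ?\<beta> * (E.env ?y + e / x powr ?\<beta>)"
          using mc(2) by (intro mult_left_mono) auto
        also have "\<dots> = w x + e" using x0 by (simp add: w_def lift_def distrib_left)
        finally show ?thesis by (simp add: lift_def)
      qed
      ultimately show "\<exists>l. Dynkin_pair l (\<lambda>_. 0) \<and> (\<forall>s\<in>{a..b}. U s - ?M s \<le> l s) \<and> l x \<le> w x + e"
        using Dynkin_pair_affine by blast
    next
      obtain m c p q where pq: "E.env ?y = m * ?y + c" "A \<le> p" "p \<le> ?y" "?y \<le> q" "q \<le> B"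
        "F p = m * p + c" "F q = m * q + c"
      proof (cases "?y \<in> {A<..<B}")
        case True then show ?thesis using E.chord[OF True] that by metis
      next
        case False
        then have "?y = A \<or> ?y = B" using y by auto
        then have "E.env ?y = F ?y" by (rule E.env_endpoint)
        \<comment> \<open>At an end of \<open>[A,B]\<close> a degenerate chord with
          \<open>p = q\<close> and slope 0 serves; the corresponding exit is immediate.\<close>
        then show ?thesis using that[of 0 "F ?y" ?y ?y] y by auto
      qed
      have pos: "p > 0" "q > 0" using A0 pq by auto
      have touch: "lift ?\<beta> ?\<delta> (\<lambda>y. m * y + c) (t powr (1 / ?\<delta>)) = U (t powr (1 / ?\<delta>)) - ?M (t powr (1 / ?\<delta>))"
        if t: "t > 0" "F t = m * t + c" for t
      proof -
        have t': "t powr (1 / ?\<delta>) > 0" using t(1) by simp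
        have "lift ?\<beta> ?\<delta> (\<lambda>y. m * y + c) (t powr (1 / ?\<delta>)) = lift ?\<beta> ?\<delta> F (t powr (1 / ?\<delta>))"
          unfolding lift_def inv[OF t(1)] t(2) ..
        also have "\<dots> = \<phi> (t powr (1 / ?\<delta>))" by (rule \<phi>_lift[OF t'])
        finally show ?thesis by (simp add: \<phi>_def)
      qed
      have "p powr (1 / ?\<delta>) \<le> ?y powr (1 / ?\<delta>)" "?y powr (1 / ?\<delta>) \<le> q powr (1 / ?\<delta>)"
        using pq pos \<delta> x0 by (auto intro!: powr_mono2)
      then have "p powr (1 / ?\<delta>) \<le> x" "x \<le> q powr (1 / ?\<delta>)" unfolding inv'[OF x0] by auto
      moreover have "p powr (1 / ?\<delta>) \<in> {a..b}" "q powr (1 / ?\<delta>) \<in> {a..b}"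
      proof -
        have in_AB: "p \<in> {A..B}" "q \<in> {A..B}" using pq y by auto
        show "p powr (1 / ?\<delta>) \<in> {a..b}" "q powr (1 / ?\<delta>) \<in> {a..b}" by (rule from_AB[OF in_AB(1)], rule from_AB[OF in_AB(2)])
      qed
      moreover have "lift ?\<beta> ?\<delta> (\<lambda>y. m * y + c) x = w x" unfolding w_def lift_def pq(1) ..
      ultimately show "\<exists>l p q. Dynkin_pair l (\<lambda>_. 0) \<and> a \<le> p \<and> p \<le> x \<and> x \<le> q \<and> q \<le> b \<and>
          l p = U p - ?M p \<and> l q = U q - ?M q \<and> l x = w x"
        using touch[OF pos(1) pq(6)] touch[OF pos(2) pq(7)] Dynkin_pair_affine[of m c]
        by (intro exI[of _ "lift ?\<beta> ?\<delta> (\<lambda>y. m * y + c)"] exI[of _ "p powr (1 / ?\<delta>)"] exI[of _ "q powr (1 / ?\<delta>)"]) simp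
    qed
    finally show ?thesis .
  qed
  have env_c: "continuous_on {A<..<B} E.env" by (rule continuous_on_subset[OF E.env_continuous]) auto
  have w_c: "continuous_on {a..b} w"
    unfolding w_def by (rule lift_continuous[OF E.env_continuous]) (use a_pos to_AB in auto)
  have w1_c: "continuous_on ?I w1"
    unfolding w1_def by (rule lift1_continuous[OF env_c E.env1_continuous]) (use a_pos to_AB' in auto)
  have w1_d: "(w has_real_derivative w1 x) (at x)" if x: "x \<in> ?I" for x
    unfolding w_def w1_def by (rule lift_deriv[where ?H1.0=E.env1, OF _ E.env_deriv[OF to_AB'[OF x]]]) (use x a_pos in auto)
  let ?Ex = "{x\<in>?I. x powr ?\<delta> \<in> E.exceptional}"
  have fin: "finite ?Ex"
  proof (rule finite_subset[OF _ finite_imageI[OF E.finite_exceptional, of "\<lambda>y. y powr (1 / ?\<delta>)"]], rule subsetI)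
    fix x assume x: "x \<in> ?Ex"
    then have "x > 0" using a_pos by simp
    then show "x \<in> (\<lambda>y. y powr (1 / ?\<delta>)) ` E.exceptional"
      using x inv' by (intro image_eqI[of _ _ "x powr ?\<delta>"]) auto
  qed
  have w2_d: "(w1 has_real_derivative w2 x) (at x)" if x: "x \<in> ?I - ?Ex" for x
  proof -
    have xI: "x \<in> ?I" and x0: "x > 0" using x a_pos by auto
    have "x powr ?\<delta> \<notin> E.exceptional" using x by blast
    from E.env1_deriv[OF to_AB'[OF xI] this]
    have "(E.env1 has_real_derivative e2 (x powr ?\<delta>)) (at (x powr ?\<delta>))" unfolding e2_def .
    then show ?thesis unfolding w1_def w2_def by (rule lift1_deriv[where ?H1.0=E.env1 and ?H2.0=e2, OF x0 E.env_deriv[OF to_AB'[OF xI]]])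
  qed
  \<comment> \<open>\<open>w2\<close> may jump at the ends of gaps. Without the term in
    \<open>e2\<close> it is \<open>T0\<close>, continuous on \<open>?I\<close>; the rest is the
    continuous \<open>T2\<close> restricted to the contact set. Measurability and local bounds for
    \<open>u2\<close> follow from this splitting.\<close>
  define T0 where "T0 = lift2 ?\<beta> ?\<delta> E.env E.env1 (\<lambda>_. 0)"
  define T2 where "T2 x = ?\<delta>\<^sup>2 * x powr (?\<beta> + 2 * ?\<delta> - 2) * F2 (x powr ?\<delta>)" for x
  let ?X = "{x\<in>?I. x powr ?\<delta> \<in> E.contacts}"
  define u2 where "u2 x = indicator ?I x *\<^sub>R (U2 x - T0 x) - indicator ?X x *\<^sub>R T2 x" for x
  have u2_eq: "u2 x = U2 x - w2 x" if "x \<in> ?I" for x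
    using that by (simp add: u2_def w2_def T0_def T2_def lift2_def e2_def)
  have T0_c: "continuous_on ?I T0"
    unfolding T0_def by (rule lift2_continuous[OF env_c E.env1_continuous continuous_on_const]) (use a_pos to_AB' in auto)
  have T2_c: "continuous_on ?I T2"
  proof -
    have p: "continuous_on ?I (\<lambda>x. x powr q)" for q using a_pos by (intro continuous_intros) auto
    have "continuous_on ?I (\<lambda>x. F2 (x powr ?\<delta>))"
      by (rule continuous_on_compose2[OF F2c p]) (use to_AB' in auto)
    then show ?thesis unfolding T2_def[abs_def] by (intro continuous_intros p)
  qed
  have U2_c: "continuous_on ?I U2" by (rule C2_onD(5)[OF CU_I])
  have contact_iff: "x powr ?\<delta> \<in> E.contacts \<longleftrightarrow> w x = \<phi> x" if x: "x \<in> ?I" for x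
  proof -
    have x0: "x > 0" using x a_pos by simp
    show ?thesis
      unfolding \<phi>_lift[OF x0, symmetric] w_def lift_def E.contacts_def using to_AB'[OF x] x0 by simp
  qed
  have w_ge: "\<phi> x \<le> w x" if x: "x \<in> {a..b}" for x
  proof -
    have x0: "x > 0" using x a_pos by simp
    show ?thesis
      unfolding \<phi>_lift[OF x0, symmetric] w_def lift_def using E.env_ge[OF to_AB[OF x]] by (intro mult_left_mono) auto
  qed
  \<comment> \<open>The contact set is the zero set in \<open>?I\<close> of
    \<open>w - \<phi>\<close>, which is continuous there.\<close>
  have X_borel: "?X \<in> sets borel"
  proof -
    have [measurable]: "(\<lambda>x. indicator ?I x *\<^sub>R (w x - \<phi> x)) \<in> borel_measurable borel"
    proof (rule borel_measurable_continuous_on_indicator)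
      have "continuous_on ?I w" by (rule continuous_on_subset[OF w_c]) auto
      then show "continuous_on ?I (\<lambda>x. w x - \<phi> x)" using C2_onD(3)[OF C\<phi>] by (intro continuous_intros)
    qed simp
    have "{x \<in> space borel. indicator ?I x *\<^sub>R (w x - \<phi> x) = 0} \<in> sets borel" by measurable
    moreover have "?X = ?I \<inter> {x \<in> space borel. indicator ?I x *\<^sub>R (w x - \<phi> x) = 0}"
      using contact_iff by auto
    ultimately show ?thesis by simp
  qed
  show ?thesis
  proof (rule obstacle_solutionI[where ?u1.0="\<lambda>x. U1 x - w1 x" and ?u2.0=u2 and E="?Ex" and g="\<lambda>x. \<bar>U2 x - T0 x\<bar> + \<bar>T2 x\<bar>"])
    have "continuous_on {a..b} (\<lambda>x. U x - w x)"
      by (intro continuous_intros w_c continuous_on_subset[OF C2_onD(3)[OF CU] abpos])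
    then show "continuous_on {a..b} (\<lambda>x. Vfun Mp W r \<sigma> K a b x h)"
      by (rule continuous_on_eq) (rule V_eq[symmetric])
    have wa: "w a = 0" "w b = 0"
    proof -
      have "w x = \<phi> x" if "x = a \<or> x = b" for x
      proof -
        have x0: "x > 0" using that a_pos a_less_b by auto
        have "x powr ?\<delta> = A \<or> x powr ?\<delta> = B" using that by (auto simp: A_def B_def)
        from E.env_endpoint[OF this] show ?thesis unfolding \<phi>_lift[OF x0, symmetric] w_def lift_def by simp
      qed
      then show "w a = 0" "w b = 0" using U_bd M_bd by (simp_all add: \<phi>_def)
    qed
    show "Vfun Mp W r \<sigma> K a b a h = 0" "Vfun Mp W r \<sigma> K a b b h = 0"
      using V_eq[of a] V_eq[of b] wa U_bd a_less_b by auto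
    show "((\<lambda>x. Vfun Mp W r \<sigma> K a b x h) has_real_derivative U1 x - w1 x) (at x)" if x: "x \<in> ?I" for x
    proof (rule has_field_derivative_transform_within_open[OF _ open_greaterThanLessThan x])
      show "((\<lambda>x. U x - w x) has_real_derivative U1 x - w1 x) (at x)"
        by (intro DERIV_diff C2_onD(1)[OF CU_I x] w1_d[OF x])
      show "U y - w y = Vfun Mp W r \<sigma> K a b y h" if "y \<in> ?I" for y using V_eq[of y] that by auto
    qed
    show "continuous_on ?I (\<lambda>x. U1 x - w1 x)" by (intro continuous_intros w1_c C2_onD(4)[OF CU_I])
    show "finite ?Ex" by (rule fin)
    show "((\<lambda>x. U1 x - w1 x) has_real_derivative u2 x) (at x)" if x: "x \<in> ?I - ?Ex" for x
    proof -
      have xI: "x \<in> ?I" using x by blast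
      show ?thesis unfolding u2_eq[OF xI] by (intro DERIV_diff C2_onD(2)[OF CU_I xI] w2_d[OF x])
    qed
    show "u2 \<in> borel_measurable borel"
    proof -
      have "(\<lambda>x. indicator ?I x *\<^sub>R (U2 x - T0 x)) \<in> borel_measurable borel"
        by (rule borel_measurable_continuous_on_indicator) (auto intro!: continuous_intros U2_c T0_c)
      moreover have "(\<lambda>x. indicator ?X x *\<^sub>R T2 x) \<in> borel_measurable borel"
        by (rule borel_measurable_continuous_on_indicator[OF X_borel continuous_on_subset[OF T2_c]]) auto
      ultimately show ?thesis unfolding u2_def[abs_def] by measurable
    qed
    show "continuous_on ?I (\<lambda>x. \<bar>U2 x - T0 x\<bar> + \<bar>T2 x\<bar>)" by (intro continuous_intros U2_c T0_c T2_c)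
    show "\<bar>u2 x\<bar> \<le> \<bar>U2 x - T0 x\<bar> + \<bar>T2 x\<bar>" for x
      unfolding u2_def by (auto simp: indicator_def)
    fix x assume x: "x \<in> ?I - ?Ex"
    have xI: "x \<in> ?I" and x': "x \<in> {a..b}" and x0: "x > 0" using x a_pos by auto
    have "generator r \<sigma> w w1 w2 x = \<sigma>\<^sup>2 / 2 * ?\<delta>\<^sup>2 * x powr (?\<beta> + 2 * ?\<delta>) * e2 (x powr ?\<delta>)"
      unfolding w_def w1_def w2_def by (rule generator_lift[OF x0 root root_sum])
    moreover have "generator r \<sigma> U U1 U2 x - generator r \<sigma> w w1 w2 x =
        \<sigma>\<^sup>2 / 2 * x\<^sup>2 * u2 x + r * x * (U1 x - w1 x) - 2 * r * (U x - w x)"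
      unfolding generator_def u2_eq[OF xI] by (simp add: algebra_simps diff_divide_distrib)
    \<comment> \<open>\<open>U\<close> has generator \<open>- f\<close>, so for
      \<open>V = U - w\<close> the first entry of the minimum is minus the generator of
      \<open>w\<close>, a weighted \<open>e2\<close>.\<close>
    ultimately have L: "\<sigma>\<^sup>2 / 2 * x\<^sup>2 * u2 x + r * x * (U1 x - w1 x) - 2 * r * (U x - w x) + fcost r \<sigma> K x h =
        - (\<sigma>\<^sup>2 / 2 * ?\<delta>\<^sup>2 * x powr (?\<beta> + 2 * ?\<delta>) * e2 (x powr ?\<delta>))"
      using genU[OF xI] by linarith
    have gap: "?M x - (U x - w x) = w x - \<phi> x" by (simp add: \<phi>_def)
    \<comment> \<open>In contact, concavity makes the first entry nonnegative and the second is 0;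
      off contact the first is 0 and the second nonnegative.\<close>
    have "min (- (\<sigma>\<^sup>2 / 2 * ?\<delta>\<^sup>2 * x powr (?\<beta> + 2 * ?\<delta>) * e2 (x powr ?\<delta>))) (w x - \<phi> x) = 0"
    proof (cases "x powr ?\<delta> \<in> E.contacts")
      case True
      then have "\<sigma>\<^sup>2 / 2 * ?\<delta>\<^sup>2 * x powr (?\<beta> + 2 * ?\<delta>) * e2 (x powr ?\<delta>) \<le> 0"
        using weight[OF x0] E.F2_contact_nonpos[OF True] by (intro mult_nonneg_nonpos) (auto simp: e2_def)
      moreover have "w x - \<phi> x = 0" using True contact_iff[OF xI] by simp
      ultimately show ?thesis by simp
    next
      case False
      then show ?thesis using w_ge[OF x'] by (simp add: e2_def)
    qed
    then show "min (\<sigma>\<^sup>2 / 2 * x\<^sup>2 * u2 x + r * x * (U1 x - w1 x) - 2 * r * Vfun Mp W r \<sigma> K a b x h + fcost r \<sigma> K x h)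
        (?M x - Vfun Mp W r \<sigma> K a b x h) = 0"
      unfolding V_eq[OF x'] L gap .
  qed
qed

end

theorem mainTheorem10:
  fixes Mp :: "'a measure" and W :: "real \<Rightarrow> 'a \<Rightarrow> real"
    and r \<sigma> K a b h :: real
  assumes BM: "std_BM Mp W"
    and complete: "complete_space_measure Mp"
    and r: "r > 0" and \<sigma>: "\<sigma> > 0" and K: "K > 0"
    and ab: "ahat r \<sigma> K \<le> a" "a < b"
    and Z: "\<forall>h'\<in>{Pd r \<sigma> K a..Pd r \<sigma> K b}.
              finite {x\<in>{a<..<b}. Gfun Mp W r \<sigma> K a b x h' = 0} \<and>
              card {x\<in>{a<..<b}. Gfun Mp W r \<sigma> K a b x h' = 0} \<le> 2"
    and h: "h \<in> {Pd r \<sigma> K a..Pd r \<sigma> K b}"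
  shows "obstacle_solution r \<sigma> a b (\<lambda>x. fcost r \<sigma> K x h) (Mfun Mp W r \<sigma> K a b)
           (\<lambda>x. Vfun Mp W r \<sigma> K a b x h)
       \<and> (\<forall>u. obstacle_solution r \<sigma> a b (\<lambda>x. fcost r \<sigma> K x h) (Mfun Mp W r \<sigma> K a b) u
              \<longrightarrow> (\<forall>x\<in>{a..b}. u x = Vfun Mp W r \<sigma> K a b x h))"
proof -
  have a: "0 < a"
  proof -
    have "dpar r \<sigma> > 0" using r \<sigma> by (simp add: dpar_def)
    then have "ahat r \<sigma> K > 0" using K by (simp add: ahat_def add_pos_pos)
    then show ?thesis using ab by simp
  qed
  have "prob_space Mp" using BM by (simp add: std_BM_def)
  then interpret prob_space Mp .
  interpret put_hedging Mp W r \<sigma> a b K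
    using BM r \<sigma> K ab a by unfold_locales auto
  have V: "obstacle_solution r \<sigma> a b (\<lambda>x. fcost r \<sigma> K x h) (Mfun Mp W r \<sigma> K a b)
      (\<lambda>x. Vfun Mp W r \<sigma> K a b x h)"
    by (rule value_function_solves_obstacle_problem) (use Z h in blast)
  show ?thesis
    using V obstacle_solution_le[OF a ab(2) r \<sigma> V] obstacle_solution_le[OF a ab(2) r \<sigma> _ V]
    by (auto intro!: antisym)
qed

end
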